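(* Let $A$ be a brick-finite finite dimensional algebra over a field $k$. If $A$ is brick-directed, then each brick in $\operatorname{mod} A$ is uniquely determined by its dimension vector; that is, if $X$ and $Y$ are non-isomorphic bricks in $\operatorname{mod} A$, then $\underline{\dim} X\neq\underline{\dim} Y$.
   Context: $\operatorname{mod} A$ is the category of finitely generated left $A$-modules. A brick is a module $X\in\operatorname{mod} A$ such that $\operatorname{End}_A(X)$ is a division algebra. $A$ is brick-finite if there are only finitely many isomorphism classes of bricks. A brick-cycle is a sequence $X_0\xrightarrow{f_1}X_1\to\cdots\xrightarrow{f_m}X_m$ with $m\ge 1$, all $X_i$ bricks, $X_0\simeq X_m$, and each $f_j$ non-zero and non-invertible. $A$ is brick-directed if $\operatorname{mod} A$ contains no brick-cycle. The dimension vector $\underline{\dim}X$ is the class $[X]$ of $X$ in the Grothendieck group $K_0(\operatorname{mod} A)$, i.e. the vector of composition multiplicities of the simple modules in $X$. *)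

theory Defs
  imports "HOL-Algebra.Module" "HOL-Algebra.Free_Abelian_Groups"
begin

section \<open>Finite dimensional algebras and their modules\<close>

text \<open>
  The locale \<^locale>\<open>algebra\<close> of the library demands a commutative multiplication. Here \<open>A\<close> is a
  \<open>K\<close>-module record that is also a unital, associative, not necessarily commutative ring.
\<close>

locale fin_dim_algebra = K: field K + KA: module K A + A: ring A
  for K :: "('k, 'r) ring_scheme" and A :: "('k, 'a, 's) module_scheme" +
  assumes smult_mult_left: "\<lbrakk>c \<in> carrier K; a \<in> carrier A; b \<in> carrier A\<rbrakk> \<Longrightarrow>
      (c \<odot>\<^bsub>A\<^esub> a) \<otimes>\<^bsub>A\<^esub> b = c \<odot>\<^bsub>A\<^esub> (a \<otimes>\<^bsub>A\<^esub> b)"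
    and smult_mult_right: "\<lbrakk>c \<in> carrier K; a \<in> carrier A; b \<in> carrier A\<rbrakk> \<Longrightarrow>
      a \<otimes>\<^bsub>A\<^esub> (c \<odot>\<^bsub>A\<^esub> b) = c \<odot>\<^bsub>A\<^esub> (a \<otimes>\<^bsub>A\<^esub> b)"
    and finite_spanning: "\<exists>B. finite B \<and> B \<subseteq> carrier A \<and>
      (\<forall>a\<in>carrier A. \<exists>c\<in>B \<rightarrow> carrier K. a = (\<Oplus>\<^bsub>A\<^esub>b\<in>B. c b \<odot>\<^bsub>A\<^esub> b))"

text \<open>
  The locale \<^locale>\<open>module\<close> of the library is restricted to commutative rings; the following are
  its axioms over an arbitrary ring. The fields \<^const>\<open>monoid.mult\<close> and \<^const>\<open>one\<close> of the
  record \<open>M\<close> carry no meaning. A module over a \<open>K\<close>-algebra is a \<open>K\<close>-module through the unit of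
  the algebra, so no separate scalar multiplication is needed.
\<close>

locale left_module = A: ring A + M: abelian_group M
  for A :: "('a, 'r) ring_scheme" and M :: "('a, 'm, 's) module_scheme" (structure) +
  assumes smult_closed: "\<lbrakk>a \<in> carrier A; x \<in> carrier M\<rbrakk> \<Longrightarrow> a \<odot> x \<in> carrier M"
    and smult_l_distr: "\<lbrakk>a \<in> carrier A; b \<in> carrier A; x \<in> carrier M\<rbrakk> \<Longrightarrow>
      (a \<oplus>\<^bsub>A\<^esub> b) \<odot> x = a \<odot> x \<oplus> b \<odot> x"
    and smult_r_distr: "\<lbrakk>a \<in> carrier A; x \<in> carrier M; y \<in> carrier M\<rbrakk> \<Longrightarrow>
      a \<odot> (x \<oplus> y) = a \<odot> x \<oplus> a \<odot> y"
    and smult_assoc: "\<lbrakk>a \<in> carrier A; b \<in> carrier A; x \<in> carrier M\<rbrakk> \<Longrightarrow>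
      (a \<otimes>\<^bsub>A\<^esub> b) \<odot> x = a \<odot> (b \<odot> x)"
    and smult_one: "x \<in> carrier M \<Longrightarrow> \<one>\<^bsub>A\<^esub> \<odot> x = x"

definition finitely_generated ::
  "('a, 'r) ring_scheme \<Rightarrow> ('a, 'm, 's) module_scheme \<Rightarrow> bool" where
  "finitely_generated A M \<longleftrightarrow> (\<exists>S. finite S \<and> S \<subseteq> carrier M \<and>
     (\<forall>x\<in>carrier M. \<exists>c\<in>S \<rightarrow> carrier A. x = (\<Oplus>\<^bsub>M\<^esub>s\<in>S. c s \<odot>\<^bsub>M\<^esub> s)))"

definition lmod_hom ::
  "('a, 'r) ring_scheme \<Rightarrow> ('a, 'm, 's) module_scheme \<Rightarrow> ('a, 'n, 't) module_scheme \<Rightarrow> ('m \<Rightarrow> 'n) set"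
  where
  "lmod_hom A M N = {f \<in> carrier M \<rightarrow> carrier N.
     (\<forall>x\<in>carrier M. \<forall>y\<in>carrier M. f (x \<oplus>\<^bsub>M\<^esub> y) = f x \<oplus>\<^bsub>N\<^esub> f y) \<and>
     (\<forall>a\<in>carrier A. \<forall>x\<in>carrier M. f (a \<odot>\<^bsub>M\<^esub> x) = a \<odot>\<^bsub>N\<^esub> f x)}"

definition lmod_iso ::
  "('a, 'r) ring_scheme \<Rightarrow> ('a, 'm, 's) module_scheme \<Rightarrow> ('a, 'n, 't) module_scheme \<Rightarrow> ('m \<Rightarrow> 'n) set"
  where
  "lmod_iso A M N = {f \<in> lmod_hom A M N. bij_betw f (carrier M) (carrier N)}"

definition lmod_isomorphic ::
  "('a, 'r) ring_scheme \<Rightarrow> ('a, 'm, 's) module_scheme \<Rightarrow> ('a, 'n, 't) module_scheme \<Rightarrow> bool" where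
  "lmod_isomorphic A M N \<longleftrightarrow> lmod_iso A M N \<noteq> {}"

lemma lmod_iso_iff_invertible:
  assumes "left_module A M" "left_module A N"
  shows "f \<in> lmod_iso A M N \<longleftrightarrow> f \<in> lmod_hom A M N \<and>
    (\<exists>g\<in>lmod_hom A N M. (\<forall>x\<in>carrier M. g (f x) = x) \<and> (\<forall>y\<in>carrier N. f (g y) = y))"
    (is "?l \<longleftrightarrow> ?r")
proof
  interpret M: left_module A M by fact
  assume f: ?l
  define g where "g = inv_into (carrier M) f"
  have gf: "g (f x) = x" if "x \<in> carrier M" for x
    using f that unfolding lmod_iso_def g_def by (auto simp: bij_betw_def)
  have fg: "f (g y) = y" and gc: "g y \<in> carrier M" if "y \<in> carrier N" for y
    using f that unfolding lmod_iso_def g_def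
    by (auto simp: bij_betw_def f_inv_into_f inv_into_into)
  have "g (x \<oplus>\<^bsub>N\<^esub> y) = g x \<oplus>\<^bsub>M\<^esub> g y" if "x \<in> carrier N" "y \<in> carrier N" for x y
  proof -
    have "f (g x \<oplus>\<^bsub>M\<^esub> g y) = x \<oplus>\<^bsub>N\<^esub> y"
      using f that fg gc by (auto simp: lmod_iso_def lmod_hom_def)
    then show ?thesis using gf gc that by (metis M.M.a_closed)
  qed
  moreover have "g (a \<odot>\<^bsub>N\<^esub> x) = a \<odot>\<^bsub>M\<^esub> g x" if "a \<in> carrier A" "x \<in> carrier N" for a x
  proof -
    have "f (a \<odot>\<^bsub>M\<^esub> g x) = a \<odot>\<^bsub>N\<^esub> x"
      using f that fg gc by (auto simp: lmod_iso_def lmod_hom_def)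
    then show ?thesis using gf gc that by (metis M.smult_closed)
  qed
  ultimately have "g \<in> lmod_hom A N M" using gc by (auto simp: lmod_hom_def)
  then show ?r using f gf fg by (auto simp: lmod_iso_def)
next
  assume ?r
  then obtain g where f: "f \<in> lmod_hom A M N" and g: "g \<in> lmod_hom A N M"
    and "\<forall>x\<in>carrier M. g (f x) = x" "\<forall>y\<in>carrier N. f (g y) = y" by blast
  moreover from this have "bij_betw f (carrier M) (carrier N)"
    by (intro bij_betw_byWitness[where f' = g]) (auto simp: lmod_hom_def)
  ultimately show ?l by (auto simp: lmod_iso_def)
qed


section \<open>The category of finitely generated modules\<close>

text \<open>
  The objects need a fixed type for their elements. A module generated by \<open>s\<^sub>1, \<dots>, s\<^sub>n\<close> embeds as a
  set into \<open>A\<^sup>n\<close> by choosing coefficients, so lists over the ring are large enough to realize every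
  finitely generated module up to isomorphism, whatever its own type of elements is; see
  \<open>mod_cat_complete\<close> below.
\<close>

definition mod_cat :: "('a, 'r) ring_scheme \<Rightarrow> ('a, 'a list) module set" where
  "mod_cat A = {M. left_module A M \<and> finitely_generated A M}"

lemma left_module_transport:
  fixes M :: "('a, 'm, 's) module_scheme" and h :: "'m \<Rightarrow> 'n"
  assumes M: "left_module A M" and inj: "inj_on h (carrier M)"
  shows "\<exists>N :: ('a, 'n) module. left_module A N \<and> h \<in> lmod_iso A M N"
proof -
  interpret M: left_module A M by fact
  define g where "g = inv_into (carrier M) h"
  define N :: "('a, 'n) module" where "N = \<lparr>carrier = h ` carrier M,
    monoid.mult = (\<lambda>x y. undefined), one = undefined, ring.zero = h \<zero>\<^bsub>M\<^esub>,
    ring.add = (\<lambda>x y. h (g x \<oplus>\<^bsub>M\<^esub> g y)), smult = (\<lambda>a x. h (a \<odot>\<^bsub>M\<^esub> g x))\<rparr>"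
  have g[simp]: "g (h x) = x" if "x \<in> carrier M" for x
    using inj that by (simp add: g_def)
  have N[simp]: "carrier N = h ` carrier M" "\<zero>\<^bsub>N\<^esub> = h \<zero>\<^bsub>M\<^esub>"
    "\<And>x y. x \<oplus>\<^bsub>N\<^esub> y = h (g x \<oplus>\<^bsub>M\<^esub> g y)" "\<And>a x. a \<odot>\<^bsub>N\<^esub> x = h (a \<odot>\<^bsub>M\<^esub> g x)"
    by (simp_all add: N_def)
  note M.smult_closed[simp]
  have "abelian_group N"
  proof (rule abelian_groupI)
    fix x assume "x \<in> carrier N"
    then obtain u where u: "u \<in> carrier M" "x = h u" by auto
    then show "\<exists>y\<in>carrier N. y \<oplus>\<^bsub>N\<^esub> x = \<zero>\<^bsub>N\<^esub>"
      by (intro bexI[of _ "h (\<ominus>\<^bsub>M\<^esub> u)"]) (auto simp: M.M.l_neg)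
  qed (auto simp: M.M.a_ac)
  moreover have "left_module_axioms A N"
    by unfold_locales
      (auto simp: M.smult_l_distr M.smult_r_distr M.smult_assoc M.smult_one)
  ultimately have "left_module A N"
    using M.A.ring_axioms by (intro left_module.intro)
  moreover have "h \<in> lmod_iso A M N"
    using inj by (auto simp: lmod_iso_def lmod_hom_def bij_betw_def)
  ultimately show ?thesis by blast
qed

lemma mod_cat_complete:
  fixes M :: "('a, 'm, 's) module_scheme"
  assumes M: "left_module A M" and fg: "finitely_generated A M"
  shows "\<exists>N\<in>mod_cat A. lmod_isomorphic A M N"
proof -
  interpret M: left_module A M by fact
  obtain S where S: "finite S" "S \<subseteq> carrier M"
    and "\<forall>x\<in>carrier M. \<exists>c\<in>S \<rightarrow> carrier A. x = (\<Oplus>\<^bsub>M\<^esub>s\<in>S. c s \<odot>\<^bsub>M\<^esub> s)"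
    using fg by (auto simp: finitely_generated_def)
  then obtain c where c: "\<And>x. x \<in> carrier M \<Longrightarrow> c x \<in> S \<rightarrow> carrier A"
    and x: "\<And>x. x \<in> carrier M \<Longrightarrow> x = (\<Oplus>\<^bsub>M\<^esub>s\<in>S. c x s \<odot>\<^bsub>M\<^esub> s)" by metis
  obtain ss where ss: "set ss = S" using S(1) finite_list by blast
  define h where "h x = map (c x) ss" for x
  have "inj_on h (carrier M)"
  proof (rule inj_onI)
    fix u v assume u: "u \<in> carrier M" and v: "v \<in> carrier M" and "h u = h v"
    then have "\<forall>s\<in>S. c u s = c v s" by (auto simp: h_def ss)
    then have "(\<Oplus>\<^bsub>M\<^esub>s\<in>S. c u s \<odot>\<^bsub>M\<^esub> s) = (\<Oplus>\<^bsub>M\<^esub>s\<in>S. c v s \<odot>\<^bsub>M\<^esub> s)"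
      using c[OF v] S(2) by (intro M.M.finsum_cong') (auto intro!: M.smult_closed)
    then show "u = v" using x u v by metis
  qed
  from left_module_transport[OF M this]
  obtain N :: "('a, 'a list) module" where N: "left_module A N" "h \<in> lmod_iso A M N" by blast
  interpret N: left_module A N by fact
  have h: "h \<in> carrier M \<rightarrow> carrier N" "inj_on h (carrier M)" "h ` carrier M = carrier N"
    and add: "\<And>x y. x \<in> carrier M \<Longrightarrow> y \<in> carrier M \<Longrightarrow> h (x \<oplus>\<^bsub>M\<^esub> y) = h x \<oplus>\<^bsub>N\<^esub> h y"
    and sm: "\<And>a x. a \<in> carrier A \<Longrightarrow> x \<in> carrier M \<Longrightarrow> h (a \<odot>\<^bsub>M\<^esub> x) = a \<odot>\<^bsub>N\<^esub> h x"
    using N(2) by (auto simp: lmod_iso_def lmod_hom_def bij_betw_def)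
  have h0: "h \<zero>\<^bsub>M\<^esub> = \<zero>\<^bsub>N\<^esub>"
  proof -
    have "h \<zero>\<^bsub>M\<^esub> \<oplus>\<^bsub>N\<^esub> h \<zero>\<^bsub>M\<^esub> = h \<zero>\<^bsub>M\<^esub>"
      using add[of "\<zero>\<^bsub>M\<^esub>" "\<zero>\<^bsub>M\<^esub>"] by simp
    then show ?thesis using h(1) N.M.add.l_cancel_one'
      by (metis M.M.zero_closed Pi_mem)
  qed
  have hsum: "h (\<Oplus>\<^bsub>M\<^esub>s\<in>T. f s) = (\<Oplus>\<^bsub>N\<^esub>s\<in>T. h (f s))"
    if "finite T" "f \<in> T \<rightarrow> carrier M" for T f
    using that
  proof (induction T)
    case empty
    then show ?case by (simp add: h0)
  next
    case (insert t T)
    then have "f \<in> T \<rightarrow> carrier M" "f t \<in> carrier M" by auto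
    moreover from this have "(\<lambda>s. h (f s)) \<in> T \<rightarrow> carrier N" "h (f t) \<in> carrier N"
      using h(1) by auto
    ultimately show ?case
      using insert by (simp add: M.M.finsum_insert N.M.finsum_insert add)
  qed
  have "finitely_generated A N" unfolding finitely_generated_def
  proof (intro exI[of _ "h ` S"] conjI ballI)
    show "finite (h ` S)" "h ` S \<subseteq> carrier N" using S h(1) by auto
    fix y assume "y \<in> carrier N"
    then obtain u where u: "u \<in> carrier M" "y = h u" using h(3) by auto
    have injS: "inj_on h S" using h(2) S(2) inj_on_subset by blast
    define d where "d = c u \<circ> inv_into S h"
    have d: "d (h s) = c u s" if "s \<in> S" for s using that injS by (simp add: d_def)
    have dA: "d \<in> h ` S \<rightarrow> carrier A" using d c[OF u(1)] by auto
    have "y = h (\<Oplus>\<^bsub>M\<^esub>s\<in>S. c u s \<odot>\<^bsub>M\<^esub> s)" using x u by metis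
    also have "\<dots> = (\<Oplus>\<^bsub>N\<^esub>s\<in>S. h (c u s \<odot>\<^bsub>M\<^esub> s))"
      using c[OF u(1)] S by (intro hsum) (auto intro!: M.smult_closed)
    also have "\<dots> = (\<Oplus>\<^bsub>N\<^esub>s\<in>S. d (h s) \<odot>\<^bsub>N\<^esub> h s)"
    proof (rule N.M.finsum_cong')
      show "(\<lambda>s. d (h s) \<odot>\<^bsub>N\<^esub> h s) \<in> S \<rightarrow> carrier N"
        using dA h(1) S(2) by (auto intro!: N.smult_closed)
      show "h (c u s \<odot>\<^bsub>M\<^esub> s) = d (h s) \<odot>\<^bsub>N\<^esub> h s" if "s \<in> S" for s
        using that c[OF u(1)] S(2) sm d by auto
    qed simp
    also have "\<dots> = (\<Oplus>\<^bsub>N\<^esub>t\<in>h ` S. d t \<odot>\<^bsub>N\<^esub> t)"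
      using dA h(1) S(2) injS
      by (intro N.M.finsum_reindex[symmetric]) (auto intro!: N.smult_closed)
    finally show "\<exists>c\<in>h ` S \<rightarrow> carrier A. y = (\<Oplus>\<^bsub>N\<^esub>s\<in>h ` S. c s \<odot>\<^bsub>N\<^esub> s)"
      using dA by blast
  qed
  then show ?thesis using N by (auto simp: mod_cat_def lmod_isomorphic_def)
qed


section \<open>Bricks\<close>

text \<open>
  Endomorphisms are taken extensional (undefined outside the carrier), so that equality in the
  endomorphism ring is equality of maps on the module.
\<close>

definition End_ring ::
  "('a, 'r) ring_scheme \<Rightarrow> ('a, 'm, 's) module_scheme \<Rightarrow> ('m \<Rightarrow> 'm) ring" where
  "End_ring A M = \<lparr>carrier = lmod_hom A M M \<inter> extensional (carrier M),
     monoid.mult = compose (carrier M), one = (\<lambda>x\<in>carrier M. x),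
     ring.zero = (\<lambda>x\<in>carrier M. \<zero>\<^bsub>M\<^esub>), ring.add = (\<lambda>f g. \<lambda>x\<in>carrier M. f x \<oplus>\<^bsub>M\<^esub> g x)\<rparr>"

lemma ring_End_ring:
  fixes M :: "('a, 'm, 's) module_scheme"
  assumes "left_module A M"
  shows "ring (End_ring A M)"
proof -
  interpret M: left_module A M by fact
  note M.smult_closed[simp]
  have ext: "f = g" if "f \<in> extensional (carrier M)" "g \<in> extensional (carrier M)"
    "\<And>x. x \<in> carrier M \<Longrightarrow> f x = g x" for f g :: "'m \<Rightarrow> 'm"
    using that by (rule extensionalityI)
  have sm_neg: "a \<odot>\<^bsub>M\<^esub> (\<ominus>\<^bsub>M\<^esub> x) = \<ominus>\<^bsub>M\<^esub> (a \<odot>\<^bsub>M\<^esub> x)"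
    and sm_zero: "a \<odot>\<^bsub>M\<^esub> \<zero>\<^bsub>M\<^esub> = \<zero>\<^bsub>M\<^esub>" if "a \<in> carrier A" "x \<in> carrier M" for a x
  proof -
    have "a \<odot>\<^bsub>M\<^esub> \<zero>\<^bsub>M\<^esub> \<oplus>\<^bsub>M\<^esub> a \<odot>\<^bsub>M\<^esub> \<zero>\<^bsub>M\<^esub> = a \<odot>\<^bsub>M\<^esub> \<zero>\<^bsub>M\<^esub>"
      using that M.smult_r_distr[of a "\<zero>\<^bsub>M\<^esub>" "\<zero>\<^bsub>M\<^esub>"] by simp
    then show z: "a \<odot>\<^bsub>M\<^esub> \<zero>\<^bsub>M\<^esub> = \<zero>\<^bsub>M\<^esub>"
      using that by simp
    show "a \<odot>\<^bsub>M\<^esub> (\<ominus>\<^bsub>M\<^esub> x) = \<ominus>\<^bsub>M\<^esub> (a \<odot>\<^bsub>M\<^esub> x)"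
      using that M.smult_r_distr[of a "\<ominus>\<^bsub>M\<^esub> x" x] z
      by (intro M.M.minus_equality[symmetric]) (auto simp: M.M.l_neg)
  qed
  show ?thesis
  proof (rule ringI)
    show "abelian_group (End_ring A M)"
    proof (rule abelian_groupI, goal_cases)
      case (6 f)
      then show ?case
        by (intro bexI[of _ "\<lambda>x\<in>carrier M. \<ominus>\<^bsub>M\<^esub> f x"])
          (auto simp: End_ring_def lmod_hom_def Pi_iff M.M.l_neg M.M.r_neg M.M.minus_add sm_neg M.M.a_ac
            intro!: restrict_ext)
    qed (auto simp: End_ring_def lmod_hom_def Pi_iff M.M.a_ac sm_zero M.smult_r_distr
          intro!: ext)
    show "monoid (End_ring A M)"
      by (rule monoidI)
        (auto simp: End_ring_def lmod_hom_def Pi_iff compose_def intro!: ext)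
  qed (auto simp: End_ring_def lmod_hom_def Pi_iff compose_def intro!: ext)
qed

text \<open>An algebra is a division algebra iff its underlying ring is a division ring.\<close>

definition skew_field :: "('a, 'r) ring_scheme \<Rightarrow> bool" where
  "skew_field R \<longleftrightarrow> ring R \<and> \<one>\<^bsub>R\<^esub> \<noteq> \<zero>\<^bsub>R\<^esub> \<and> Units R = carrier R - {\<zero>\<^bsub>R\<^esub>}"

definition bricks :: "('a, 'r) ring_scheme \<Rightarrow> ('a, 'a list) module set" where
  "bricks A = {X \<in> mod_cat A. skew_field (End_ring A X)}"

definition brick_finite :: "('a, 'r) ring_scheme \<Rightarrow> bool" where
  "brick_finite A \<longleftrightarrow>
     finite (bricks A // {(X, Y). X \<in> bricks A \<and> Y \<in> bricks A \<and> lmod_isomorphic A X Y})"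

definition brick_cycle ::
  "('a, 'r) ring_scheme \<Rightarrow> nat \<Rightarrow> (nat \<Rightarrow> ('a, 'a list) module) \<Rightarrow> (nat \<Rightarrow> 'a list \<Rightarrow> 'a list) \<Rightarrow> bool"
  where
  "brick_cycle A m X f \<longleftrightarrow> m \<ge> 1 \<and> (\<forall>i\<le>m. X i \<in> bricks A) \<and> lmod_isomorphic A (X 0) (X m) \<and>
     (\<forall>j\<in>{1..m}. f j \<in> lmod_hom A (X (j - 1)) (X j) \<and>
        (\<exists>x\<in>carrier (X (j - 1)). f j x \<noteq> \<zero>\<^bsub>X j\<^esub>) \<and>
        f j \<notin> lmod_iso A (X (j - 1)) (X j))"

definition brick_directed :: "('a, 'r) ring_scheme \<Rightarrow> bool" where
  "brick_directed A \<longleftrightarrow> \<not> (\<exists>m X f. brick_cycle A m X f)"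


section \<open>The Grothendieck group and dimension vectors\<close>

definition short_exact ::
  "('a, 'r) ring_scheme \<Rightarrow> ('a, 'l, 's) module_scheme \<Rightarrow> ('l \<Rightarrow> 'm) \<Rightarrow> ('a, 'm, 't) module_scheme
     \<Rightarrow> ('m \<Rightarrow> 'n) \<Rightarrow> ('a, 'n, 'u) module_scheme \<Rightarrow> bool" where
  "short_exact A L f M g N \<longleftrightarrow> f \<in> lmod_hom A L M \<and> g \<in> lmod_hom A M N \<and>
     inj_on f (carrier L) \<and> g ` carrier M = carrier N \<and>
     f ` carrier L = {x \<in> carrier M. g x = \<zero>\<^bsub>N\<^esub>}"

definition K0_relations :: "('a, 'r) ring_scheme \<Rightarrow> (('a, 'a list) module \<Rightarrow>\<^sub>0 int) set" where
  "K0_relations A = generate (free_Abelian_group (mod_cat A))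
     {frag_of M - frag_of L - frag_of N | L M N.
        L \<in> mod_cat A \<and> M \<in> mod_cat A \<and> N \<in> mod_cat A \<and> (\<exists>f g. short_exact A L f M g N)}"

definition K0 :: "('a, 'r) ring_scheme \<Rightarrow> (('a, 'a list) module \<Rightarrow>\<^sub>0 int) set monoid" where
  "K0 A = free_Abelian_group (mod_cat A) Mod K0_relations A"

text \<open>
  The class of \<open>X\<close> in \<^const>\<open>K0\<close>. By the Jordan--Hoelder theorem \<^const>\<open>K0\<close> is free on the classes
  of the simple modules, and the coordinates of this class are the composition multiplicities of
  \<open>X\<close>.
\<close>

definition dim_vector ::
  "('a, 'r) ring_scheme \<Rightarrow> ('a, 'a list) module \<Rightarrow> (('a, 'a list) module \<Rightarrow>\<^sub>0 int) set" where
  "dim_vector A X = K0_relations A #>\<^bsub>free_Abelian_group (mod_cat A)\<^esub> frag_of X"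

lemma comm_group_K0: "comm_group (K0 A)"
  and dim_vector_in_K0: "X \<in> mod_cat A \<Longrightarrow> dim_vector A X \<in> carrier (K0 A)"
proof -
  let ?F = "free_Abelian_group (mod_cat A)"
  interpret F: comm_group ?F by (rule abelian_free_Abelian_group)
  have "subgroup (K0_relations A) ?F"
    unfolding K0_relations_def
  proof (rule F.generate_is_subgroup, safe)
    fix L M N :: "('a, 'a list) module"
    assume "L \<in> mod_cat A" "M \<in> mod_cat A" "N \<in> mod_cat A"
    then have "frag_of M - frag_of L - frag_of N =
      frag_of M \<otimes>\<^bsub>?F\<^esub> inv\<^bsub>?F\<^esub> frag_of L \<otimes>\<^bsub>?F\<^esub> inv\<^bsub>?F\<^esub> frag_of N"
      and "frag_of L \<in> carrier ?F" "frag_of M \<in> carrier ?F" "frag_of N \<in> carrier ?F"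
      by auto
    then show "frag_of M - frag_of L - frag_of N \<in> carrier ?F"
      by (metis F.inv_closed F.m_closed)
  qed
  then show "comm_group (K0 A)"
    unfolding K0_def by (rule F.abelian_FactGroup)
  show "X \<in> mod_cat A \<Longrightarrow> dim_vector A X \<in> carrier (K0 A)"
    by (auto simp: K0_def carrier_FactGroup dim_vector_def)
qed

end

theory Submission
  imports Defs
begin

text \<open>
  For a torsion pair \<open>(T, F)\<close> with \<open>T\<close> functorially finite, a minimal left \<open>T\<close>-approximation
  \<open>A \<rightarrow> M\<close> and a minimal projective presentation \<open>Q \<rightarrow> P \<rightarrow> M \<rightarrow> 0\<close>, the additive function
  \<open>\<theta>(X) = dim Hom(P, X) - dim Hom(Q, X)\<close> is positive on the nonzero modules in \<open>T\<close>, because \<open>M\<close> is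
  Ext-projective in \<open>T\<close> and generates it, and is at most \<open>0\<close> on \<open>F\<close>, because \<open>Hom(M, F) = 0\<close>.
  So a module in \<open>T\<close> and one in \<open>F\<close> never have the same dimension vector.

  In a brick-directed algebra, for any two non-isomorphic bricks \<open>X\<close>, \<open>Y\<close>, up to exchanging them,
  there is no path from \<open>Y\<close> to \<open>X\<close>; if \<open>S\<close> is the set of bricks with a path to \<open>X\<close>, then \<open>X\<close> lies
  in the torsion-free class and \<open>Y\<close> in the torsion class \<open>T\<close> of modules without nonzero maps to \<open>S\<close>.
  That \<open>T\<close> is functorially finite follows by induction on the finite set \<open>S\<close>: when a brick \<open>B\<close>
  without arrows into \<open>S\<close> is added, \<open>B\<close> is the only brick in the interval between the two
  torsion classes, and if \<open>m \<in> M\<close> is the old approximation, then the new torsion submodules of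
  \<open>M\<close> and of \<open>M / A m\<close> generate the new torsion class.
\<close>

section \<open>Submodules and length\<close>

text \<open>The obstacle is functorial finiteness of \<open>Tors A S\<close>. Only one consequence
  of it enters: an approximation of the regular module, that is, an element \<open>m\<close> of some
  \<open>M\<close> in the class such that every element of every module in the class is an image of
  \<open>m\<close>. Brick-finiteness makes \<open>S\<close> finite, so such an \<open>m\<close> is
  built by adding one brick at a time to \<open>S\<close>, starting from the class of all modules,
  where the unit of the algebra serves. One step works because in the interval between two
  consecutive torsion classes every nonzero module contains the new brick, and because this interval
  is closed under quotients by kernels from the larger torsion class. Dimensions are lengths over
  \<open>K\<close> of spaces of homomorphisms, which makes sense over any field. All objects of the
  category live on lists over the algebra, so direct sums and the regular module are carried back to
  that type and then used only through their maps.\<close>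

definition submod :: "('r, 'x) ring_scheme \<Rightarrow> ('r, 'm, 's) module_scheme \<Rightarrow> 'm set \<Rightarrow> bool" where
  "submod R V U \<longleftrightarrow> U \<subseteq> carrier V \<and> \<zero>\<^bsub>V\<^esub> \<in> U \<and> (\<forall>x\<in>U. \<forall>y\<in>U. x \<oplus>\<^bsub>V\<^esub> y \<in> U) \<and>
     (\<forall>a\<in>carrier R. \<forall>x\<in>U. a \<odot>\<^bsub>V\<^esub> x \<in> U)"

text \<open>Only the carrier changes, so a submodule keeps the type and the operations of the
  ambient module: its inclusion is the identity function, and a homomorphism restricts as the same
  function.\<close>

abbreviation submod_on :: "('r, 'm, 's) module_scheme \<Rightarrow> 'm set \<Rightarrow> ('r, 'm, 's) module_scheme" where
  "submod_on V U \<equiv> V\<lparr>carrier := U\<rparr>"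

definition hker :: "('r, 'm, 's) module_scheme \<Rightarrow> ('r, 'n, 't) module_scheme \<Rightarrow> ('m \<Rightarrow> 'n) \<Rightarrow> 'm set" where
  "hker V W f = {x \<in> carrier V. f x = \<zero>\<^bsub>W\<^esub>}"

lemma lmod_homI:
  assumes "\<And>x. x \<in> carrier M \<Longrightarrow> f x \<in> carrier N"
    "\<And>x y. x \<in> carrier M \<Longrightarrow> y \<in> carrier M \<Longrightarrow> f (x \<oplus>\<^bsub>M\<^esub> y) = f x \<oplus>\<^bsub>N\<^esub> f y"
    "\<And>a x. a \<in> carrier R \<Longrightarrow> x \<in> carrier M \<Longrightarrow> f (a \<odot>\<^bsub>M\<^esub> x) = a \<odot>\<^bsub>N\<^esub> f x"
  shows "f \<in> lmod_hom R M N"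
  using assms by (auto simp: lmod_hom_def)

lemma lmod_homD:
  assumes "f \<in> lmod_hom R M N"
  shows lmod_hom_closed: "x \<in> carrier M \<Longrightarrow> f x \<in> carrier N"
    and lmod_hom_add: "x \<in> carrier M \<Longrightarrow> y \<in> carrier M \<Longrightarrow> f (x \<oplus>\<^bsub>M\<^esub> y) = f x \<oplus>\<^bsub>N\<^esub> f y"
    and lmod_hom_smult: "a \<in> carrier R \<Longrightarrow> x \<in> carrier M \<Longrightarrow> f (a \<odot>\<^bsub>M\<^esub> x) = a \<odot>\<^bsub>N\<^esub> f x"
  using assms by (auto simp: lmod_hom_def)

lemma lmod_hom_comp: "f \<in> lmod_hom R L M \<Longrightarrow> g \<in> lmod_hom R M N \<Longrightarrow> g \<circ> f \<in> lmod_hom R L N"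
  by (auto simp: lmod_hom_def Pi_iff)

lemma lmod_hom_id: "(\<lambda>x. x) \<in> lmod_hom R M M"
  by (auto simp: lmod_hom_def)

lemma lmod_hom_submod_dom: "f \<in> lmod_hom R M N \<Longrightarrow> U \<subseteq> carrier M \<Longrightarrow> f \<in> lmod_hom R (submod_on M U) N"
  by (simp add: lmod_hom_def Pi_iff subset_iff)

lemma lmod_hom_submod_incl: "U \<subseteq> carrier M \<Longrightarrow> (\<lambda>x. x) \<in> lmod_hom R (submod_on M U) M"
  by (auto simp: lmod_hom_def)

lemma lmod_hom_submod_cod:
  "f \<in> lmod_hom R M N \<Longrightarrow> f ` carrier M \<subseteq> U \<Longrightarrow> f \<in> lmod_hom R M (submod_on N U)"
  by (auto simp: lmod_hom_def)

lemma lmod_hom_submod_codD: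
  "f \<in> lmod_hom R M (submod_on N U) \<Longrightarrow> U \<subseteq> carrier N \<Longrightarrow> f \<in> lmod_hom R M N"
  by (auto simp: lmod_hom_def)

context left_module
begin

lemmas is_lmod = left_module_axioms

declare smult_closed [simp, intro]

lemma smult_zero_right [simp]: "a \<in> carrier A \<Longrightarrow> a \<odot> \<zero> = \<zero>"
  using smult_r_distr[of a "\<zero>" "\<zero>"] by (simp add: M.add.l_cancel_one')

lemma smult_zero_left [simp]: "x \<in> carrier M \<Longrightarrow> \<zero>\<^bsub>A\<^esub> \<odot> x = \<zero>"
  using smult_l_distr[of "\<zero>\<^bsub>A\<^esub>" "\<zero>\<^bsub>A\<^esub>" x] by simp

lemma smult_minus_left: "a \<in> carrier A \<Longrightarrow> x \<in> carrier M \<Longrightarrow> (\<ominus>\<^bsub>A\<^esub> a) \<odot> x = \<ominus> (a \<odot> x)"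
  using smult_l_distr[of "\<ominus>\<^bsub>A\<^esub> a" a x] by (intro M.minus_equality[symmetric]) (auto simp: A.l_neg)

lemma smult_minus_right: "a \<in> carrier A \<Longrightarrow> x \<in> carrier M \<Longrightarrow> a \<odot> (\<ominus> x) = \<ominus> (a \<odot> x)"
  using smult_r_distr[of a "\<ominus> x" x] by (intro M.minus_equality[symmetric]) (auto simp: M.l_neg)

lemma submodD:
  assumes "submod A M U"
  shows submod_subset: "U \<subseteq> carrier M" and submod_zero: "\<zero> \<in> U"
    and submod_add: "x \<in> U \<Longrightarrow> y \<in> U \<Longrightarrow> x \<oplus> y \<in> U"
    and submod_smult: "a \<in> carrier A \<Longrightarrow> x \<in> U \<Longrightarrow> a \<odot> x \<in> U"
    and submod_uminus: "x \<in> U \<Longrightarrow> \<ominus> x \<in> U"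
    and submod_minus: "x \<in> U \<Longrightarrow> y \<in> U \<Longrightarrow> x \<ominus> y \<in> U"
proof -
  show *: "x \<in> U \<Longrightarrow> \<ominus> x \<in> U" for x
  proof -
    assume x: "x \<in> U"
    then have "(\<ominus>\<^bsub>A\<^esub> \<one>\<^bsub>A\<^esub>) \<odot> x \<in> U" "x \<in> carrier M"
      using assms A.a_inv_closed[OF A.one_closed] by (auto simp: submod_def)
    then show ?thesis by (simp add: smult_minus_left smult_one)
  qed
  show "x \<in> U \<Longrightarrow> y \<in> U \<Longrightarrow> x \<ominus> y \<in> U" for x y
    using * assms by (auto simp: submod_def a_minus_def)
qed (use assms in \<open>auto simp: submod_def\<close>)

lemma submod_finsum:
  assumes "submod A M U" "finite S" "f \<in> S \<rightarrow> U"
  shows "(\<Oplus>s\<in>S. f s) \<in> U"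
  using assms(2,3)
proof (induction S)
  case (insert s S)
  then have "f \<in> S \<rightarrow> carrier M" "f s \<in> carrier M"
    using submod_subset[OF assms(1)] by auto
  then show ?case using insert assms(1) by (simp add: submod_add)
qed (simp add: submod_zero[OF assms(1)])

lemma left_module_submod:
  assumes "submod A M U"
  shows "left_module A (submod_on M U)"
proof -
  note U = submodD[OF assms]
  have "abelian_group (submod_on M U)"
  proof (rule abelian_groupI)
    fix x assume "x \<in> carrier (submod_on M U)"
    then show "\<exists>y\<in>carrier (submod_on M U). y \<oplus>\<^bsub>submod_on M U\<^esub> x = \<zero>\<^bsub>submod_on M U\<^esub>"
      using U by (intro bexI[of _ "\<ominus> x"]) (auto simp: M.l_neg subset_iff)
  qed (use U in \<open>auto simp: M.a_ac subset_iff\<close>)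
  moreover have "left_module_axioms A (submod_on M U)"
    by unfold_locales
      (use U in \<open>auto simp: smult_l_distr smult_r_distr smult_assoc smult_one subset_iff\<close>)
  ultimately show ?thesis using A.ring_axioms by (intro left_module.intro)
qed

lemma submod_carrier: "submod A M (carrier M)"
  by (auto simp: submod_def)

lemma submod_zero_set: "submod A M {\<zero>}"
  by (auto simp: submod_def)

lemma submod_submod_iff:
  "submod A M U \<Longrightarrow> submod A (submod_on M U) W \<longleftrightarrow> submod A M W \<and> W \<subseteq> U"
  by (auto simp: submod_def)

end

context
  fixes R :: "('r, 'x) ring_scheme" and V :: "('r, 'm, 's) module_scheme"
    and W :: "('r, 'n, 't) module_scheme" and f
  assumes V: "left_module R V" and W: "left_module R W" and f: "f \<in> lmod_hom R V W"
begin

interpretation V: left_module R V by (rule V)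
interpretation W: left_module R W by (rule W)

lemma lmod_hom_zero: "f \<zero>\<^bsub>V\<^esub> = \<zero>\<^bsub>W\<^esub>"
  using lmod_hom_smult[OF f, of "\<zero>\<^bsub>R\<^esub>" "\<zero>\<^bsub>V\<^esub>"] lmod_hom_closed[OF f] by auto

lemma lmod_hom_uminus: "x \<in> carrier V \<Longrightarrow> f (\<ominus>\<^bsub>V\<^esub> x) = \<ominus>\<^bsub>W\<^esub> f x"
  using lmod_hom_smult[OF f, of "\<ominus>\<^bsub>R\<^esub> \<one>\<^bsub>R\<^esub>" x] lmod_hom_closed[OF f]
  by (auto simp: V.smult_minus_left W.smult_minus_left V.smult_one W.smult_one)

lemma lmod_hom_minus:
  "x \<in> carrier V \<Longrightarrow> y \<in> carrier V \<Longrightarrow> f (x \<ominus>\<^bsub>V\<^esub> y) = f x \<ominus>\<^bsub>W\<^esub> f y"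
  by (simp add: a_minus_def lmod_hom_add[OF f] lmod_hom_uminus)

lemma submod_hker: "submod R V (hker V W f)"
  using lmod_homD[OF f] lmod_hom_zero by (auto simp: submod_def hker_def)

lemma submod_vimage: "submod R W U \<Longrightarrow> submod R V {x \<in> carrier V. f x \<in> U}"
  using lmod_homD[OF f] lmod_hom_zero by (auto simp: submod_def)

lemma submod_image: "submod R V U \<Longrightarrow> submod R W (f ` U)"
  using lmod_homD[OF f] lmod_hom_zero
  unfolding submod_def by (auto simp: subset_iff image_iff) (metis)+

lemma inj_on_iff_hker: "inj_on f (carrier V) \<longleftrightarrow> hker V W f = {\<zero>\<^bsub>V\<^esub>}"
proof
  assume "inj_on f (carrier V)"
  then show "hker V W f = {\<zero>\<^bsub>V\<^esub>}"
    using lmod_hom_zero unfolding hker_def inj_on_def by force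
next
  assume *: "hker V W f = {\<zero>\<^bsub>V\<^esub>}"
  show "inj_on f (carrier V)"
  proof (rule inj_onI)
    fix x y assume xy: "x \<in> carrier V" "y \<in> carrier V" "f x = f y"
    then have "x \<ominus>\<^bsub>V\<^esub> y \<in> hker V W f"
      using lmod_hom_minus[of x y] lmod_hom_closed[OF f]
      by (auto simp: hker_def W.M.r_neg a_minus_def)
    then have "x \<ominus>\<^bsub>V\<^esub> y = \<zero>\<^bsub>V\<^esub>" using * by blast
    then have "x = \<ominus>\<^bsub>V\<^esub> (\<ominus>\<^bsub>V\<^esub> y)" using xy
      by (intro V.M.minus_equality[symmetric]) (auto simp: a_minus_def)
    then show "x = y" using xy by simp
  qed
qed

end

section \<open>Length of a module through chains of submodules\<close>

inductive chain_to :: "('r, 'x) ring_scheme \<Rightarrow> ('r, 'm, 's) module_scheme \<Rightarrow> nat \<Rightarrow> 'm set \<Rightarrow> bool"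
  for R V where
  chain_to_0: "submod R V U \<Longrightarrow> chain_to R V 0 U"
| chain_to_Suc: "chain_to R V n U \<Longrightarrow> U \<subset> U' \<Longrightarrow> submod R V U' \<Longrightarrow> chain_to R V (Suc n) U'"

definition finite_length :: "('r, 'x) ring_scheme \<Rightarrow> ('r, 'm, 's) module_scheme \<Rightarrow> bool" where
  "finite_length R V \<longleftrightarrow> (\<exists>N. \<forall>n. chain_to R V n (carrier V) \<longrightarrow> n \<le> N)"

text \<open>Counts the strict inclusions in a longest chain ending at the carrier; the bottom of a
  chain may be any submodule. This gives additivity of length without comparing composition series.
  The value is meaningful under \<open>finite_length\<close>.\<close>

definition len :: "('r, 'x) ring_scheme \<Rightarrow> ('r, 'm, 's) module_scheme \<Rightarrow> nat" where
  "len R V = (GREATEST n. chain_to R V n (carrier V))"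

lemma chain_to_submod: "chain_to R V n U \<Longrightarrow> submod R V U"
  by (auto elim: chain_to.cases)

text \<open>Only the last inclusion involves the top, and enlarging the top keeps it strict.\<close>

lemma chain_to_mono: "chain_to R V n U \<Longrightarrow> U \<subseteq> U' \<Longrightarrow> submod R V U' \<Longrightarrow> chain_to R V n U'"
  by (erule chain_to.cases) (metis chain_to.intros psubset_subset_trans)+

text \<open>Strictness of inclusions does not mention the module, so a chain survives any change of
  ring or module under which its terms, all of them inside \<open>T\<close>, remain
  submodules.\<close>

lemma chain_to_transfer:
  assumes "chain_to R V n U" "U \<subseteq> T" "\<And>X. submod R V X \<Longrightarrow> X \<subseteq> T \<Longrightarrow> submod R' V' X"
  shows "chain_to R' V' n U"
  using assms(1,2) by induction (auto intro!: chain_to.intros assms(3) intro: chain_to.intros(2))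

lemma chain_to_le_len: "finite_length R V \<Longrightarrow> chain_to R V n (carrier V) \<Longrightarrow> n \<le> len R V"
  unfolding finite_length_def len_def by (elim exE, rule Greatest_le_nat) auto

lemma chain_to_len:
  assumes "left_module R V" "finite_length R V"
  shows "chain_to R V (len R V) (carrier V)"
proof -
  have "chain_to R V 0 (carrier V)"
    using assms(1) by (auto intro: chain_to.intros left_module.submod_carrier)
  moreover obtain N where "\<forall>n. chain_to R V n (carrier V) \<longrightarrow> n \<le> N"
    using assms(2) unfolding finite_length_def by blast
  ultimately show ?thesis
    unfolding len_def by (intro GreatestI_nat[of "\<lambda>n. chain_to R V n (carrier V)" 0 N]) auto
qed

lemma chain_to_submod_on:
  assumes "left_module R V" "submod R V U"
  shows "chain_to R (submod_on V U) n X \<longleftrightarrow> chain_to R V n X \<and> X \<subseteq> U"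
proof -
  have "chain_to R V n X \<Longrightarrow> X \<subseteq> U \<Longrightarrow> chain_to R (submod_on V U) n X"
    by (erule chain_to_transfer) (auto simp: left_module.submod_submod_iff[OF assms])
  moreover have "chain_to R (submod_on V U) n X \<Longrightarrow> chain_to R V n X"
    by (erule chain_to_transfer[where T = UNIV]) (auto simp: left_module.submod_submod_iff[OF assms])
  moreover have "chain_to R (submod_on V U) n X \<Longrightarrow> X \<subseteq> U"
    by (drule chain_to_submod) (auto simp: left_module.submod_submod_iff[OF assms])
  ultimately show ?thesis by blast
qed

lemma finite_length_submod:
  assumes "left_module R V" "submod R V U" "finite_length R V"
  shows "finite_length R (submod_on V U)"
  using assms left_module.submod_carrier[OF assms(1)]
  by (auto simp: finite_length_def chain_to_submod_on)
    (meson chain_to_mono submod_def)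

lemma
  assumes V: "left_module R V"
  shows len_zero_submod: "len R (submod_on V {\<zero>\<^bsub>V\<^esub>}) = 0"
    and finite_length_zero_submod: "finite_length R (submod_on V {\<zero>\<^bsub>V\<^esub>})"
proof -
  interpret V: left_module R V by fact
  have *: "n = 0" if "chain_to R V n {\<zero>\<^bsub>V\<^esub>}" for n
    using that by (cases rule: chain_to.cases) (auto dest!: chain_to_submod simp: submod_def)
  then show "finite_length R (submod_on V {\<zero>\<^bsub>V\<^esub>})"
    by (auto simp: finite_length_def chain_to_submod_on[OF V V.submod_zero_set])
  from chain_to_len[OF V.left_module_submod[OF V.submod_zero_set] this] *
  show "len R (submod_on V {\<zero>\<^bsub>V\<^esub>}) = 0" by (auto simp: chain_to_submod_on[OF V V.submod_zero_set])
qed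

lemma len_submod_less:
  assumes "left_module R V" "submod R V U" "finite_length R V" "U \<noteq> carrier V"
  shows "len R (submod_on V U) < len R V"
proof -
  interpret left_module R V by fact
  have "chain_to R (submod_on V U) (len R (submod_on V U)) U"
    using chain_to_len[OF left_module_submod finite_length_submod] assms by force
  then have "chain_to R V (Suc (len R (submod_on V U))) (carrier V)"
    using assms submod_subset[OF assms(2)]
    by (intro chain_to_Suc[of _ _ _ U]) (auto simp: chain_to_submod_on submod_carrier)
  from chain_to_le_len[OF assms(3) this] show ?thesis by simp
qed

context
  fixes R :: "('r, 'x) ring_scheme" and V :: "('r, 'm, 's) module_scheme"
    and W :: "('r, 'n, 't) module_scheme" and f
  assumes V: "left_module R V" and W: "left_module R W" and f: "f \<in> lmod_hom R V W"
begin

interpretation V: left_module R V by (rule V)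
interpretation W: left_module R W by (rule W)

private lemma ker: "submod R V (hker V W f)"
  by (rule submod_hker[OF V W f])

private lemma im: "submod R W (f ` carrier V)"
  by (rule submod_image[OF V W f V.submod_carrier])

text \<open>Every strict inclusion in the chain stays strict after intersecting with the kernel or
  after applying \<open>f\<close>, so the two induced chains together have at least \<open>n\<close>
  steps.\<close>

lemma chain_to_split:
  assumes "chain_to R V n U"
  shows "\<exists>a b. chain_to R V a (U \<inter> hker V W f) \<and> chain_to R W b (f ` U) \<and> n \<le> a + b"
  using assms
proof induction
  case (chain_to_0 U)
  then have "submod R V (U \<inter> hker V W f)" "submod R W (f ` U)"
    using ker submod_image[OF V W f] by (auto simp: submod_def)
  then show ?case by (blast intro: chain_to.chain_to_0)
next
  case (chain_to_Suc n U U')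
  then obtain a b where ab: "chain_to R V a (U \<inter> hker V W f)" "chain_to R W b (f ` U)" "n \<le> a + b"
    by blast
  note U = chain_to_submod[OF chain_to_Suc(1)] and U' = chain_to_Suc(3)
  have s: "submod R V (U' \<inter> hker V W f)" "submod R W (f ` U')"
    using ker submod_image[OF V W f U'] U' by (auto simp: submod_def)
  \<comment> \<open>Modular law: if neither grows, an element of \<open>U'\<close> differs from an
    element of \<open>U\<close> by an element of the kernel that already lies in
    \<open>U\<close>.\<close>
  have "U \<inter> hker V W f \<subset> U' \<inter> hker V W f \<or> f ` U \<subset> f ` U'"
  proof (rule ccontr)
    assume "\<not> ?thesis"
    then have e: "U' \<inter> hker V W f \<subseteq> U" "f ` U' \<subseteq> f ` U" using chain_to_Suc(2) by blast+
    have "U' \<subseteq> U"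
    proof
      fix x assume x: "x \<in> U'"
      then obtain y where y: "y \<in> U" "f x = f y" using e by blast
      have c: "x \<in> carrier V" "y \<in> carrier V" "y \<in> U'"
        using x y U U' chain_to_Suc(2) by (auto simp: submod_def)
      then have "x \<ominus>\<^bsub>V\<^esub> y \<in> U' \<inter> hker V W f"
        using x V.submod_minus[OF U'] y lmod_hom_minus[OF V W f] lmod_hom_closed[OF f]
        by (auto simp: hker_def W.M.r_neg a_minus_def)
      then have "(x \<ominus>\<^bsub>V\<^esub> y) \<oplus>\<^bsub>V\<^esub> y \<in> U" using e y V.submod_add[OF U] by blast
      then show "x \<in> U" using c by (simp add: a_minus_def V.M.a_assoc V.M.l_neg)
    qed
    then show False using chain_to_Suc(2) by blast
  qed
  then show ?case
  proof
    assume "U \<inter> hker V W f \<subset> U' \<inter> hker V W f"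
    then have "chain_to R V (Suc a) (U' \<inter> hker V W f)" using ab s by (auto intro: chain_to.chain_to_Suc)
    moreover have "chain_to R W b (f ` U')"
      using ab s chain_to_Suc(2) by (auto intro!: chain_to_mono[OF ab(2)])
    ultimately show ?case using ab(3) by (intro exI[of _ "Suc a"] exI[of _ b]) auto
  next
    assume "f ` U \<subset> f ` U'"
    then have "chain_to R W (Suc b) (f ` U')" using ab s by (auto intro: chain_to.chain_to_Suc)
    moreover have "chain_to R V a (U' \<inter> hker V W f)"
      using ab s chain_to_Suc(2) by (auto intro!: chain_to_mono[OF ab(1)])
    ultimately show ?case using ab(3) by (intro exI[of _ a] exI[of _ "Suc b"]) auto
  qed
qed

text \<open>A chain in the kernel is continued by the preimages of a chain in the image of
  \<open>f\<close>. Subsets of the image are recovered from their preimages, so the inclusions stay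
  strict.\<close>

lemma chain_to_join:
  assumes "chain_to R V a (hker V W f)"
  shows "chain_to R W b U \<Longrightarrow> U \<subseteq> f ` carrier V \<Longrightarrow> chain_to R V (a + b) {x \<in> carrier V. f x \<in> U}"
proof (induction rule: chain_to.induct)
  case (chain_to_0 U)
  then show ?case
    using submod_vimage[OF V W f] assms W.submod_zero
    by (auto intro!: chain_to_mono[OF assms] simp: hker_def)
next
  case (chain_to_Suc n U U')
  then have "{x \<in> carrier V. f x \<in> U} \<subset> {x \<in> carrier V. f x \<in> U'}" by blast
  moreover have "chain_to R V (a + n) {x \<in> carrier V. f x \<in> U}"
    using chain_to_Suc by blast
  ultimately show ?case
    using submod_vimage[OF V W f chain_to_Suc(3)] by (simp add: chain_to.chain_to_Suc)
qed

lemma finite_length_split: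
  assumes "finite_length R (submod_on V (hker V W f))" "finite_length R (submod_on W (f ` carrier V))"
  shows "finite_length R V"
proof -
  obtain k l where kl: "\<And>n. chain_to R V n (hker V W f) \<Longrightarrow> n \<le> k"
    "\<And>n. chain_to R W n (f ` carrier V) \<Longrightarrow> n \<le> l"
    using assms by (auto simp: finite_length_def chain_to_submod_on V W ker im)
  have "n \<le> k + l" if "chain_to R V n (carrier V)" for n
  proof -
    have "carrier V \<inter> hker V W f = hker V W f" by (auto simp: hker_def)
    then show ?thesis using chain_to_split[OF that] kl by simp (meson add_mono order_trans)
  qed
  then show ?thesis by (auto simp: finite_length_def)
qed

lemma finite_length_image:
  assumes "finite_length R V"
  shows "finite_length R (submod_on W (f ` carrier V))"
proof -
  have e: "{x \<in> carrier V. f x \<in> f ` carrier V} = carrier V" by auto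
  have "chain_to R V 0 (hker V W f)" using ker by (rule chain_to_0)
  then have "chain_to R V n (carrier V)" if "chain_to R W n (f ` carrier V)" for n
    using chain_to_join[of 0 n "f ` carrier V"] that e by simp
  then show ?thesis using assms by (auto simp: finite_length_def chain_to_submod_on W im)
qed

lemma len_split:
  assumes "finite_length R V"
  shows "len R V = len R (submod_on V (hker V W f)) + len R (submod_on W (f ` carrier V))"
proof (rule antisym)
  have e: "carrier V \<inter> hker V W f = hker V W f" "{x \<in> carrier V. f x \<in> f ` carrier V} = carrier V"
    by (auto simp: hker_def)
  note fk = finite_length_submod[OF V ker assms] and fi = finite_length_image[OF assms]
  obtain a b where "chain_to R V a (hker V W f)" "chain_to R W b (f ` carrier V)" "len R V \<le> a + b"
    using chain_to_split[OF chain_to_len[OF V assms]] e by auto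
  moreover from this have "a \<le> len R (submod_on V (hker V W f))" "b \<le> len R (submod_on W (f ` carrier V))"
    using chain_to_le_len[OF fk] chain_to_le_len[OF fi]
    by (auto simp: chain_to_submod_on V W ker im)
  ultimately show "len R V \<le> len R (submod_on V (hker V W f)) + len R (submod_on W (f ` carrier V))"
    by linarith
  have "chain_to R V (len R (submod_on V (hker V W f))) (hker V W f)"
    "chain_to R W (len R (submod_on W (f ` carrier V))) (f ` carrier V)"
    using chain_to_len[OF V.left_module_submod[OF ker] fk] chain_to_len[OF W.left_module_submod[OF im] fi]
    by (auto simp: chain_to_submod_on V W ker im)
  from chain_to_le_len[OF assms] chain_to_join[OF this] e
  show "len R (submod_on V (hker V W f)) + len R (submod_on W (f ` carrier V)) \<le> len R V" by simp
qed



lemma finite_length_inj: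
  assumes "inj_on f (carrier V)" "finite_length R W"
  shows "finite_length R V"
  using assms finite_length_submod[OF W im] finite_length_zero_submod[OF V] inj_on_iff_hker[OF V W f]
  by (intro finite_length_split) auto

lemma finite_length_surj:
  assumes "f ` carrier V = carrier W" "finite_length R V"
  shows "finite_length R W"
  using finite_length_image[OF assms(2)] assms by simp

lemma len_inj_le:
  assumes "inj_on f (carrier V)" "finite_length R W"
  shows "len R V \<le> len R W"
proof -
  have "len R V = len R (submod_on W (f ` carrier V))"
    using len_split[OF finite_length_inj[OF assms]] inj_on_iff_hker[OF V W f] assms len_zero_submod[OF V]
    by simp
  moreover have "len R (submod_on W (f ` carrier V)) \<le> len R W"
    using len_submod_less[OF W im assms(2)] by (cases "f ` carrier V = carrier W") auto
  ultimately show ?thesis by simp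
qed

text \<open>A nonzero kernel has positive length, so additivity makes the drop strict. Over
  \<open>K\<close> this is the source of the strict inequality between dimensions of spaces of
  homomorphisms.\<close>

lemma len_surj_less:
  assumes "f ` carrier V = carrier W" "finite_length R V" "x \<in> carrier V" "f x = \<zero>\<^bsub>W\<^esub>" "x \<noteq> \<zero>\<^bsub>V\<^esub>"
  shows "len R W < len R V"
proof -
  interpret k: left_module R "submod_on V (hker V W f)" by (rule V.left_module_submod[OF ker])
  have "{\<zero>\<^bsub>V\<^esub>} \<noteq> hker V W f" using assms by (auto simp: hker_def)
  then have "0 < len R (submod_on V (hker V W f))"
    using len_submod_less[OF k.is_lmod k.submod_zero_set finite_length_submod[OF V ker assms(2)]]
    by auto
  then show ?thesis using len_split[OF assms(2)] assms(1) by simp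
qed

end

text \<open>If the kernel contained a nonzero element, the length of \<open>V\<close> would be
  smaller than itself.\<close>

lemma surj_endo_inj:
  assumes "left_module R V" "f \<in> lmod_hom R V V" "f ` carrier V = carrier V" "finite_length R V"
  shows "inj_on f (carrier V)"
proof -
  have "hker V V f = {\<zero>\<^bsub>V\<^esub>}"
    using len_surj_less[OF assms(1,1,2,3,4)] submod_hker[OF assms(1,1,2)]
    by (auto simp: hker_def submod_def)
  then show ?thesis using inj_on_iff_hker[OF assms(1,1,2)] by simp
qed

section \<open>Products, quotients and generation\<close>

definition prod_mod :: "('r, 'm, 's) module_scheme \<Rightarrow> ('r, 'n, 't) module_scheme \<Rightarrow> ('r, 'm \<times> 'n) module" where
  "prod_mod V W = \<lparr>carrier = carrier V \<times> carrier W, monoid.mult = (\<lambda>x y. undefined), one = undefined,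
     ring.zero = (\<zero>\<^bsub>V\<^esub>, \<zero>\<^bsub>W\<^esub>), ring.add = (\<lambda>x y. (fst x \<oplus>\<^bsub>V\<^esub> fst y, snd x \<oplus>\<^bsub>W\<^esub> snd y)),
     smult = (\<lambda>a x. (a \<odot>\<^bsub>V\<^esub> fst x, a \<odot>\<^bsub>W\<^esub> snd x))\<rparr>"

lemma prod_mod_simps [simp]:
  "carrier (prod_mod V W) = carrier V \<times> carrier W" "\<zero>\<^bsub>prod_mod V W\<^esub> = (\<zero>\<^bsub>V\<^esub>, \<zero>\<^bsub>W\<^esub>)"
  "x \<oplus>\<^bsub>prod_mod V W\<^esub> y = (fst x \<oplus>\<^bsub>V\<^esub> fst y, snd x \<oplus>\<^bsub>W\<^esub> snd y)"
  "a \<odot>\<^bsub>prod_mod V W\<^esub> x = (a \<odot>\<^bsub>V\<^esub> fst x, a \<odot>\<^bsub>W\<^esub> snd x)"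
  by (simp_all add: prod_mod_def)

lemma left_module_prod:
  assumes V: "left_module R V" and W: "left_module R W"
  shows "left_module R (prod_mod V W)"
proof -
  interpret V: left_module R V by fact
  interpret W: left_module R W by fact
  have "abelian_group (prod_mod V W)"
  proof (rule abelian_groupI)
    fix x assume "x \<in> carrier (prod_mod V W)"
    then show "\<exists>y\<in>carrier (prod_mod V W). y \<oplus>\<^bsub>prod_mod V W\<^esub> x = \<zero>\<^bsub>prod_mod V W\<^esub>"
      by (intro bexI[of _ "(\<ominus>\<^bsub>V\<^esub> fst x, \<ominus>\<^bsub>W\<^esub> snd x)"]) (auto simp: V.M.l_neg W.M.l_neg)
  qed (auto simp: V.M.a_ac W.M.a_ac)
  moreover have "left_module_axioms R (prod_mod V W)"
    by unfold_locales (auto simp: V.smult_l_distr V.smult_r_distr V.smult_assoc V.smult_one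
        W.smult_l_distr W.smult_r_distr W.smult_assoc W.smult_one)
  ultimately show ?thesis using V.A.ring_axioms by (intro left_module.intro)
qed

lemma finite_length_prod:
  assumes V: "left_module R V" and W: "left_module R W"
    and "finite_length R V" "finite_length R W"
  shows "finite_length R (prod_mod V W)"
proof -
  interpret V: left_module R V by fact
  interpret W: left_module R W by fact
  note P = left_module_prod[OF V W]
  interpret P: left_module R "prod_mod V W" by (rule P)
  have f: "fst \<in> lmod_hom R (prod_mod V W) V" and g: "snd \<in> lmod_hom R (prod_mod V W) W"
    by (auto simp: lmod_hom_def)
  have k: "submod R (prod_mod V W) (hker (prod_mod V W) V fst)" by (rule submod_hker[OF P V f])
  have im: "fst ` carrier (prod_mod V W) = carrier V" using W.M.zero_closed by force
  have "inj_on snd (hker (prod_mod V W) V fst)" by (auto simp: hker_def inj_on_def)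
  then have "finite_length R (submod_on (prod_mod V W) (hker (prod_mod V W) V fst))"
    using lmod_hom_submod_dom[OF g] submod_def[of R "prod_mod V W"] k assms(4)
    by (intro finite_length_inj[OF P.left_module_submod[OF k] W]) auto
  then show ?thesis using assms(3) im by (intro finite_length_split[OF P V f]) auto
qed

section \<open>The regular module, and finite length of finitely generated modules\<close>

definition regular :: "('r, 'x) ring_scheme \<Rightarrow> ('r, 'r) module" where
  "regular R = \<lparr>carrier = carrier R, monoid.mult = (\<lambda>x y. undefined), one = undefined,
     ring.zero = \<zero>\<^bsub>R\<^esub>, ring.add = ring.add R, smult = monoid.mult R\<rparr>"

lemma regular_simps [simp]:
  "carrier (regular R) = carrier R" "\<zero>\<^bsub>regular R\<^esub> = \<zero>\<^bsub>R\<^esub>" "x \<oplus>\<^bsub>regular R\<^esub> y = x \<oplus>\<^bsub>R\<^esub> y"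
  "a \<odot>\<^bsub>regular R\<^esub> x = a \<otimes>\<^bsub>R\<^esub> x"
  by (simp_all add: regular_def)

lemma left_module_regular: "ring R \<Longrightarrow> left_module R (regular R)"
proof -
  assume R: "ring R"
  interpret ring R by fact
  have "abelian_group (regular R)"
    by (rule abelian_groupI) (auto simp: a_ac intro: l_neg bexI[of _ "\<ominus>\<^bsub>R\<^esub> _"])
  moreover have "left_module_axioms R (regular R)"
    by unfold_locales (auto simp: l_distr r_distr m_assoc)
  ultimately show ?thesis using R by (intro left_module.intro)
qed

lemma (in left_module) lmod_hom_regular: "x \<in> carrier M \<Longrightarrow> (\<lambda>a. a \<odot> x) \<in> lmod_hom A (regular A) M"
  by (rule lmod_homI) (auto simp: smult_l_distr smult_assoc)

lemma (in left_module) submod_cyclic: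
  assumes "x \<in> carrier M"
  shows "submod A M ((\<lambda>a. a \<odot> x) ` carrier A)"
proof -
  note R = left_module_regular[OF A.ring_axioms]
  show ?thesis
    using submod_image[OF R is_lmod lmod_hom_regular[OF assms] left_module.submod_carrier[OF R]] by simp
qed

text \<open>Finite sums of submodules of finite length have finite length; the form with a common
  bound \<open>T\<close> is what is needed to reach a whole module from its generators.\<close>

lemma finite_length_cover:
  assumes V: "left_module R V" and "finite S"
    and "\<And>s. s \<in> S \<Longrightarrow> submod R V (U s) \<and> finite_length R (submod_on V (U s))"
  shows "\<exists>T. submod R V T \<and> finite_length R (submod_on V T) \<and> (\<forall>s\<in>S. U s \<subseteq> T)"
  using assms(2,3)
proof (induction S)
  case empty
  interpret left_module R V by fact
  show ?case using submod_zero_set finite_length_zero_submod[OF V] by blast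
next
  case (insert s S)
  interpret V: left_module R V by fact
  obtain T where T: "submod R V T" "finite_length R (submod_on V T)" "\<forall>s\<in>S. U s \<subseteq> T"
    using insert by blast
  have s: "submod R V (U s)" "finite_length R (submod_on V (U s))" using insert by auto
  \<comment> \<open>\<open>T\<close> is enlarged to its sum with \<open>U s\<close>, the image of
    the product under addition.\<close>
  let ?P = "prod_mod (submod_on V (U s)) (submod_on V T)"
  let ?f = "\<lambda>x. fst x \<oplus>\<^bsub>V\<^esub> snd x"
  have c: "U s \<subseteq> carrier V" "T \<subseteq> carrier V" using T s by (auto simp: submod_def)
  note P = left_module_prod[OF V.left_module_submod[OF s(1)] V.left_module_submod[OF T(1)]]
  interpret P: left_module R ?P by (rule P)
  have f: "?f \<in> lmod_hom R ?P V"
    using c by (intro lmod_homI) (auto simp: V.M.a_ac V.smult_r_distr subset_iff)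
  have "finite_length R (submod_on V (?f ` carrier ?P))" "submod R V (?f ` carrier ?P)"
    using finite_length_image[OF P V f] finite_length_prod[OF _ _ s(2) T(2)] V.left_module_submod s T
      submod_image[OF P V f P.submod_carrier]
    by auto
  moreover have "U s \<subseteq> ?f ` carrier ?P"
  proof
    fix x assume "x \<in> U s"
    then show "x \<in> ?f ` carrier ?P"
      using c V.submod_zero[OF T(1)] by (intro image_eqI[of _ _ "(x, \<zero>\<^bsub>V\<^esub>)"]) auto
  qed
  moreover have "T \<subseteq> ?f ` carrier ?P"
  proof
    fix x assume "x \<in> T"
    then show "x \<in> ?f ` carrier ?P"
      using c V.submod_zero[OF s(1)] by (intro image_eqI[of _ _ "(\<zero>\<^bsub>V\<^esub>, x)"]) auto
  qed
  ultimately obtain I where I: "submod R V I" "finite_length R (submod_on V I)" "U s \<subseteq> I" "T \<subseteq> I"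
    by blast
  then have "\<forall>t\<in>insert s S. U t \<subseteq> I" using T(3) by blast
  then show ?case using I by blast
qed

text \<open>The cyclic submodules of the generators are images of the regular module, and a
  submodule containing all of them is the whole module.\<close>

lemma finite_length_fg:
  assumes V: "left_module R V" and fg: "finitely_generated R V"
    and R: "finite_length R (regular R)"
  shows "finite_length R V"
proof -
  interpret V: left_module R V by fact
  note reg = left_module_regular[OF V.A.ring_axioms]
  obtain S where S: "finite S" "S \<subseteq> carrier V"
    "\<And>x. x \<in> carrier V \<Longrightarrow> \<exists>c\<in>S \<rightarrow> carrier R. x = (\<Oplus>\<^bsub>V\<^esub>s\<in>S. c s \<odot>\<^bsub>V\<^esub> s)"
    using fg unfolding finitely_generated_def by metis
  define U where "U s = (\<lambda>a. a \<odot>\<^bsub>V\<^esub> s) ` carrier R" for s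
  have U: "submod R V (U s) \<and> finite_length R (submod_on V (U s))" if "s \<in> S" for s
  proof -
    have h: "(\<lambda>a. a \<odot>\<^bsub>V\<^esub> s) \<in> lmod_hom R (regular R) V" using V.lmod_hom_regular S that by blast
    show ?thesis
      using V.submod_cyclic[of s] finite_length_image[OF reg V h R] S(2) that by (auto simp: U_def)
  qed
  obtain T where T: "submod R V T" "finite_length R (submod_on V T)" "\<And>s. s \<in> S \<Longrightarrow> U s \<subseteq> T"
    using finite_length_cover[where U = U, OF V S(1) U] by blast
  have "x \<in> T" if x: "x \<in> carrier V" for x
  proof -
    obtain c where c: "c \<in> S \<rightarrow> carrier R" "x = (\<Oplus>\<^bsub>V\<^esub>s\<in>S. c s \<odot>\<^bsub>V\<^esub> s)" using S(3)[OF x] by blast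
    have "(\<lambda>s. c s \<odot>\<^bsub>V\<^esub> s) \<in> S \<rightarrow> T" using c T(3) by (auto simp: U_def)
    then show ?thesis using V.submod_finsum[OF T(1) S(1)] c by simp
  qed
  then have "T = carrier V" using V.submod_subset[OF T(1)] by blast
  then show ?thesis using T(2) by simp
qed

lemma (in left_module) smult_finsum:
  assumes "finite S" "f \<in> S \<rightarrow> carrier M" "a \<in> carrier A"
  shows "a \<odot> (\<Oplus>s\<in>S. f s) = (\<Oplus>s\<in>S. a \<odot> f s)"
  using assms(1,2)
proof (induction S)
  case (insert s S)
  then have "f \<in> S \<rightarrow> carrier M" "f s \<in> carrier M" "(\<lambda>s. a \<odot> f s) \<in> S \<rightarrow> carrier M"
    using assms(3) by auto
  then show ?case using insert assms(3) by (simp add: M.finsum_insert smult_r_distr)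
qed (simp add: assms(3))

section \<open>Spans of finite sets\<close>

definition lspan :: "('r, 'x) ring_scheme \<Rightarrow> ('r, 'm, 's) module_scheme \<Rightarrow> 'm set \<Rightarrow> 'm set" where
  "lspan R V S = {\<Oplus>\<^bsub>V\<^esub>s\<in>S. c s \<odot>\<^bsub>V\<^esub> s | c. c \<in> S \<rightarrow> carrier R}"

context left_module
begin

lemma submod_lspan:
  assumes S: "finite S" "S \<subseteq> carrier M"
  shows "submod A M (lspan A M S)"
proof -
  have c: "(\<lambda>s. c s \<odot> s) \<in> S \<rightarrow> carrier M" if "c \<in> S \<rightarrow> carrier A" for c
    using that S by auto
  show ?thesis
    unfolding submod_def
  proof (intro conjI ballI)
    show "lspan A M S \<subseteq> carrier M" using c by (auto simp: lspan_def)
    have "(\<Oplus>s\<in>S. \<zero>\<^bsub>A\<^esub> \<odot> s) = (\<Oplus>s\<in>S. \<zero>)"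
      using S by (intro M.finsum_cong') auto
    then show "\<zero> \<in> lspan A M S"
      by (auto simp: lspan_def intro!: exI[of _ "\<lambda>_. \<zero>\<^bsub>A\<^esub>"])
    fix x assume "x \<in> lspan A M S"
    then obtain d where d: "d \<in> S \<rightarrow> carrier A" "x = (\<Oplus>s\<in>S. d s \<odot> s)" by (auto simp: lspan_def)
    {
      fix y assume "y \<in> lspan A M S"
      then obtain e where e: "e \<in> S \<rightarrow> carrier A" "y = (\<Oplus>s\<in>S. e s \<odot> s)" by (auto simp: lspan_def)
      have "x \<oplus> y = (\<Oplus>s\<in>S. (d s \<oplus>\<^bsub>A\<^esub> e s) \<odot> s)"
        unfolding d(2) e(2) M.finsum_addf[OF c[OF d(1)] c[OF e(1)], symmetric]
        using S d e by (intro M.finsum_cong') (auto simp: smult_l_distr Pi_iff subset_iff)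
      then show "x \<oplus> y \<in> lspan A M S"
        using d e by (auto simp: lspan_def Pi_iff intro!: exI[of _ "\<lambda>s. d s \<oplus>\<^bsub>A\<^esub> e s"])
    }
    fix a assume a: "a \<in> carrier A"
    have "a \<odot> x = (\<Oplus>s\<in>S. (a \<otimes>\<^bsub>A\<^esub> d s) \<odot> s)"
      unfolding d(2) smult_finsum[OF S(1) c[OF d(1)] a]
      using S d a by (intro M.finsum_cong') (auto simp: smult_assoc Pi_iff subset_iff)
    then show "a \<odot> x \<in> lspan A M S"
      using d a by (auto simp: lspan_def Pi_iff intro!: exI[of _ "\<lambda>s. a \<otimes>\<^bsub>A\<^esub> d s"])
  qed
qed

lemma subset_lspan:
  assumes S: "finite S" "S \<subseteq> carrier M"
  shows "S \<subseteq> lspan A M S"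
proof
  fix s assume s: "s \<in> S"
  let ?c = "\<lambda>t. if t = s then \<one>\<^bsub>A\<^esub> else \<zero>\<^bsub>A\<^esub>"
  have "(\<Oplus>t\<in>S. ?c t \<odot> t) = (\<Oplus>t\<in>S. if s = t then t else \<zero>)"
    using S by (intro M.finsum_cong') (auto simp: smult_one subset_iff)
  also have "\<dots> = s"
    using M.finsum_singleton[OF s S(1), of "\<lambda>t. t"] S by auto
  finally show "s \<in> lspan A M S"
    by (auto simp: lspan_def intro!: exI[of _ ?c])
qed

lemma lspan_subset:
  assumes "submod A M U" "finite S" "S \<subseteq> U"
  shows "lspan A M S \<subseteq> U"
  using assms by (auto simp: lspan_def Pi_iff subset_iff intro!: submod_finsum submod_smult)

lemma finitely_generated_iff_lspan:
  "finitely_generated A M \<longleftrightarrow> (\<exists>S. finite S \<and> S \<subseteq> carrier M \<and> carrier M = lspan A M S)"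
proof -
  have "(\<forall>x\<in>carrier M. \<exists>c\<in>S \<rightarrow> carrier A. x = (\<Oplus>s\<in>S. c s \<odot> s)) \<longleftrightarrow> carrier M = lspan A M S"
    if "finite S" "S \<subseteq> carrier M" for S
    using submod_subset[OF submod_lspan[OF that]] by (auto simp: lspan_def)
  then show ?thesis unfolding finitely_generated_def by (intro ex_cong1 conj_cong refl)
qed

text \<open>Choose a finite set whose span ends a chain that is longest among chains ending in such
  spans. An element outside the span could be added to the set and would lengthen the chain.\<close>

lemma finitely_generated_finite_length:
  assumes "finite_length A M"
  shows "finitely_generated A M"
proof -
  define P where "P n \<longleftrightarrow> (\<exists>S. finite S \<and> S \<subseteq> carrier M \<and> chain_to A M n (lspan A M S))" for n
  obtain N where N: "\<And>n. chain_to A M n (carrier M) \<Longrightarrow> n \<le> N"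
    using assms by (auto simp: finite_length_def)
  have b: "n \<le> N" if "P n" for n
    using that N chain_to_mono[OF _ _ submod_carrier] submod_subset[OF submod_lspan]
    unfolding P_def by blast
  have "P 0" unfolding P_def by (intro exI[of _ "{}"]) (auto intro!: chain_to_0 submod_lspan)
  then have "P (GREATEST n. P n)" using b by (intro GreatestI_nat[of P 0 N]) auto
  then obtain S where S: "finite S" "S \<subseteq> carrier M" "chain_to A M (GREATEST n. P n) (lspan A M S)"
    unfolding P_def by blast
  have "x \<in> lspan A M S" if x: "x \<in> carrier M" for x
  proof (rule ccontr)
    assume n: "x \<notin> lspan A M S"
    have i: "finite (insert x S)" "insert x S \<subseteq> carrier M" using S x by auto
    have "lspan A M S \<subset> lspan A M (insert x S)"
      using subset_lspan[OF i] lspan_subset[OF submod_lspan[OF i] S(1)] n by auto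
    then have "P (Suc (GREATEST n. P n))"
      using chain_to_Suc[OF S(3) _ submod_lspan[OF i]] i unfolding P_def by blast
    then show False using Greatest_le_nat[of P _ N] b by force
  qed
  then have "carrier M = lspan A M S" using submod_subset[OF submod_lspan[OF S(1,2)]] by blast
  then show ?thesis using S by (auto simp: finitely_generated_iff_lspan)
qed

end

text \<open>
  The quotient lives on representatives of the cosets, so that it has the same type of elements.
\<close>

definition qrep :: "('r, 'm, 's) module_scheme \<Rightarrow> 'm set \<Rightarrow> 'm \<Rightarrow> 'm" where
  "qrep V U x = (SOME y. y \<in> carrier V \<and> x \<ominus>\<^bsub>V\<^esub> y \<in> U)"

definition quot_mod :: "('r, 'm, 's) module_scheme \<Rightarrow> 'm set \<Rightarrow> ('r, 'm) module" where
  "quot_mod V U = \<lparr>carrier = qrep V U ` carrier V, monoid.mult = (\<lambda>x y. undefined), one = undefined,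
     ring.zero = qrep V U \<zero>\<^bsub>V\<^esub>, ring.add = (\<lambda>x y. qrep V U (x \<oplus>\<^bsub>V\<^esub> y)),
     smult = (\<lambda>a x. qrep V U (a \<odot>\<^bsub>V\<^esub> x))\<rparr>"

context left_module
begin

context
  fixes U assumes U: "submod A M U"
begin

private lemma qrep: "x \<in> carrier M \<Longrightarrow> qrep M U x \<in> carrier M \<and> x \<ominus> qrep M U x \<in> U"
  unfolding qrep_def by (rule someI[of _ x]) (auto simp: a_minus_def M.r_neg submod_zero[OF U])

private lemma minus_ac:
  "x \<in> carrier M \<Longrightarrow> y \<in> carrier M \<Longrightarrow> z \<in> carrier M \<Longrightarrow> x \<ominus> z = (x \<ominus> y) \<oplus> (y \<ominus> z)"
  "x \<in> carrier M \<Longrightarrow> y \<in> carrier M \<Longrightarrow> y \<ominus> x = \<ominus> (x \<ominus> y)"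
  by (simp_all add: a_minus_def M.minus_add M.a_ac M.l_neg M.r_neg M.r_neg1 M.r_neg2)

private lemma qrep_eq:
  assumes "x \<in> carrier M" "y \<in> carrier M"
  shows "qrep M U x = qrep M U y \<longleftrightarrow> x \<ominus> y \<in> U"
proof
  assume "qrep M U x = qrep M U y"
  then show "x \<ominus> y \<in> U"
    using assms qrep minus_ac(1)[of x "qrep M U x" y] minus_ac(2)[of y "qrep M U y"]
    by (metis submod_add[OF U] submod_uminus[OF U])
next
  assume xy: "x \<ominus> y \<in> U"
  then have "y \<ominus> x \<in> U" using assms minus_ac(2) by (metis submod_uminus[OF U])
  then have "x \<ominus> z \<in> U \<longleftrightarrow> y \<ominus> z \<in> U" if "z \<in> carrier M" for z
    using that xy assms minus_ac(1) by (metis submod_add[OF U])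
  \<comment> \<open>The two representatives are chosen from the same predicate, so the choices
    agree.\<close>
  then have "(\<lambda>z. z \<in> carrier M \<and> x \<ominus> z \<in> U) = (\<lambda>z. z \<in> carrier M \<and> y \<ominus> z \<in> U)" by blast
  then show "qrep M U x = qrep M U y" by (simp add: qrep_def)
qed

private lemma qrep_closed [simp]: "x \<in> carrier M \<Longrightarrow> qrep M U x \<in> carrier M"
  using qrep by blast

private lemma qrep_qrep [simp]: "x \<in> carrier M \<Longrightarrow> qrep M U (qrep M U x) = qrep M U x"
  using qrep qrep_eq by metis

private lemma qrep_add:
  assumes "x \<in> carrier M" "y \<in> carrier M"
  shows "qrep M U (qrep M U x \<oplus> qrep M U y) = qrep M U (x \<oplus> y)"
proof -
  have "(x \<oplus> y) \<ominus> (qrep M U x \<oplus> qrep M U y) = (x \<ominus> qrep M U x) \<oplus> (y \<ominus> qrep M U y)"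
    using assms by (simp add: a_minus_def M.minus_add M.a_ac)
  then have "(x \<oplus> y) \<ominus> (qrep M U x \<oplus> qrep M U y) \<in> U"
    using qrep[OF assms(1)] qrep[OF assms(2)] submod_add[OF U] by simp
  then show ?thesis using assms qrep_eq[of "x \<oplus> y" "qrep M U x \<oplus> qrep M U y"] by simp
qed

private lemma qrep_smult:
  assumes "a \<in> carrier A" "x \<in> carrier M"
  shows "qrep M U (a \<odot> qrep M U x) = qrep M U (a \<odot> x)"
proof -
  have "(a \<odot> x) \<ominus> (a \<odot> qrep M U x) = a \<odot> (x \<ominus> qrep M U x)"
    using assms by (simp add: a_minus_def smult_r_distr smult_minus_right)
  then have "(a \<odot> x) \<ominus> (a \<odot> qrep M U x) \<in> U"
    using qrep[OF assms(2)] submod_smult[OF U assms(1)] by simp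
  then show ?thesis using assms qrep_eq[of "a \<odot> x" "a \<odot> qrep M U x"] by simp
qed

private lemma quot_simps [simp]:
  "carrier (quot_mod M U) = qrep M U ` carrier M" "\<zero>\<^bsub>quot_mod M U\<^esub> = qrep M U \<zero>"
  "x \<in> carrier M \<Longrightarrow> y \<in> carrier M \<Longrightarrow> qrep M U x \<oplus>\<^bsub>quot_mod M U\<^esub> qrep M U y = qrep M U (x \<oplus> y)"
  "a \<in> carrier A \<Longrightarrow> x \<in> carrier M \<Longrightarrow> a \<odot>\<^bsub>quot_mod M U\<^esub> qrep M U x = qrep M U (a \<odot> x)"
  by (simp_all add: quot_mod_def qrep_add qrep_smult)

lemma left_module_quot: "left_module A (quot_mod M U)"
proof -
  have "abelian_group (quot_mod M U)"
  proof (rule abelian_groupI)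
    fix x assume "x \<in> carrier (quot_mod M U)"
    then obtain u where "u \<in> carrier M" "x = qrep M U u" by auto
    then show "\<exists>y\<in>carrier (quot_mod M U). y \<oplus>\<^bsub>quot_mod M U\<^esub> x = \<zero>\<^bsub>quot_mod M U\<^esub>"
      by (intro bexI[of _ "qrep M U (\<ominus> u)"]) (auto simp: M.l_neg)
  qed (auto simp: M.a_ac)
  moreover have "left_module_axioms A (quot_mod M U)"
    by unfold_locales
      (auto simp: smult_l_distr smult_r_distr smult_assoc smult_one)
  ultimately show ?thesis using A.ring_axioms by (intro left_module.intro)
qed

lemma lmod_hom_qrep: "qrep M U \<in> lmod_hom A M (quot_mod M U)"
  by (rule lmod_homI) auto

lemma qrep_surj: "qrep M U ` carrier M = carrier (quot_mod M U)"
  by simp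

lemma hker_qrep: "hker M (quot_mod M U) (qrep M U) = U"
proof -
  have "x \<ominus> \<zero> = x" if "x \<in> carrier M" for x
    using that M.add.inv_one by (simp add: a_minus_def)
  then show ?thesis using submod_subset[OF U] qrep_eq by (auto simp: hker_def)
qed

end

end

section \<open>Surjectivity from generators, and factorization of homomorphisms\<close>

lemma lmod_hom_onto:
  assumes V: "left_module R V" and W: "left_module R W" and f: "f \<in> lmod_hom R V W"
    and "finite S" "carrier W = lspan R W S" "S \<subseteq> f ` carrier V"
  shows "f ` carrier V = carrier W"
  using left_module.lspan_subset[OF W submod_image[OF V W f left_module.submod_carrier[OF V]] assms(4,6)]
    assms(5) lmod_hom_closed[OF f] by blast

text \<open>Compose \<open>f\<close> with a set-theoretic section of \<open>q\<close>: as
  \<open>f\<close> is constant on the fibres of \<open>q\<close>, the choice of the section does not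
  matter and the composition is a homomorphism.\<close>

lemma lmod_hom_factor_surj:
  assumes V: "left_module R V" and Q: "left_module R Q" and W: "left_module R W"
    and q: "q \<in> lmod_hom R V Q" "q ` carrier V = carrier Q"
    and f: "f \<in> lmod_hom R V W" and ker: "\<And>x. x \<in> carrier V \<Longrightarrow> q x = \<zero>\<^bsub>Q\<^esub> \<Longrightarrow> f x = \<zero>\<^bsub>W\<^esub>"
  shows "\<exists>g\<in>lmod_hom R Q W. \<forall>x\<in>carrier V. g (q x) = f x"
proof -
  interpret V: left_module R V by fact
  interpret Q: left_module R Q by fact
  interpret W: left_module R W by fact
  define s where "s y = inv_into (carrier V) q y" for y
  have s: "s y \<in> carrier V" "q (s y) = y" if "y \<in> carrier Q" for y
    using that q(2) by (auto simp: s_def f_inv_into_f inv_into_into)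
  have *: "f x = f y" if "x \<in> carrier V" "y \<in> carrier V" "q x = q y" for x y
  proof -
    have "q (x \<ominus>\<^bsub>V\<^esub> y) = \<zero>\<^bsub>Q\<^esub>"
      using that lmod_hom_minus[OF V Q q(1)] lmod_hom_closed[OF q(1)]
      by (simp add: a_minus_def Q.M.r_neg)
    then have "f (x \<ominus>\<^bsub>V\<^esub> y) = \<zero>\<^bsub>W\<^esub>" using ker that by simp
    then have "f x \<ominus>\<^bsub>W\<^esub> f y = \<zero>\<^bsub>W\<^esub>" using that lmod_hom_minus[OF V W f] by simp
    moreover have c: "f x \<in> carrier W" "f y \<in> carrier W" using that lmod_hom_closed[OF f] by auto
    ultimately have "f x = \<ominus>\<^bsub>W\<^esub> (\<ominus>\<^bsub>W\<^esub> f y)"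
      by (intro W.M.minus_equality[symmetric]) (auto simp: a_minus_def)
    then show ?thesis using c by simp
  qed
  have "f (s (q x)) = f x" if "x \<in> carrier V" for x
    using that s lmod_hom_closed[OF q(1)] by (intro *) auto
  moreover have "(\<lambda>y. f (s y)) \<in> lmod_hom R Q W"
  proof (rule lmod_homI)
    fix x y assume xy: "x \<in> carrier Q" "y \<in> carrier Q"
    then have "f (s (x \<oplus>\<^bsub>Q\<^esub> y)) = f (s x \<oplus>\<^bsub>V\<^esub> s y)"
      using s lmod_hom_add[OF q(1)] by (intro *) auto
    then show "f (s (x \<oplus>\<^bsub>Q\<^esub> y)) = f (s x) \<oplus>\<^bsub>W\<^esub> f (s y)"
      using xy s lmod_hom_add[OF f] by simp
  next
    fix a x assume x: "a \<in> carrier R" "x \<in> carrier Q"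
    then have "f (s (a \<odot>\<^bsub>Q\<^esub> x)) = f (a \<odot>\<^bsub>V\<^esub> s x)"
      using s lmod_hom_smult[OF q(1)] by (intro *) auto
    then show "f (s (a \<odot>\<^bsub>Q\<^esub> x)) = a \<odot>\<^bsub>W\<^esub> f (s x)"
      using x s lmod_hom_smult[OF f] by simp
  qed (use s lmod_hom_closed[OF f] in auto)
  ultimately show ?thesis by (intro bexI[of _ "\<lambda>y. f (s y)"]) auto
qed

lemma lmod_hom_factor_inj:
  assumes V: "left_module R V" and U: "left_module R U"
    and i: "i \<in> lmod_hom R V W" "inj_on i (carrier V)"
    and f: "f \<in> lmod_hom R U W" "f ` carrier U \<subseteq> i ` carrier V"
  shows "\<exists>g\<in>lmod_hom R U V. \<forall>x\<in>carrier U. i (g x) = f x"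
proof -
  interpret V: left_module R V by fact
  interpret U: left_module R U by fact
  define g where "g x = inv_into (carrier V) i (f x)" for x
  have g: "g x \<in> carrier V" "i (g x) = f x" if "x \<in> carrier U" for x
  proof -
    have "f x \<in> i ` carrier V" using that f(2) by blast
    then show "g x \<in> carrier V" "i (g x) = f x"
      by (simp_all add: g_def f_inv_into_f inv_into_into)
  qed
  have *: "x = y" if "x \<in> carrier V" "y \<in> carrier V" "i x = i y" for x y
    using i(2) that by (auto simp: inj_on_def)
  have "g \<in> lmod_hom R U V"
    by (rule lmod_homI) (auto simp: g lmod_hom_add[OF i(1)] lmod_hom_smult[OF i(1)]
        lmod_hom_add[OF f(1)] lmod_hom_smult[OF f(1)] intro!: *)
  then show ?thesis using g by blast
qed

section \<open>Modules over a finite dimensional algebra\<close>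

lemma lmod_hom_inv_into:
  assumes "f \<in> lmod_iso A M N" "left_module A M" "left_module A N"
  shows "\<exists>g\<in>lmod_hom A N M. (\<forall>x\<in>carrier M. g (f x) = x) \<and> (\<forall>y\<in>carrier N. f (g y) = y)"
  using lmod_iso_iff_invertible[OF assms(2,3)] assms(1) by blast

text \<open>Given by its maps rather than by a construction: objects of \<open>mod_cat\<close> have
  lists as elements, so a direct sum exists there only up to isomorphism.\<close>

definition biproduct where
  "biproduct A P M N i j p q \<longleftrightarrow> i \<in> lmod_hom A M P \<and> j \<in> lmod_hom A N P \<and> p \<in> lmod_hom A P M \<and>
     q \<in> lmod_hom A P N \<and> (\<forall>x\<in>carrier M. p (i x) = x \<and> q (i x) = \<zero>\<^bsub>N\<^esub>) \<and>
     (\<forall>y\<in>carrier N. p (j y) = \<zero>\<^bsub>M\<^esub> \<and> q (j y) = y) \<and> (\<forall>z\<in>carrier P. z = i (p z) \<oplus>\<^bsub>P\<^esub> j (q z))"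

definition projective :: "('a, 'x) ring_scheme \<Rightarrow> ('a, 'a list) module \<Rightarrow> bool" where
  "projective A P \<longleftrightarrow> P \<in> mod_cat A \<and>
     (\<forall>X\<in>mod_cat A. \<forall>Y\<in>mod_cat A. \<forall>g\<in>lmod_hom A X Y. \<forall>f\<in>lmod_hom A P Y.
        g ` carrier X = carrier Y \<longrightarrow> (\<exists>h\<in>lmod_hom A P X. \<forall>x\<in>carrier P. g (h x) = f x))"

lemma lmod_hom_sum:
  assumes "left_module A M" "left_module A N" "f \<in> lmod_hom A M N" "g \<in> lmod_hom A M N"
  shows "(\<lambda>x. f x \<oplus>\<^bsub>N\<^esub> g x) \<in> lmod_hom A M N"
proof -
  interpret N: left_module A N by fact
  show ?thesis
    using lmod_homD[OF assms(3)] lmod_homD[OF assms(4)]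
    by (intro lmod_homI) (auto simp: N.M.a_ac N.smult_r_distr)
qed

lemma lmod_hom_diff:
  assumes "left_module A M" "left_module A N" "f \<in> lmod_hom A M N" "g \<in> lmod_hom A M N"
  shows "(\<lambda>x. f x \<ominus>\<^bsub>N\<^esub> g x) \<in> lmod_hom A M N"
proof -
  interpret N: left_module A N by fact
  show ?thesis
    using lmod_homD[OF assms(3)] lmod_homD[OF assms(4)]
    by (intro lmod_homI)
      (auto simp: a_minus_def N.M.a_ac N.M.minus_add N.smult_r_distr N.smult_minus_right)
qed

lemma lmod_hom_const_zero:
  assumes "left_module A N"
  shows "(\<lambda>x. \<zero>\<^bsub>N\<^esub>) \<in> lmod_hom A M N"
proof -
  interpret N: left_module A N by fact
  show ?thesis by (intro lmod_homI) auto
qed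

context fin_dim_algebra
begin

lemma left_module_K: "left_module K A"
  using K.ring_axioms KA.abelian_group_axioms
  by (intro left_module.intro left_module_axioms.intro)
    (auto simp: KA.smult_l_distr KA.smult_r_distr KA.smult_assoc1)

text \<open>A field has no submodules besides zero and itself.\<close>

lemma finite_length_regular_K: "finite_length K (regular K)"
proof -
  have *: "U = {\<zero>\<^bsub>K\<^esub>} \<or> U = carrier K" if U: "submod K (regular K) U" for U
  proof (cases "\<exists>x\<in>U. x \<noteq> \<zero>\<^bsub>K\<^esub>")
    case True
    then obtain x where x: "x \<in> U" "x \<noteq> \<zero>\<^bsub>K\<^esub>" "x \<in> carrier K" using U by (auto simp: submod_def)
    then have inv: "inv\<^bsub>K\<^esub> x \<in> carrier K" "inv\<^bsub>K\<^esub> x \<otimes>\<^bsub>K\<^esub> x = \<one>\<^bsub>K\<^esub>"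
      using K.field_Units by (auto intro: K.Units_l_inv)
    have "y \<in> U" if y: "y \<in> carrier K" for y
    proof -
      have "(y \<otimes>\<^bsub>K\<^esub> inv\<^bsub>K\<^esub> x) \<otimes>\<^bsub>K\<^esub> x \<in> U"
        using U x inv y by (auto simp: submod_def)
      then show ?thesis using x inv y by (simp add: K.m_assoc)
    qed
    then show ?thesis using U by (auto simp: submod_def)
  qed (use U in \<open>auto simp: submod_def\<close>)
  \<comment> \<open>The bound is stated for every top \<open>U\<close> so that the induction can use
    that the term below a strict inclusion is zero.\<close>
  have "n \<le> (if U = {\<zero>\<^bsub>K\<^esub>} then 0 else 1)" if "chain_to K (regular K) n U" for n U
    using that
  proof induction
    case (chain_to_Suc n U U')
    then have "U = {\<zero>\<^bsub>K\<^esub>}" "U' \<noteq> {\<zero>\<^bsub>K\<^esub>}"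
      using *[OF chain_to_submod[OF chain_to_Suc(1)]] *[OF chain_to_Suc(3)] K.zero_closed by blast+
    then show ?case using chain_to_Suc by simp
  qed simp
  then have "\<forall>n. chain_to K (regular K) n (carrier (regular K)) \<longrightarrow> n \<le> 1" by (metis le_SucI le_zero_eq One_nat_def)
  then show ?thesis unfolding finite_length_def by blast
qed

lemma finite_length_K: "finite_length K A"
  using finite_spanning unfolding finitely_generated_def[symmetric]
  by (intro finite_length_fg[OF left_module_K _ finite_length_regular_K])
    (auto simp: finitely_generated_def)

text \<open>The structure map from the scalars to the centre of \<open>A\<close>. Through it every
  \<open>A\<close>-module is a \<open>K\<close>-module, and a scalar multiple of a homomorphism is
  again a homomorphism.\<close>

definition scal :: "'k \<Rightarrow> 'a" where
  "scal c = c \<odot>\<^bsub>A\<^esub> \<one>\<^bsub>A\<^esub>"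

lemma scal:
  shows scal_closed [simp, intro]: "c \<in> carrier K \<Longrightarrow> scal c \<in> carrier A"
    and scal_mult_left: "c \<in> carrier K \<Longrightarrow> a \<in> carrier A \<Longrightarrow> scal c \<otimes>\<^bsub>A\<^esub> a = c \<odot>\<^bsub>A\<^esub> a"
    and scal_mult_right: "c \<in> carrier K \<Longrightarrow> a \<in> carrier A \<Longrightarrow> a \<otimes>\<^bsub>A\<^esub> scal c = c \<odot>\<^bsub>A\<^esub> a"
    and scal_add: "c \<in> carrier K \<Longrightarrow> d \<in> carrier K \<Longrightarrow> scal (c \<oplus>\<^bsub>K\<^esub> d) = scal c \<oplus>\<^bsub>A\<^esub> scal d"
    and scal_mult: "c \<in> carrier K \<Longrightarrow> d \<in> carrier K \<Longrightarrow> scal (c \<otimes>\<^bsub>K\<^esub> d) = scal c \<otimes>\<^bsub>A\<^esub> scal d"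
    and scal_one: "scal \<one>\<^bsub>K\<^esub> = \<one>\<^bsub>A\<^esub>"
proof -
  show "scal (c \<otimes>\<^bsub>K\<^esub> d) = scal c \<otimes>\<^bsub>A\<^esub> scal d" if "c \<in> carrier K" "d \<in> carrier K"
    using that KA.smult_assoc1[of c d "\<one>\<^bsub>A\<^esub>"] smult_mult_left[of c "\<one>\<^bsub>A\<^esub>" "d \<odot>\<^bsub>A\<^esub> \<one>\<^bsub>A\<^esub>"]
    by (simp add: scal_def)
qed (simp_all add: scal_def smult_mult_left smult_mult_right KA.smult_l_distr)

text \<open>A left ideal is a \<open>K\<close>-subspace, so a chain of left ideals is a chain of
  subspaces of \<open>A\<close>.\<close>

lemma finite_length_regular_A: "finite_length A (regular A)"
proof -
  have *: "submod K A X" if "submod A (regular A) X" for X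
    unfolding submod_def
  proof (intro conjI ballI)
    fix c x assume "c \<in> carrier K" "x \<in> X"
    moreover from this have "scal c \<otimes>\<^bsub>A\<^esub> x \<in> X" "x \<in> carrier A" using that by (auto simp: submod_def)
    ultimately show "c \<odot>\<^bsub>A\<^esub> x \<in> X" using scal_mult_left[of c x] by simp
  qed (use that in \<open>auto simp: submod_def\<close>)
  have "chain_to K A n (carrier A)" if "chain_to A (regular A) n (carrier A)" for n
    using chain_to_transfer[OF that, of UNIV K A] * by simp
  then show ?thesis using finite_length_K by (auto simp: finite_length_def)
qed

text \<open>Finite generation does not visibly pass to submodules, finite length does; membership of
  submodules and quotients in \<open>mod_cat\<close> is therefore checked through length.\<close>

lemma mod_cat_iff: "M \<in> mod_cat A \<longleftrightarrow> left_module A M \<and> finite_length A M"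
  using finite_length_fg[OF _ _ finite_length_regular_A]
  by (auto simp: mod_cat_def left_module.finitely_generated_finite_length)

lemma mod_catD: "M \<in> mod_cat A \<Longrightarrow> left_module A M"
  by (simp add: mod_cat_iff)

text \<open>The way back into the category for constructions on other element types, such as
  products and the regular module.\<close>

lemma mod_cat_realize:
  assumes "left_module A M" "finite_length A M"
  shows "\<exists>N\<in>mod_cat A. \<exists>h\<in>lmod_hom A M N. \<exists>g\<in>lmod_hom A N M.
    (\<forall>x\<in>carrier M. g (h x) = x) \<and> (\<forall>y\<in>carrier N. h (g y) = y)"
proof -
  obtain N where N: "N \<in> mod_cat A" "lmod_isomorphic A M N"
    using mod_cat_complete[OF assms(1) left_module.finitely_generated_finite_length[OF assms]] by blast
  then obtain h where h: "h \<in> lmod_iso A M N" by (auto simp: lmod_isomorphic_def)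
  then have "h \<in> lmod_hom A M N" by (simp add: lmod_iso_def)
  then show ?thesis
    using N lmod_hom_inv_into[OF h assms(1) mod_catD[OF N(1)]] by blast
qed

lemma submod_mod_cat: "M \<in> mod_cat A \<Longrightarrow> submod A M U \<Longrightarrow> submod_on M U \<in> mod_cat A"
  by (simp add: mod_cat_iff left_module.left_module_submod finite_length_submod)

lemma quot_mod_cat: "M \<in> mod_cat A \<Longrightarrow> submod A M U \<Longrightarrow> quot_mod M U \<in> mod_cat A"
  using finite_length_surj[OF _ left_module.left_module_quot left_module.lmod_hom_qrep left_module.qrep_surj]
  by (fastforce simp add: mod_cat_iff left_module.left_module_quot)

lemma biproduct_exists:
  assumes M: "M \<in> mod_cat A" and N: "N \<in> mod_cat A"
  shows "\<exists>P\<in>mod_cat A. \<exists>i j p q. biproduct A P M N i j p q"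
proof -
  interpret M: left_module A M using M by (rule mod_catD)
  interpret N: left_module A N using N by (rule mod_catD)
  obtain P h g where P: "P \<in> mod_cat A" "h \<in> lmod_hom A (prod_mod M N) P" "g \<in> lmod_hom A P (prod_mod M N)"
    "\<And>x. x \<in> carrier (prod_mod M N) \<Longrightarrow> g (h x) = x" "\<And>y. y \<in> carrier P \<Longrightarrow> h (g y) = y"
    using mod_cat_realize[OF left_module_prod[OF M.is_lmod N.is_lmod]
        finite_length_prod[OF M.is_lmod N.is_lmod]]
      M[unfolded mod_cat_iff] N[unfolded mod_cat_iff]
    by blast
  have "biproduct A P M N (\<lambda>x. h (x, \<zero>\<^bsub>N\<^esub>)) (\<lambda>y. h (\<zero>\<^bsub>M\<^esub>, y)) (\<lambda>z. fst (g z)) (\<lambda>z. snd (g z))"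
    unfolding biproduct_def
  proof (intro conjI ballI lmod_homI)
    fix z assume z: "z \<in> carrier P"
    then have "g z \<in> carrier M \<times> carrier N" using lmod_hom_closed[OF P(3)] by simp
    then have "h (fst (g z), \<zero>\<^bsub>N\<^esub>) \<oplus>\<^bsub>P\<^esub> h (\<zero>\<^bsub>M\<^esub>, snd (g z)) = h (g z)"
      by (subst lmod_hom_add[OF P(2), symmetric]) auto
    then show "z = h (fst (g z), \<zero>\<^bsub>N\<^esub>) \<oplus>\<^bsub>P\<^esub> h (\<zero>\<^bsub>M\<^esub>, snd (g z))" using P(5) z by simp
  qed (use lmod_homD[OF P(2)] lmod_homD[OF P(3)] P(4) in
      \<open>auto simp: lmod_hom_add[OF P(2), symmetric] lmod_hom_smult[OF P(2), symmetric] mem_Times_iff\<close>)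
  then show ?thesis using P(1) by blast
qed

text \<open>A copy of the regular module on lists, with \<open>r\<close> the image of the unit;
  later it enters only through these two properties of \<open>r\<close>.\<close>

lemma regular_exists:
  "\<exists>R\<in>mod_cat A. \<exists>r\<in>carrier R. (\<forall>y\<in>carrier R. \<exists>a\<in>carrier A. y = a \<odot>\<^bsub>R\<^esub> r) \<and>
     (\<forall>M\<in>mod_cat A. \<forall>x\<in>carrier M. \<exists>h\<in>lmod_hom A R M. h r = x)"
proof -
  obtain R h g where R: "R \<in> mod_cat A" "h \<in> lmod_hom A (regular A) R" "g \<in> lmod_hom A R (regular A)"
    "\<And>x. x \<in> carrier A \<Longrightarrow> g (h x) = x" "\<And>y. y \<in> carrier R \<Longrightarrow> h (g y) = y"
    using mod_cat_realize[OF left_module_regular[OF A.ring_axioms] finite_length_regular_A] by auto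
  show ?thesis
  proof (intro bexI[OF _ R(1)] bexI[of _ "h \<one>\<^bsub>A\<^esub>"] conjI ballI)
    show "h \<one>\<^bsub>A\<^esub> \<in> carrier R" using lmod_hom_closed[OF R(2)] by simp
    fix y assume y: "y \<in> carrier R"
    then have "g y \<in> carrier A" using lmod_hom_closed[OF R(3)] by simp
    then show "\<exists>a\<in>carrier A. y = a \<odot>\<^bsub>R\<^esub> h \<one>\<^bsub>A\<^esub>"
      using lmod_hom_smult[OF R(2), of "g y" "\<one>\<^bsub>A\<^esub>"] R(5)[OF y] by auto
  next
    fix M :: "('a, 'a list) module" and x assume M: "M \<in> mod_cat A" "x \<in> carrier M"
    interpret M: left_module A M using M by (intro mod_catD)
    have "(\<lambda>a. a \<odot>\<^bsub>M\<^esub> x) \<circ> g \<in> lmod_hom A R M"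
      using lmod_hom_comp[OF R(3) M.lmod_hom_regular] M by blast
    moreover have "((\<lambda>a. a \<odot>\<^bsub>M\<^esub> x) \<circ> g) (h \<one>\<^bsub>A\<^esub>) = x" using R(4) M M.smult_one by simp
    ultimately show "\<exists>h'\<in>lmod_hom A R M. h' (h \<one>\<^bsub>A\<^esub>) = x" by blast
  qed
qed

text \<open>To lift \<open>f\<close>, send \<open>r\<close> to any preimage of \<open>f r\<close>;
  as \<open>r\<close> generates, this is a lift everywhere.\<close>

lemma projective_regular_exists:
  "\<exists>R r. projective A R \<and> r \<in> carrier R \<and> (\<forall>M\<in>mod_cat A. \<forall>x\<in>carrier M. \<exists>h\<in>lmod_hom A R M. h r = x)"
proof -
  obtain R r where R: "R \<in> mod_cat A" "r \<in> carrier R" "\<And>y. y \<in> carrier R \<Longrightarrow> \<exists>a\<in>carrier A. y = a \<odot>\<^bsub>R\<^esub> r"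
    "\<And>M x. M \<in> mod_cat A \<Longrightarrow> x \<in> carrier M \<Longrightarrow> \<exists>h\<in>lmod_hom A R M. h r = x"
    using regular_exists by metis
  have "projective A R"
    unfolding projective_def
  proof (intro conjI ballI impI)
    fix X Y :: "('a, 'a list) module" and g f
    assume X: "X \<in> mod_cat A" and g: "g \<in> lmod_hom A X Y" "g ` carrier X = carrier Y"
      and f: "f \<in> lmod_hom A R Y"
    then obtain x where x: "x \<in> carrier X" "g x = f r" using lmod_hom_closed[OF f R(2)] by (metis imageE)
    obtain h where h: "h \<in> lmod_hom A R X" "h r = x" using R(4)[OF X x(1)] by blast
    have "g (h y) = f y" if "y \<in> carrier R" for y
      using R(3)[OF that] h x R(2) lmod_hom_smult[OF h(1)] lmod_hom_smult[OF g(1)] lmod_hom_smult[OF f]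
      by auto
    then show "\<exists>h\<in>lmod_hom A R X. \<forall>x\<in>carrier R. g (h x) = f x" using h(1) by blast
  qed (rule R(1))
  then show ?thesis using R by blast
qed

subsection \<open>Scalar restriction and spaces of homomorphisms\<close>

definition restr_K :: "('a, 'm, 't) module_scheme \<Rightarrow> ('k, 'm) module" where
  "restr_K Y = \<lparr>carrier = carrier Y, monoid.mult = (\<lambda>x y. undefined), one = undefined,
     ring.zero = \<zero>\<^bsub>Y\<^esub>, ring.add = ring.add Y, smult = (\<lambda>c y. scal c \<odot>\<^bsub>Y\<^esub> y)\<rparr>"

lemma restr_K_simps [simp]:
  "carrier (restr_K Y) = carrier Y" "\<zero>\<^bsub>restr_K Y\<^esub> = \<zero>\<^bsub>Y\<^esub>" "x \<oplus>\<^bsub>restr_K Y\<^esub> y = x \<oplus>\<^bsub>Y\<^esub> y"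
  "c \<odot>\<^bsub>restr_K Y\<^esub> x = scal c \<odot>\<^bsub>Y\<^esub> x"
  by (simp_all add: restr_K_def)

lemma left_module_restr_K:
  assumes "left_module A Y"
  shows "left_module K (restr_K Y)"
proof -
  interpret Y: left_module A Y by fact
  have "abelian_group (restr_K Y)"
    by (rule abelian_groupI) (auto simp: Y.M.a_ac intro: Y.M.l_neg bexI[of _ "\<ominus>\<^bsub>Y\<^esub> _"])
  moreover have "left_module_axioms K (restr_K Y)"
    by unfold_locales
      (auto simp: scal_add scal_mult scal_one Y.smult_l_distr Y.smult_r_distr Y.smult_assoc Y.smult_one)
  ultimately show ?thesis using K.ring_axioms by (intro left_module.intro)
qed

text \<open>Each generator \<open>s\<close> gives a \<open>K\<close>-linear map from
  \<open>A\<close> to \<open>Y\<close>, whose image has finite length over \<open>K\<close>;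
  finitely many such images sum to \<open>Y\<close>.\<close>

lemma finite_length_restr_K:
  assumes "Y \<in> mod_cat A"
  shows "finite_length K (restr_K Y)"
proof -
  interpret Y: left_module A Y using assms by (rule mod_catD)
  note rY = left_module_restr_K[OF Y.is_lmod]
  interpret rY: left_module K "restr_K Y" by (rule rY)
  obtain S where S: "finite S" "S \<subseteq> carrier Y"
    "\<And>x. x \<in> carrier Y \<Longrightarrow> \<exists>c\<in>S \<rightarrow> carrier A. x = (\<Oplus>\<^bsub>Y\<^esub>s\<in>S. c s \<odot>\<^bsub>Y\<^esub> s)"
    using assms unfolding mod_cat_def finitely_generated_def by auto
  define U where "U s = (\<lambda>a. a \<odot>\<^bsub>Y\<^esub> s) ` carrier A" for s
  have h: "(\<lambda>a. a \<odot>\<^bsub>Y\<^esub> s) \<in> lmod_hom K A (restr_K Y)" if "s \<in> S" for s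
    using that S
    by (intro lmod_homI) (auto simp: Y.smult_l_distr Y.smult_assoc scal_mult_left[symmetric])
  have U: "submod K (restr_K Y) (U s) \<and> finite_length K (submod_on (restr_K Y) (U s))" if "s \<in> S" for s
    using finite_length_image[OF left_module_K rY h[OF that] finite_length_K]
      submod_image[OF left_module_K rY h[OF that] left_module.submod_carrier[OF left_module_K]]
    by (simp add: U_def)
  obtain T where T: "submod K (restr_K Y) T" "finite_length K (submod_on (restr_K Y) T)"
    "\<And>s. s \<in> S \<Longrightarrow> U s \<subseteq> T"
    using finite_length_cover[where U = U, OF rY S(1) U] by blast
  have sum: "(\<Oplus>\<^bsub>Y\<^esub>s\<in>F. g s) \<in> T" if "finite F" "g \<in> F \<rightarrow> T" for F g
    using that
  proof (induction F)
    case (insert s F)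
    then have "g \<in> F \<rightarrow> carrier Y" "g s \<in> carrier Y" using rY.submod_subset[OF T(1)] by auto
    then show ?case using insert rY.submod_add[OF T(1)] by (simp add: Y.M.finsum_insert)
  qed (use rY.submod_zero[OF T(1)] in simp)
  have "x \<in> T" if "x \<in> carrier Y" for x
  proof -
    obtain c where c: "c \<in> S \<rightarrow> carrier A" "x = (\<Oplus>\<^bsub>Y\<^esub>s\<in>S. c s \<odot>\<^bsub>Y\<^esub> s)" using S(3)[OF \<open>x \<in> carrier Y\<close>] by blast
    have "(\<lambda>s. c s \<odot>\<^bsub>Y\<^esub> s) \<in> S \<rightarrow> T" using c T(3) by (auto simp: U_def)
    then show ?thesis using sum[OF S(1)] c by simp
  qed
  then have "T = carrier (restr_K Y)" using rY.submod_subset[OF T(1)] by auto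
  then show ?thesis using T(2) by (simp del: restr_K_simps)
qed

lemma lmod_hom_scal:
  assumes "left_module A Y" "f \<in> lmod_hom A P Y" "c \<in> carrier K"
  shows "(\<lambda>x. scal c \<odot>\<^bsub>Y\<^esub> f x) \<in> lmod_hom A P Y"
proof -
  interpret Y: left_module A Y by fact
  show ?thesis
    using assms lmod_homD[OF assms(2)]
    by (intro lmod_homI)
      (auto simp: Y.smult_r_distr Y.smult_assoc[symmetric] scal_mult_left scal_mult_right)
qed

text \<open>As \<open>A\<close> may be non-commutative, homomorphisms form only a
  \<open>K\<close>-module; its length over \<open>K\<close> is the dimension that is compared later.
  Maps are extensional so that maps equal on \<open>P\<close> are equal elements.\<close>

definition Hom_K :: "('a, 'm, 't) module_scheme \<Rightarrow> ('a, 'n, 'u) module_scheme \<Rightarrow> ('k, 'm \<Rightarrow> 'n) module" where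
  "Hom_K P Y = \<lparr>carrier = lmod_hom A P Y \<inter> extensional (carrier P),
     monoid.mult = (\<lambda>x y. undefined), one = undefined,
     ring.zero = (\<lambda>x\<in>carrier P. \<zero>\<^bsub>Y\<^esub>), ring.add = (\<lambda>f g. \<lambda>x\<in>carrier P. f x \<oplus>\<^bsub>Y\<^esub> g x),
     smult = (\<lambda>c f. \<lambda>x\<in>carrier P. scal c \<odot>\<^bsub>Y\<^esub> f x)\<rparr>"

lemma Hom_K_simps [simp]:
  "carrier (Hom_K P Y) = lmod_hom A P Y \<inter> extensional (carrier P)"
  "\<zero>\<^bsub>Hom_K P Y\<^esub> = (\<lambda>x\<in>carrier P. \<zero>\<^bsub>Y\<^esub>)"
  "f \<oplus>\<^bsub>Hom_K P Y\<^esub> g = (\<lambda>x\<in>carrier P. f x \<oplus>\<^bsub>Y\<^esub> g x)"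
  "c \<odot>\<^bsub>Hom_K P Y\<^esub> f = (\<lambda>x\<in>carrier P. scal c \<odot>\<^bsub>Y\<^esub> f x)"
  by (simp_all add: Hom_K_def)

lemma restrict_lmod_hom:
  assumes "left_module A P"
  shows "restrict f (carrier P) \<in> lmod_hom A P Y \<longleftrightarrow> f \<in> lmod_hom A P Y"
proof -
  interpret P: left_module A P by fact
  show ?thesis by (auto simp: lmod_hom_def Pi_iff)
qed

lemma left_module_Hom_K:
  assumes P: "left_module A P" and Y: "left_module A Y"
  shows "left_module K (Hom_K P Y)"
proof -
  interpret P: left_module A P by fact
  interpret Y: left_module A Y by fact
  note [simp] = restrict_lmod_hom[OF P] lmod_hom_sum[OF P Y] lmod_hom_scal[OF Y] lmod_hom_const_zero[OF Y]
  have ext: "f = g" if "f \<in> extensional (carrier P)" "g \<in> extensional (carrier P)"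
    "\<And>x. x \<in> carrier P \<Longrightarrow> f x = g x" for f g
    using that by (rule extensionalityI)
  have "abelian_group (Hom_K P Y)"
  proof (rule abelian_groupI)
    fix f assume f: "f \<in> carrier (Hom_K P Y)"
    then show "\<exists>g\<in>carrier (Hom_K P Y). g \<oplus>\<^bsub>Hom_K P Y\<^esub> f = \<zero>\<^bsub>Hom_K P Y\<^esub>"
      using lmod_hom_diff[OF P Y lmod_hom_const_zero[OF Y], of f]
      by (intro bexI[of _ "\<lambda>x\<in>carrier P. \<zero>\<^bsub>Y\<^esub> \<ominus>\<^bsub>Y\<^esub> f x"])
        (auto simp: a_minus_def lmod_hom_closed Y.M.l_neg intro!: ext)
  qed (auto simp: lmod_hom_closed Y.M.a_ac intro!: ext)
  moreover have "left_module_axioms K (Hom_K P Y)"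
    by unfold_locales
      (auto simp: lmod_hom_closed scal_add scal_mult scal_one Y.smult_l_distr Y.smult_r_distr
        Y.smult_assoc Y.smult_one intro!: ext)
  ultimately show ?thesis using K.ring_axioms by (intro left_module.intro)
qed

lemma Hom_K_eval:
  assumes "s \<in> carrier P"
  shows "(\<lambda>f. f s) \<in> lmod_hom K (Hom_K P Y) (restr_K Y)"
  using assms by (intro lmod_homI) (auto simp: lmod_hom_closed)

lemma Hom_K_postcomp:
  assumes "left_module A P" "g \<in> lmod_hom A Y Z"
  shows "(\<lambda>f. restrict (g \<circ> f) (carrier P)) \<in> lmod_hom K (Hom_K P Y) (Hom_K P Z)"
  using assms by (intro lmod_homI)
    (auto simp: restrict_lmod_hom lmod_hom_comp lmod_hom_closed lmod_hom_add[OF assms(2)]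
      lmod_hom_smult[OF assms(2)] intro!: restrict_ext)

lemma Hom_K_precomp:
  assumes "left_module A P" "d \<in> lmod_hom A P Q"
  shows "(\<lambda>f. restrict (f \<circ> d) (carrier P)) \<in> lmod_hom K (Hom_K Q Y) (Hom_K P Y)"
  using assms by (intro lmod_homI)
    (auto simp: restrict_lmod_hom lmod_hom_comp lmod_hom_closed intro!: restrict_ext)

text \<open>A homomorphism is determined by its values on finitely many generators, and each value
  lies in a module of finite length over \<open>K\<close>.\<close>

lemma finite_length_Hom_K:
  assumes P: "P \<in> mod_cat A" and Y: "Y \<in> mod_cat A"
  shows "finite_length K (Hom_K P Y)"
proof -
  interpret P: left_module A P using P by (rule mod_catD)
  interpret Y: left_module A Y using Y by (rule mod_catD)
  note H = left_module_Hom_K[OF P.is_lmod Y.is_lmod]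
  interpret H: left_module K "Hom_K P Y" by (rule H)
  note rY = left_module_restr_K[OF Y.is_lmod]
  obtain S where S: "finite S" "S \<subseteq> carrier P" "carrier P = lspan A P S"
    using P P.finitely_generated_iff_lspan unfolding mod_cat_def by auto
  define V where "V T = {f \<in> carrier (Hom_K P Y). \<forall>s\<in>T. f s = \<zero>\<^bsub>Y\<^esub>}" for T
  have V: "submod K (Hom_K P Y) (V T)" if "T \<subseteq> carrier P" for T
    unfolding submod_def V_def
    using that H.M.zero_closed H.M.a_closed H.smult_closed by (auto simp: subset_iff)
  \<comment> \<open>Vanishing conditions are dropped one generator at a time: on
    \<open>V (S - insert t T)\<close> evaluation at \<open>t\<close> has kernel
    \<open>V (S - T)\<close> and image in \<open>Y\<close>.\<close>
  have "finite_length K (submod_on (Hom_K P Y) (V (S - T)))" if "finite T" "T \<subseteq> S" for T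
    using that
  proof (induction T)
    case empty
    have "f = \<zero>\<^bsub>Hom_K P Y\<^esub>" if "f \<in> V S" for f
    proof -
      have f: "f \<in> lmod_hom A P Y" "f \<in> extensional (carrier P)" "\<forall>s\<in>S. f s = \<zero>\<^bsub>Y\<^esub>"
        using that by (auto simp: V_def)
      have "submod A P (hker P Y f)" by (rule submod_hker[OF P.is_lmod Y.is_lmod f(1)])
      moreover have "S \<subseteq> hker P Y f" using S(2) f(3) by (auto simp: hker_def)
      ultimately have "carrier P \<subseteq> hker P Y f" using P.lspan_subset[OF _ S(1)] S(3) by simp
      then show ?thesis using f(2) by (auto simp: hker_def intro!: extensionalityI[of _ "carrier P"])
    qed
    then have "V S = {\<zero>\<^bsub>Hom_K P Y\<^esub>}" using H.submod_zero[OF V[OF S(2)]] by blast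
    then show ?case using finite_length_zero_submod[OF H] by simp
  next
    case (insert t T)
    have sub: "S - insert t T \<subseteq> carrier P" using S(2) by blast
    let ?V = "submod_on (Hom_K P Y) (V (S - insert t T))"
    have t: "t \<in> carrier P" using insert S(2) by blast
    have e: "(\<lambda>f. f t) \<in> lmod_hom K ?V (restr_K Y)"
      using Hom_K_eval[OF t] H.submod_subset[OF V[OF sub]] by (rule lmod_hom_submod_dom)
    note m = H.left_module_submod[OF V[OF sub]]
    have "hker ?V (restr_K Y) (\<lambda>f. f t) = V (S - T)"
      using insert by (auto simp: hker_def V_def)
    then have "finite_length K (submod_on ?V (hker ?V (restr_K Y) (\<lambda>f. f t)))"
      using insert by simp
    moreover have "finite_length K (submod_on (restr_K Y) ((\<lambda>f. f t) ` carrier ?V))"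
      using submod_image[OF m rY e left_module.submod_carrier[OF m]]
      by (rule finite_length_submod[OF rY _ finite_length_restr_K[OF Y]])
    ultimately show ?case by (rule finite_length_split[OF m rY e])
  qed
  from this[OF S(1)] have "finite_length K (submod_on (Hom_K P Y) (V {}))" by simp
  moreover have "V {} = carrier (Hom_K P Y)" by (auto simp: V_def)
  ultimately show ?thesis by (simp del: Hom_K_simps)
qed

text \<open>\<open>Hom(P, -)\<close> is exact for projective \<open>P\<close>, and length over
  \<open>K\<close> is additive.\<close>

lemma len_Hom_K_exact:
  assumes P: "projective A P" and cat: "L \<in> mod_cat A" "M \<in> mod_cat A" "N \<in> mod_cat A"
    and ex: "short_exact A L f M g N"
  shows "len K (Hom_K P M) = len K (Hom_K P L) + len K (Hom_K P N)"
proof -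
  have f: "f \<in> lmod_hom A L M" "inj_on f (carrier L)" and g: "g \<in> lmod_hom A M N" "g ` carrier M = carrier N"
    and im: "f ` carrier L = {x \<in> carrier M. g x = \<zero>\<^bsub>N\<^esub>}"
    using ex by (auto simp: short_exact_def)
  have Pc: "P \<in> mod_cat A" using P by (simp add: projective_def)
  note lm = mod_catD[OF Pc] mod_catD[OF cat(1)] mod_catD[OF cat(2)]
    mod_catD[OF cat(3)]
  interpret P: left_module A P by (rule lm)
  interpret L: left_module A L by (rule lm)
  note HL = left_module_Hom_K[OF lm(1,2)] and HM = left_module_Hom_K[OF lm(1,3)]
    and HN = left_module_Hom_K[OF lm(1,4)]
  let ?F = "\<lambda>u. restrict (f \<circ> u) (carrier P)" and ?G = "\<lambda>u. restrict (g \<circ> u) (carrier P)"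
  have F: "?F \<in> lmod_hom K (Hom_K P L) (Hom_K P M)" and G: "?G \<in> lmod_hom K (Hom_K P M) (Hom_K P N)"
    by (intro Hom_K_postcomp lm f g)+
  have "inj_on ?F (carrier (Hom_K P L))"
  proof (rule inj_onI)
    fix u v assume uv: "u \<in> carrier (Hom_K P L)" "v \<in> carrier (Hom_K P L)" "?F u = ?F v"
    have "u x = v x" if "x \<in> carrier P" for x
      using fun_cong[OF uv(3), of x] f(2) that uv(1,2) by (auto simp: inj_on_def lmod_hom_closed)
    then show "u = v" using uv by (auto intro: extensionalityI)
  qed
  then have FL: "len K (Hom_K P L) = len K (submod_on (Hom_K P M) (?F ` carrier (Hom_K P L)))"
    using len_split[OF HL HM F finite_length_Hom_K[OF Pc cat(1)]] inj_on_iff_hker[OF HL HM F]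
      len_zero_submod[OF HL] by simp
  have "?F ` carrier (Hom_K P L) = hker (Hom_K P M) (Hom_K P N) ?G"
  proof (intro equalityI subsetI)
    fix w assume "w \<in> ?F ` carrier (Hom_K P L)"
    then obtain u where u: "u \<in> lmod_hom A P L" "w = ?F u" by auto
    have "g (f (u x)) = \<zero>\<^bsub>N\<^esub>" if "x \<in> carrier P" for x
      using im lmod_hom_closed[OF u(1) that] by blast
    then show "w \<in> hker (Hom_K P M) (Hom_K P N) ?G"
      using u lm(1) f(1) by (auto simp: hker_def restrict_lmod_hom lmod_hom_comp intro!: restrict_ext)
  next
    fix w assume w: "w \<in> hker (Hom_K P M) (Hom_K P N) ?G"
    then have w': "w \<in> lmod_hom A P M" "w \<in> extensional (carrier P)" by (auto simp: hker_def)
    have "g (w x) = \<zero>\<^bsub>N\<^esub>" if "x \<in> carrier P" for x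
      using w that by (auto simp: hker_def dest: fun_cong[of _ _ x])
    then have "w ` carrier P \<subseteq> f ` carrier L" using im lmod_hom_closed[OF w'(1)] by auto
    then obtain u where u: "u \<in> lmod_hom A P L" "\<And>x. x \<in> carrier P \<Longrightarrow> f (u x) = w x"
      using lmod_hom_factor_inj[OF lm(2,1) f w'(1)] by blast
    have "w = ?F (restrict u (carrier P))"
      using u w'(2) by (auto intro!: extensionalityI[of _ "carrier P"])
    then show "w \<in> ?F ` carrier (Hom_K P L)" using u(1) lm(1) by (auto simp: restrict_lmod_hom)
  qed
  moreover have "?G ` carrier (Hom_K P M) = carrier (Hom_K P N)"
  proof (intro equalityI subsetI)
    fix w assume "w \<in> carrier (Hom_K P N)"
    then have w: "w \<in> lmod_hom A P N" "w \<in> extensional (carrier P)" by auto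
    then obtain u where u: "u \<in> lmod_hom A P M" "\<And>x. x \<in> carrier P \<Longrightarrow> g (u x) = w x"
      using P cat g unfolding projective_def by meson
    have "w = ?G (restrict u (carrier P))"
      using u w(2) by (auto intro!: extensionalityI[of _ "carrier P"])
    then show "w \<in> ?G ` carrier (Hom_K P M)" using u(1) lm(1) by (auto simp: restrict_lmod_hom)
  qed (use lmod_hom_closed[OF G] in auto)
  ultimately show ?thesis
    using len_split[OF HM HN G finite_length_Hom_K[OF Pc cat(2)]] FL by (simp del: Hom_K_simps)
qed

end

text \<open>A function additive on short exact sequences extends to the free abelian group and
  vanishes on \<open>K0_relations A\<close>, so it depends only on the class in
  \<open>K0 A\<close>.\<close>

lemma additive_dim_vector:
  fixes \<phi> :: "('a, 'a list) module \<Rightarrow> int"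
  assumes add: "\<And>L M N f g. L \<in> mod_cat A \<Longrightarrow> M \<in> mod_cat A \<Longrightarrow> N \<in> mod_cat A \<Longrightarrow>
      short_exact A L f M g N \<Longrightarrow> \<phi> M = \<phi> L + \<phi> N"
    and eq: "dim_vector A X = dim_vector A Y"
  shows "\<phi> X = \<phi> Y"
proof -
  \<comment> \<open>The target is the free abelian group on one point, a copy of the integers in the
    form that \<open>frag_extend\<close> expects.\<close>
  define \<Phi> where "\<Phi> = frag_extend (\<lambda>M. frag_cmul (\<phi> M) (frag_of ()))"
  have \<Phi>_of: "\<Phi> (frag_of M) = frag_cmul (\<phi> M) (frag_of ())" for M by (simp add: \<Phi>_def)
  have ker: "\<Phi> c = 0" if "c \<in> K0_relations A" for c
    using that unfolding K0_relations_def
  proof (induction rule: generate.induct)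
    case (incl h)
    then obtain L M N f g where h: "h = frag_of M - frag_of L - frag_of N" "L \<in> mod_cat A"
      "M \<in> mod_cat A" "N \<in> mod_cat A" "short_exact A L f M g N" by auto
    then have "\<phi> M = \<phi> L + \<phi> N" using add by blast
    then show ?case
      unfolding h(1) by (simp add: \<Phi>_def frag_extend_diff frag_cmul_distrib)
  next
    case (inv h)
    then obtain L M N f g where h: "h = frag_of M - frag_of L - frag_of N" "L \<in> mod_cat A"
      "M \<in> mod_cat A" "N \<in> mod_cat A" "short_exact A L f M g N" by auto
    then have "\<phi> M = \<phi> L + \<phi> N" using add by blast
    moreover have "h \<in> carrier (free_Abelian_group (mod_cat A))"
      unfolding h(1) using h by (auto dest!: subsetD[OF keys_diff])
    ultimately show ?case
      using h by (simp add: \<Phi>_def frag_extend_diff frag_extend_minus frag_cmul_distrib)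
  qed (auto simp: \<Phi>_def frag_extend_add)
  have "frag_of X \<in> dim_vector A X"
    unfolding dim_vector_def r_coset_def K0_relations_def
    using generate.one[of "free_Abelian_group (mod_cat A)"] by force
  then obtain c where "c \<in> K0_relations A" "frag_of X = c + frag_of Y"
    unfolding eq by (auto simp: dim_vector_def r_coset_def)
  then have "frag_cmul (\<phi> X) (frag_of ()) = frag_cmul (\<phi> Y) (frag_of ())"
    using ker \<Phi>_of by (metis \<Phi>_def add_0 frag_extend_add)
  then show ?thesis
    by (metis frag_cmul_one frag_of_nonzero lookup_frag_cmul lookup_frag_of mult.right_neutral)
qed

section \<open>Torsion classes\<close>

definition Tors :: "('a, 'x) ring_scheme \<Rightarrow> ('a, 'a list) module set \<Rightarrow> ('a, 'a list) module set" where
  "Tors A S = {M \<in> mod_cat A. \<forall>B\<in>S. \<forall>f\<in>lmod_hom A M B. \<forall>x\<in>carrier M. f x = \<zero>\<^bsub>B\<^esub>}"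

text \<open>Orthogonality to \<open>Tors\<close> makes the two classes the torsion pair cogenerated
  by \<open>S\<close>.\<close>

definition Free :: "('a, 'x) ring_scheme \<Rightarrow> ('a, 'a list) module set \<Rightarrow> ('a, 'a list) module set" where
  "Free A S = {N \<in> mod_cat A. \<forall>M\<in>Tors A S. \<forall>f\<in>lmod_hom A M N. \<forall>x\<in>carrier M. f x = \<zero>\<^bsub>N\<^esub>}"

lemma TorsD: "M \<in> Tors A S \<Longrightarrow> B \<in> S \<Longrightarrow> f \<in> lmod_hom A M B \<Longrightarrow> x \<in> carrier M \<Longrightarrow> f x = \<zero>\<^bsub>B\<^esub>"
  by (auto simp: Tors_def)

lemma Tors_mod_cat: "M \<in> Tors A S \<Longrightarrow> M \<in> mod_cat A"
  by (simp add: Tors_def)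

lemma Free_mod_cat: "M \<in> Free A S \<Longrightarrow> M \<in> mod_cat A"
  by (simp add: Free_def)

lemma FreeD: "N \<in> Free A S \<Longrightarrow> M \<in> Tors A S \<Longrightarrow> f \<in> lmod_hom A M N \<Longrightarrow> x \<in> carrier M \<Longrightarrow> f x = \<zero>\<^bsub>N\<^esub>"
  by (auto simp: Free_def)

lemma Tors_antimono: "S \<subseteq> S' \<Longrightarrow> Tors A S' \<subseteq> Tors A S"
  by (auto simp: Tors_def)

lemma Free_mem: "S \<subseteq> mod_cat A \<Longrightarrow> B \<in> S \<Longrightarrow> B \<in> Free A S"
  by (auto simp: Free_def Tors_def)

lemma Tors_Free_zero:
  assumes "M \<in> Tors A S" "M \<in> Free A S" "x \<in> carrier M"
  shows "x = \<zero>\<^bsub>M\<^esub>"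
  using FreeD[OF assms(2,1) lmod_hom_id assms(3)] .

lemma Tors_quotient:
  assumes "M \<in> Tors A S" "N \<in> mod_cat A" "f \<in> lmod_hom A M N" "f ` carrier M = carrier N"
  shows "N \<in> Tors A S"
  unfolding Tors_def
proof (intro CollectI conjI ballI)
  fix B g y assume B: "B \<in> S" "g \<in> lmod_hom A N B" "y \<in> carrier N"
  then obtain x where "x \<in> carrier M" "y = f x" using assms(4) by blast
  then show "g y = \<zero>\<^bsub>B\<^esub>" using TorsD[OF assms(1) B(1) lmod_hom_comp[OF assms(3) B(2)]] by simp
qed (rule assms)

lemma Free_sub:
  assumes "N \<in> Free A S" "U \<in> mod_cat A" "i \<in> lmod_hom A U N" "inj_on i (carrier U)"
  shows "U \<in> Free A S"
  unfolding Free_def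
proof (intro CollectI conjI ballI)
  fix M f x assume M: "M \<in> Tors A S" "f \<in> lmod_hom A M U" "x \<in> carrier M"
  interpret U: left_module A U using assms(2) by (simp add: mod_cat_def)
  have "left_module A N" using assms(1) by (simp add: Free_def mod_cat_def)
  then have "i (f x) = i \<zero>\<^bsub>U\<^esub>"
    using FreeD[OF assms(1) M(1) lmod_hom_comp[OF M(2) assms(3)] M(3)]
      lmod_hom_zero[OF U.is_lmod _ assms(3)] by simp
  then show "f x = \<zero>\<^bsub>U\<^esub>" using assms(4) lmod_hom_closed[OF M(2,3)] by (simp add: inj_on_def)
qed (rule assms)

context fin_dim_algebra
begin

text \<open>A map from \<open>E\<close> to a member of \<open>S\<close> kills the image of
  \<open>L\<close>, hence the kernel of \<open>q\<close>; so it factors through \<open>N\<close>,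
  where it is zero.\<close>

lemma Tors_ext:
  assumes S: "S \<subseteq> mod_cat A" and E: "E \<in> mod_cat A"
    and L: "L \<in> Tors A S" "i \<in> lmod_hom A L E"
    and N: "N \<in> Tors A S" "q \<in> lmod_hom A E N" "q ` carrier E = carrier N"
    and ker: "hker E N q \<subseteq> i ` carrier L"
  shows "E \<in> Tors A S"
  unfolding Tors_def
proof (intro CollectI conjI ballI)
  fix B f x assume B: "B \<in> S" "f \<in> lmod_hom A E B" "x \<in> carrier E"
  note lm = mod_catD[OF E] mod_catD[OF Tors_mod_cat[OF N(1)]]
    mod_catD[OF subsetD[OF S B(1)]]
  have "f x = \<zero>\<^bsub>B\<^esub>" if x: "x \<in> carrier E" "q x = \<zero>\<^bsub>N\<^esub>" for x
  proof -
    obtain l where "l \<in> carrier L" "x = i l" using x ker by (auto simp: hker_def)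
    then show ?thesis using TorsD[OF L(1) B(1) lmod_hom_comp[OF L(2) B(2)]] by simp
  qed
  then obtain g where g: "g \<in> lmod_hom A N B" "\<And>x. x \<in> carrier E \<Longrightarrow> g (q x) = f x"
    using lmod_hom_factor_surj[OF lm N(2,3) B(2)] by blast
  then show "f x = \<zero>\<^bsub>B\<^esub>"
    using TorsD[OF N(1) B(1) g(1) lmod_hom_closed[OF N(2) B(3)]] B(3) by simp
qed (rule E)

lemma Tors_biproduct:
  assumes S: "S \<subseteq> mod_cat A" and "M \<in> Tors A S" "N \<in> Tors A S" "P \<in> mod_cat A"
    and P: "biproduct A P M N i j p q"
  shows "P \<in> Tors A S"
  unfolding Tors_def
proof (intro CollectI conjI ballI)
  fix B f z assume B: "B \<in> S" "f \<in> lmod_hom A P B" "z \<in> carrier P"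
  interpret B: left_module A B using S B(1) mod_catD by blast
  have h: "i \<in> lmod_hom A M P" "j \<in> lmod_hom A N P" "p \<in> lmod_hom A P M" "q \<in> lmod_hom A P N"
    and z: "z = i (p z) \<oplus>\<^bsub>P\<^esub> j (q z)"
    using P B(3) by (auto simp: biproduct_def)
  have "f (i (p z)) = \<zero>\<^bsub>B\<^esub>" "f (j (q z)) = \<zero>\<^bsub>B\<^esub>"
    using TorsD[OF assms(2) B(1) lmod_hom_comp[OF h(1) B(2)]] lmod_hom_closed[OF h(3) B(3)]
      TorsD[OF assms(3) B(1) lmod_hom_comp[OF h(2) B(2)]] lmod_hom_closed[OF h(4) B(3)]
    by auto
  moreover have "f z = f (i (p z)) \<oplus>\<^bsub>B\<^esub> f (j (q z))"
    using arg_cong[OF z, of f]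
      lmod_hom_add[OF B(2) lmod_hom_closed[OF h(1) lmod_hom_closed[OF h(3) B(3)]]
        lmod_hom_closed[OF h(2) lmod_hom_closed[OF h(4) B(3)]]]
    by (rule trans)
  ultimately show "f z = \<zero>\<^bsub>B\<^esub>" by simp
qed (rule assms)

text \<open>A torsion submodule of largest length works: given a nonzero map from a torsion module
  to the quotient, the preimage of its image would be a larger torsion submodule, since torsion
  classes are closed under extensions.\<close>

lemma torsion_submodule:
  assumes S: "S \<subseteq> mod_cat A" and M: "M \<in> mod_cat A"
  shows "\<exists>U. submod A M U \<and> submod_on M U \<in> Tors A S \<and> quot_mod M U \<in> Free A S"
proof -
  interpret M: left_module A M using M by (rule mod_catD)
  have fl: "finite_length A M" using M by (simp add: mod_cat_iff)
  define P where "P U \<longleftrightarrow> submod A M U \<and> submod_on M U \<in> Tors A S" for U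
  have "f \<zero>\<^bsub>M\<^esub> = \<zero>\<^bsub>B\<^esub>" if "B \<in> S" "f \<in> lmod_hom A (submod_on M {\<zero>\<^bsub>M\<^esub>}) B" for B f
    using that S lmod_hom_zero[OF M.left_module_submod[OF M.submod_zero_set] mod_catD that(2)]
    by auto
  then have "P {\<zero>\<^bsub>M\<^esub>}"
    using M.submod_zero_set submod_mod_cat[OF M M.submod_zero_set] by (auto simp: P_def Tors_def)
  moreover have "len A (submod_on M U) < Suc (len A M)" if "P U" for U
    using that len_submod_less[OF M.is_lmod _ fl, of U]
    by (cases "U = carrier M") (auto simp: P_def)
  ultimately obtain U where U: "P U" "\<And>U'. P U' \<Longrightarrow> len A (submod_on M U') \<le> len A (submod_on M U)"
    using ex_has_greatest_nat[of P "{\<zero>\<^bsub>M\<^esub>}" "\<lambda>U. len A (submod_on M U)" "Suc (len A M)"] by blast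
  then have sU: "submod A M U" and tU: "submod_on M U \<in> Tors A S" by (auto simp: P_def)
  let ?Q = "quot_mod M U" and ?q = "qrep M U"
  note Q = quot_mod_cat[OF M sU] and q = M.lmod_hom_qrep[OF sU]
    and qs = M.qrep_surj[OF sU] and qk = M.hker_qrep[OF sU]
  note lQ = mod_catD[OF Q]
  interpret Q: left_module A ?Q by (rule lQ)
  have "f v = \<zero>\<^bsub>?Q\<^esub>" if V: "V \<in> Tors A S" "f \<in> lmod_hom A V ?Q" "v \<in> carrier V" for V f v
  proof -
    interpret V: left_module A V using V Tors_mod_cat mod_catD by blast
    define I where "I = f ` carrier V"
    define U' where "U' = {x \<in> carrier M. ?q x \<in> I}"
    have sI: "submod A ?Q I"
      unfolding I_def by (rule submod_image[OF V.is_lmod lQ V(2) V.submod_carrier])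
    have tI: "submod_on ?Q I \<in> Tors A S"
      using submod_mod_cat[OF Q sI] lmod_hom_submod_cod[OF V(2), of I] I_def
      by (intro Tors_quotient[OF V(1)]) auto
    have sU': "submod A M U'"
      unfolding U'_def by (rule submod_vimage[OF M.is_lmod lQ q sI])
    have q0: "x \<in> carrier M" "?q x = \<zero>\<^bsub>?Q\<^esub>" if "x \<in> U" for x
      using qk that unfolding hker_def by blast+
    have UU': "U \<subseteq> U'"
      using q0 Q.submod_zero[OF sI] by (auto simp: U'_def)
    have "submod_on M U' \<in> Tors A S"
    proof (rule Tors_ext[OF S submod_mod_cat[OF M sU'] tU _ tI])
      show "(\<lambda>x. x) \<in> lmod_hom A (submod_on M U) (submod_on M U')"
        using UU' M.submod_subset[OF sU] by (intro lmod_hom_submod_cod lmod_hom_submod_incl) auto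
      show "?q \<in> lmod_hom A (submod_on M U') (submod_on ?Q I)"
        using q M.submod_subset[OF sU'] by (intro lmod_hom_submod_cod lmod_hom_submod_dom) (auto simp: U'_def)
      have "\<exists>x\<in>carrier M. ?q x = y" if "y \<in> I" for y
        using that Q.submod_subset[OF sI] qs by (metis imageE subsetD)
      then show "?q ` carrier (submod_on M U') = carrier (submod_on ?Q I)"
        by (auto simp: U'_def image_iff)
      show "hker (submod_on M U') (submod_on ?Q I) ?q \<subseteq> (\<lambda>x. x) ` carrier (submod_on M U)"
        using qk M.submod_subset[OF sU'] by (auto simp: hker_def)
    qed
    then have "len A (submod_on M U') \<le> len A (submod_on M U)" using U(2) sU' by (auto simp: P_def)
    then have "U' = U"
      using len_submod_less[OF M.left_module_submod[OF sU'] _ finite_length_submod[OF M.is_lmod sU' fl], of U]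
        M.submod_submod_iff[OF sU'] sU UU' by auto
    obtain x where x: "x \<in> carrier M" "?q x = f v"
      using lmod_hom_closed[OF V(2,3)] qs by (metis imageE)
    then have "x \<in> U" using \<open>U' = U\<close> V(3) by (auto simp: U'_def I_def)
    then show ?thesis using q0(2)[of x] x by simp
  qed
  then have "?Q \<in> Free A S" using Q by (auto simp: Free_def)
  then show ?thesis using sU tU by blast
qed

subsection \<open>Bricks\<close>

text \<open>Passes from units of \<open>End_ring\<close>, which are extensional maps, to arbitrary
  functions representing an endomorphism.\<close>

lemma brick_endo:
  assumes B: "B \<in> bricks A" and f: "f \<in> lmod_hom A B B"
  shows "(\<forall>x\<in>carrier B. f x = \<zero>\<^bsub>B\<^esub>) \<or> f \<in> lmod_iso A B B"
proof (cases "\<forall>x\<in>carrier B. f x = \<zero>\<^bsub>B\<^esub>")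
  case False
  have lB: "left_module A B" and sk: "skew_field (End_ring A B)"
    using B mod_catD by (auto simp: bricks_def)
  let ?f = "restrict f (carrier B)"
  obtain x where x: "x \<in> carrier B" "f x \<noteq> \<zero>\<^bsub>B\<^esub>" using False by blast
  have "?f \<in> carrier (End_ring A B)"
    using f lB by (simp add: End_ring_def restrict_lmod_hom)
  moreover have "?f \<noteq> \<zero>\<^bsub>End_ring A B\<^esub>"
  proof
    assume "?f = \<zero>\<^bsub>End_ring A B\<^esub>"
    then have "?f x = \<zero>\<^bsub>End_ring A B\<^esub> x" by simp
    then show False using x by (simp add: End_ring_def)
  qed
  ultimately have "?f \<in> Units (End_ring A B)" using sk by (simp add: skew_field_def)
  then obtain g where gc: "g \<in> carrier (End_ring A B)"
    and gf: "g \<otimes>\<^bsub>End_ring A B\<^esub> ?f = \<one>\<^bsub>End_ring A B\<^esub>" "?f \<otimes>\<^bsub>End_ring A B\<^esub> g = \<one>\<^bsub>End_ring A B\<^esub>"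
    unfolding Units_def by blast
  have g: "g \<in> lmod_hom A B B" using gc by (simp add: End_ring_def)
  have "g (f x) = x" "f (g x) = x" if "x \<in> carrier B" for x
    using fun_cong[OF gf(1), of x] fun_cong[OF gf(2), of x] that lmod_hom_closed[OF g that]
    by (simp_all add: End_ring_def compose_def)
  then show ?thesis using f g lmod_iso_iff_invertible[OF lB lB] by blast
qed simp

lemma brick_nonzero:
  assumes B: "B \<in> bricks A"
  shows "\<exists>x\<in>carrier B. x \<noteq> \<zero>\<^bsub>B\<^esub>"
proof (rule ccontr)
  assume "\<not> ?thesis"
  then have "\<one>\<^bsub>End_ring A B\<^esub> = \<zero>\<^bsub>End_ring A B\<^esub>" by (auto simp: End_ring_def intro!: restrict_ext)
  then show False using B by (simp add: bricks_def skew_field_def)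
qed

text \<open>Minimality arguments show that endomorphisms are zero or bijective; this turns that
  alternative into the condition on the units of \<open>End_ring\<close>.\<close>

lemma brickI:
  assumes M: "M \<in> mod_cat A" and nz: "\<exists>x\<in>carrier M. x \<noteq> \<zero>\<^bsub>M\<^esub>"
    and endo: "\<And>f. f \<in> lmod_hom A M M \<Longrightarrow> (\<forall>x\<in>carrier M. f x = \<zero>\<^bsub>M\<^esub>) \<or> f \<in> lmod_iso A M M"
  shows "M \<in> bricks A"
proof -
  note lM = mod_catD[OF M]
  interpret E: ring "End_ring A M" using lM by (rule ring_End_ring)
  obtain x where x: "x \<in> carrier M" "x \<noteq> \<zero>\<^bsub>M\<^esub>" using nz by blast
  have one: "\<one>\<^bsub>End_ring A M\<^esub> \<noteq> \<zero>\<^bsub>End_ring A M\<^esub>"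
  proof
    assume "\<one>\<^bsub>End_ring A M\<^esub> = \<zero>\<^bsub>End_ring A M\<^esub>"
    then have "\<one>\<^bsub>End_ring A M\<^esub> x = \<zero>\<^bsub>End_ring A M\<^esub> x" by simp
    then show False using x by (simp add: End_ring_def)
  qed
  have "f \<in> Units (End_ring A M)" if f: "f \<in> carrier (End_ring A M)" "f \<noteq> \<zero>\<^bsub>End_ring A M\<^esub>" for f
  proof -
    have f': "f \<in> lmod_hom A M M" "f \<in> extensional (carrier M)" using f by (auto simp: End_ring_def)
    have "\<not> (\<forall>x\<in>carrier M. f x = \<zero>\<^bsub>M\<^esub>)"
      using f' f(2) by (auto simp: End_ring_def intro: extensionalityI)
    then have "f \<in> lmod_iso A M M" using endo[OF f'(1)] by blast
    from lmod_hom_inv_into[OF this lM lM]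
    obtain g where g: "g \<in> lmod_hom A M M" "\<And>x. x \<in> carrier M \<Longrightarrow> g (f x) = x"
      "\<And>x. x \<in> carrier M \<Longrightarrow> f (g x) = x" by blast
    have "restrict g (carrier M) \<in> carrier (End_ring A M)"
      using g lM by (simp add: End_ring_def restrict_lmod_hom)
    moreover have "restrict g (carrier M) \<otimes>\<^bsub>End_ring A M\<^esub> f = \<one>\<^bsub>End_ring A M\<^esub>"
      "f \<otimes>\<^bsub>End_ring A M\<^esub> restrict g (carrier M) = \<one>\<^bsub>End_ring A M\<^esub>"
      using g lmod_hom_closed[OF f'(1)] by (auto simp: End_ring_def compose_def intro!: restrict_ext)
    ultimately show ?thesis using f by (auto simp: Units_def)
  qed
  moreover have "\<zero>\<^bsub>End_ring A M\<^esub> \<notin> Units (End_ring A M)"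
    using one by (metis E.Units_l_inv_ex E.r_null)
  ultimately have "Units (End_ring A M) = carrier (End_ring A M) - {\<zero>\<^bsub>End_ring A M\<^esub>}"
    by auto
  then show ?thesis using M one E.ring_axioms by (simp add: bricks_def skew_field_def)
qed

end

section \<open>Representatives of the bricks and the arrows between them\<close>

locale brick_reps = fin_dim_algebra K A
  for K :: "('k, 'r) ring_scheme" and A :: "('k, 'a, 's) module_scheme" +
  fixes Rp :: "('a, 'a list) module set"
  assumes finite_reps: "finite Rp" and reps_bricks: "Rp \<subseteq> bricks A"
    and reps_complete: "B \<in> bricks A \<Longrightarrow> \<exists>B'\<in>Rp. lmod_isomorphic A B B'"
begin

text \<open>Once representatives of one isomorphism class coincide, the condition
  \<open>B \<noteq> B'\<close> makes the nonzero map non-invertible, so that closed paths of arrows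
  are brick-cycles.\<close>

definition arrows where
  "arrows = {(B, B'). B \<in> Rp \<and> B' \<in> Rp \<and> B \<noteq> B' \<and>
     (\<exists>f\<in>lmod_hom A B B'. \<exists>x\<in>carrier B. f x \<noteq> \<zero>\<^bsub>B'\<^esub>)}"

definition pred_closed where
  "pred_closed S \<longleftrightarrow> S \<subseteq> Rp \<and> (\<forall>B B'. (B, B') \<in> arrows \<longrightarrow> B' \<in> S \<longrightarrow> B \<in> S)"

lemma reps_mod_cat: "B \<in> Rp \<Longrightarrow> B \<in> mod_cat A"
  using reps_bricks by (auto simp: bricks_def)

lemma pred_closed_mod_cat: "pred_closed S \<Longrightarrow> S \<subseteq> mod_cat A"
  using reps_mod_cat by (auto simp: pred_closed_def)

text \<open>A nonzero map from \<open>B\<close> to a member of \<open>S\<close> would be an arrow,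
  and closedness under predecessors would put \<open>B\<close> into \<open>S\<close>.\<close>

lemma rep_in_Tors:
  assumes "pred_closed S" "B \<in> Rp" "B \<notin> S"
  shows "B \<in> Tors A S"
  using assms reps_mod_cat[OF assms(2)] unfolding Tors_def pred_closed_def arrows_def by blast

end

section \<open>The interval between two torsion classes that differ by one brick\<close>

locale brick_mutation = brick_reps K A Rp
  for K :: "('k, 'r) ring_scheme" and A :: "('k, 'a, 's) module_scheme" and Rp +
  fixes S :: "('a, 'a list) module set" and X
  assumes S: "pred_closed S" and XS: "pred_closed (insert X S)" and X: "X \<notin> S"
begin

abbreviation "S' \<equiv> insert X S"

lemma S_mod_cat: "S \<subseteq> mod_cat A" "S' \<subseteq> mod_cat A"
  using S XS by (simp_all only: pred_closed_mod_cat)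

lemma X_brick: "X \<in> bricks A" and X_mod_cat: "X \<in> mod_cat A" and X_Tors: "X \<in> Tors A S"
  using XS reps_bricks rep_in_Tors[OF S _ X] by (auto simp: pred_closed_def bricks_def)

lemma Tors_S': "Tors A S' \<subseteq> Tors A S"
  by (rule Tors_antimono) auto

text \<open>
  A minimal nonzero submodule in \<^term>\<open>Tors A S\<close> has only zero or bijective endomorphisms.
\<close>

lemma X_embeds:
  assumes N: "N \<in> Tors A S" "N \<in> Free A S'" and nz: "\<exists>x\<in>carrier N. x \<noteq> \<zero>\<^bsub>N\<^esub>"
  shows "\<exists>i\<in>lmod_hom A X N. inj_on i (carrier X)"
proof -
  have Nc: "N \<in> mod_cat A" by (rule Tors_mod_cat[OF N(1)])
  interpret N: left_module A N by (rule mod_catD[OF Nc])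
  define P where "P U \<longleftrightarrow> submod A N U \<and> submod_on N U \<in> Tors A S \<and> U \<noteq> {\<zero>\<^bsub>N\<^esub>}" for U
  have "P (carrier N)" using N nz N.submod_carrier by (auto simp: P_def)
  then obtain U where U: "P U" "\<And>U'. P U' \<Longrightarrow> len A (submod_on N U) \<le> len A (submod_on N U')"
    using ex_has_least_nat[of P "carrier N" "\<lambda>U. len A (submod_on N U)"] by blast
  let ?U = "submod_on N U"
  have sU: "submod A N U" and tU: "?U \<in> Tors A S" and nU: "U \<noteq> {\<zero>\<^bsub>N\<^esub>}" using U(1) by (auto simp: P_def)
  note Uc = Tors_mod_cat[OF tU]
  interpret U: left_module A ?U by (rule mod_catD[OF Uc])
  have flU: "finite_length A ?U" using Uc by (simp add: mod_cat_iff)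
  have incl: "(\<lambda>x. x) \<in> lmod_hom A ?U N" by (rule lmod_hom_submod_incl[OF N.submod_subset[OF sU]])
  have "?U \<in> bricks A"
  proof (rule brickI[OF Uc])
    show "\<exists>x\<in>carrier ?U. x \<noteq> \<zero>\<^bsub>?U\<^esub>" using nU N.submod_zero[OF sU] by auto
    fix f assume f: "f \<in> lmod_hom A ?U ?U"
    define I where "I = f ` U"
    have sI: "submod A ?U I"
      using submod_image[OF U.is_lmod U.is_lmod f U.submod_carrier] by (simp add: I_def)
    then have sI': "submod A N I" "I \<subseteq> U" using N.submod_submod_iff[OF sU] by auto
    have "submod_on N I \<in> Tors A S"
      using submod_mod_cat[OF Nc sI'(1)] lmod_hom_submod_cod[OF f, of I]
      by (intro Tors_quotient[OF tU]) (auto simp: I_def)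
    then have "I \<noteq> {\<zero>\<^bsub>N\<^esub>} \<Longrightarrow> len A ?U \<le> len A (submod_on N I)"
      using U(2) sI'(1) by (simp add: P_def)
    moreover have "I \<noteq> U \<Longrightarrow> len A (submod_on N I) < len A ?U"
      using len_submod_less[OF U.is_lmod sI flU] by simp
    ultimately have "I = {\<zero>\<^bsub>N\<^esub>} \<or> I = U" by linarith
    then show "(\<forall>x\<in>carrier ?U. f x = \<zero>\<^bsub>?U\<^esub>) \<or> f \<in> lmod_iso A ?U ?U"
    proof
      assume "I = U"
      then have "f ` carrier ?U = carrier ?U" by (simp add: I_def)
      then show ?thesis
        using surj_endo_inj[OF U.is_lmod f _ flU] f by (auto simp: lmod_iso_def bij_betw_def)
    qed (auto simp: I_def)
  qed
  from reps_complete[OF this] obtain B h where B: "B \<in> Rp" "h \<in> lmod_iso A ?U B"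
    by (auto simp: lmod_isomorphic_def)
  note Bc = reps_mod_cat[OF B(1)]
  interpret B: left_module A B by (rule mod_catD[OF Bc])
  obtain i where i: "i \<in> lmod_hom A B ?U" "\<And>x. x \<in> U \<Longrightarrow> i (h x) = x" "\<And>y. y \<in> carrier B \<Longrightarrow> h (i y) = y"
    using lmod_hom_inv_into[OF B(2) U.is_lmod B.is_lmod] by auto
  have iN: "i \<in> lmod_hom A B N" using i(1) N.submod_subset[OF sU] by (rule lmod_hom_submod_codD)
  have inj: "inj_on i (carrier B)" by (rule inj_on_inverseI) (rule i(3))
  have h: "h \<in> lmod_hom A ?U B" "h ` carrier ?U = carrier B"
    using B(2) by (auto simp: lmod_iso_def bij_betw_def)
  have BT: "B \<in> Tors A S" by (rule Tors_quotient[OF tU Bc h])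
  have BF: "B \<in> Free A S'" by (rule Free_sub[OF N(2) Bc iN inj])
  obtain b where b: "b \<in> carrier B" "b \<noteq> \<zero>\<^bsub>B\<^esub>" using brick_nonzero B(1) reps_bricks by blast
  \<comment> \<open>Outside \<open>S'\<close> the brick \<open>B\<close> would be both torsion and
    torsion-free for \<open>S'\<close>; inside \<open>S\<close> its identity would be a nonzero map
    from a module of \<open>Tors A S\<close> to a member of \<open>S\<close>.\<close>
  have "B \<in> S'"
    using rep_in_Tors[OF XS B(1)] Tors_Free_zero[OF _ BF b(1)] b(2) by blast
  moreover have "B \<notin> S"
    using TorsD[OF BT _ lmod_hom_id b(1)] b(2) by blast
  ultimately have "B = X" by blast
  then show ?thesis using iN inj by blast
qed

text \<open>Let \<open>I\<close> be the image in \<open>Q\<close> of a module that is torsion for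
  \<open>S'\<close>. Its preimage \<open>E\<close> in \<open>N\<close> is an extension of
  \<open>I\<close> by \<open>X\<close>. Being nonzero and torsion-free for \<open>S'\<close> but
  torsion for \<open>S\<close>, \<open>E\<close> has a nonzero map to \<open>X\<close>. The
  restriction of that map to \<open>X\<close> is invertible because \<open>X\<close> is a brick, so
  the extension splits; this gives a map from \<open>I\<close> to \<open>E\<close>, which must be
  zero, and hence \<open>I\<close> is zero.\<close>

lemma quotient_by_X:
  assumes N: "N \<in> Tors A S" "N \<in> Free A S'" and i: "i \<in> lmod_hom A X N" "inj_on i (carrier X)"
    and Q: "Q \<in> mod_cat A" and q: "q \<in> lmod_hom A N Q" "q ` carrier N = carrier Q"
    and ker: "hker N Q q = i ` carrier X"
  shows "Q \<in> Tors A S" "Q \<in> Free A S'"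
proof -
  show "Q \<in> Tors A S" by (rule Tors_quotient[OF N(1) Q q])
  have Nc: "N \<in> mod_cat A" by (rule Tors_mod_cat[OF N(1)])
  interpret N: left_module A N by (rule mod_catD[OF Nc])
  interpret Q: left_module A Q by (rule mod_catD[OF Q])
  interpret X: left_module A X by (rule mod_catD[OF X_mod_cat])
  have "f v = \<zero>\<^bsub>Q\<^esub>" if V: "V \<in> Tors A S'" "f \<in> lmod_hom A V Q" "v \<in> carrier V" for V f v
  proof -
    interpret V: left_module A V using V Tors_mod_cat mod_catD by blast
    define I where "I = f ` carrier V"
    define E where "E = {x \<in> carrier N. q x \<in> I}"
    let ?I = "submod_on Q I" and ?E = "submod_on N E"
    have sI: "submod A Q I"
      unfolding I_def by (rule submod_image[OF V.is_lmod Q.is_lmod V(2) V.submod_carrier])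
    have sE: "submod A N E"
      unfolding E_def by (rule submod_vimage[OF N.is_lmod Q.is_lmod q(1) sI])
    have tI: "?I \<in> Tors A S'"
      using submod_mod_cat[OF Q sI] lmod_hom_submod_cod[OF V(2), of I] I_def
      by (intro Tors_quotient[OF V(1)]) auto
    note Ec = submod_mod_cat[OF Nc sE] and Ic = Tors_mod_cat[OF tI]
    interpret E: left_module A ?E by (rule mod_catD[OF Ec])
    interpret I: left_module A ?I by (rule mod_catD[OF Ic])
    have k: "q (i x) = \<zero>\<^bsub>Q\<^esub>" "i x \<in> E" if "x \<in> carrier X" for x
    proof -
      have "i x \<in> hker N Q q" using that ker by blast
      then show "q (i x) = \<zero>\<^bsub>Q\<^esub>" "i x \<in> E" using Q.submod_zero[OF sI] by (auto simp: hker_def E_def)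
    qed
    have k': "\<exists>x\<in>carrier X. y = i x" if "y \<in> E" "q y = \<zero>\<^bsub>Q\<^esub>" for y
      using that ker by (auto simp: E_def hker_def)
    have iE: "i \<in> lmod_hom A X ?E" using k by (intro lmod_hom_submod_cod[OF i(1)]) auto
    have qE: "q \<in> lmod_hom A ?E ?I"
      using q(1) N.submod_subset[OF sE] by (intro lmod_hom_submod_cod lmod_hom_submod_dom) (auto simp: E_def)
    have "I \<subseteq> q ` E"
    proof
      fix y assume y: "y \<in> I"
      then have "y \<in> q ` carrier N" using Q.submod_subset[OF sI] q(2) by blast
      then show "y \<in> q ` E" using y by (auto simp: E_def)
    qed
    then have qEs: "q ` carrier ?E = carrier ?I" by (auto simp: E_def)
    have EF: "?E \<in> Free A S'"
      using lmod_hom_submod_incl[OF N.submod_subset[OF sE]] by (intro Free_sub[OF N(2) Ec]) auto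
    have "hker ?E ?I q \<subseteq> i ` carrier X" using k' by (auto simp: hker_def)
    then have ET: "?E \<in> Tors A S"
      using tI Tors_S' by (intro Tors_ext[OF S_mod_cat(1) Ec X_Tors iE _ qE qEs]) auto
    obtain b where b: "b \<in> carrier X" "b \<noteq> \<zero>\<^bsub>X\<^esub>" using brick_nonzero[OF X_brick] by blast
    then have "i b \<noteq> \<zero>\<^bsub>N\<^esub>"
      using i lmod_hom_zero[OF X.is_lmod N.is_lmod i(1)]
      by (metis X.M.zero_closed inj_onD)
    then have "?E \<notin> Tors A S'" using Tors_Free_zero[OF _ EF, of "i b"] k(2)[OF b(1)] by auto
    then obtain B g y where "B \<in> S'" "g \<in> lmod_hom A ?E B" "y \<in> E" "g y \<noteq> \<zero>\<^bsub>B\<^esub>"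
      using Ec by (auto simp: Tors_def)
    moreover from this have "B = X" using TorsD[OF ET, of B g y] by auto
    ultimately have g: "g \<in> lmod_hom A ?E X" "y \<in> E" "g y \<noteq> \<zero>\<^bsub>X\<^esub>" by auto
    have gi: "g \<circ> i \<in> lmod_hom A X X" by (rule lmod_hom_comp[OF iE g(1)])
    \<comment> \<open>If \<open>g\<close> vanished on the copy of \<open>X\<close>, it would factor
      through \<open>?I\<close>, which is torsion for \<open>S'\<close> and so has no nonzero map to
      \<open>X\<close>.\<close>
    have "g \<circ> i \<in> lmod_iso A X X"
    proof (rule ccontr)
      assume "g \<circ> i \<notin> lmod_iso A X X"
      then have "\<forall>x\<in>carrier X. g (i x) = \<zero>\<^bsub>X\<^esub>" using brick_endo[OF X_brick gi] by auto
      then have "g x = \<zero>\<^bsub>X\<^esub>" if "x \<in> carrier ?E" "q x = \<zero>\<^bsub>?I\<^esub>" for x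
        using k'[of x] that by auto
      then obtain g' where g': "g' \<in> lmod_hom A ?I X" "\<And>x. x \<in> carrier ?E \<Longrightarrow> g' (q x) = g x"
        using lmod_hom_factor_surj[OF E.is_lmod I.is_lmod X.is_lmod qE qEs g(1)]
        by blast
      have "g' (q y) = \<zero>\<^bsub>X\<^esub>"
        using g(2) by (intro TorsD[OF tI _ g'(1)]) (auto simp: E_def)
      then show False using g' g by auto
    qed
    then obtain u where u: "u \<in> lmod_hom A X X" "\<And>x. x \<in> carrier X \<Longrightarrow> u (g (i x)) = x"
      using lmod_hom_inv_into[OF _ X.is_lmod X.is_lmod] by fastforce
    \<comment> \<open>\<open>w\<close> is the projection of \<open>E\<close> onto the copy of
      \<open>X\<close>; the complementary map \<open>r\<close> kills that copy and therefore
      descends to \<open>?I\<close>.\<close>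
    define w where "w z = (i \<circ> (u \<circ> g)) z" for z
    have w: "w \<in> lmod_hom A ?E ?E"
      unfolding w_def[abs_def] by (intro lmod_hom_comp[OF _ iE] lmod_hom_comp[OF g(1)] u)
    have wX: "w z \<in> i ` carrier X" if "z \<in> E" for z
      using that lmod_hom_closed[OF u(1) lmod_hom_closed[OF g(1)]] by (auto simp: w_def)
    define r where "r z = z \<ominus>\<^bsub>?E\<^esub> w z" for z
    have r: "r \<in> lmod_hom A ?E ?E"
      unfolding r_def by (rule lmod_hom_diff[OF E.is_lmod E.is_lmod lmod_hom_id w])
    have "r x = \<zero>\<^bsub>?E\<^esub>" if x: "x \<in> carrier ?E" "q x = \<zero>\<^bsub>?I\<^esub>" for x
    proof -
      obtain a where "a \<in> carrier X" "x = i a" using k'[of x] x by auto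
      then have "w x = x" using u(2) by (simp add: w_def)
      then show ?thesis using x(1) E.M.r_neg by (simp add: r_def a_minus_def)
    qed
    then obtain r' where r': "r' \<in> lmod_hom A ?I ?E" "\<And>x. x \<in> carrier ?E \<Longrightarrow> r' (q x) = r x"
      using lmod_hom_factor_surj[OF E.is_lmod I.is_lmod E.is_lmod qE qEs r]
      by blast
    obtain z where z: "z \<in> E" "q z = f v"
    proof -
      have "f v \<in> q ` E" using qEs V(3) by (simp add: I_def)
      then show ?thesis using that by (metis imageE)
    qed
    have "r' (q z) = \<zero>\<^bsub>?E\<^esub>" using FreeD[OF EF tI r'(1), of "q z"] z(1) by (simp add: E_def)
    then have "r z = \<zero>\<^bsub>?E\<^esub>" using r'(2) z(1) by simp
    moreover have wz: "w z \<in> carrier ?E" using lmod_hom_closed[OF w] z(1) by simp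
    ultimately have "z = \<ominus>\<^bsub>?E\<^esub> (\<ominus>\<^bsub>?E\<^esub> w z)"
      using z(1) E.M.a_inv_closed by (intro E.M.minus_equality[symmetric]) (auto simp: r_def a_minus_def)
    then have "z = w z" using E.M.minus_minus[OF wz] by simp
    then have "q z = \<zero>\<^bsub>Q\<^esub>" using wX[OF z(1)] k(1) by auto
    then show ?thesis using z(2) by simp
  qed
  then show "Q \<in> Free A S'" using Q by (auto simp: Free_def)
qed

text \<open>The kernel is torsion for \<open>S\<close> and torsion-free for \<open>S'\<close>, so if
  it is nonzero it contains a copy of \<open>X\<close>. Dividing \<open>N\<close> by that copy
  preserves all hypotheses and shortens \<open>N\<close>; once the kernel is zero, \<open>Q\<close>
  embeds in \<open>N\<close>.\<close>

lemma quotient_in_Free: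
  assumes "N \<in> Tors A S" "N \<in> Free A S'" "Q \<in> mod_cat A" "q \<in> lmod_hom A N Q" "q ` carrier N = carrier Q"
    "submod_on N (hker N Q q) \<in> Tors A S"
  shows "Q \<in> Free A S'"
  using assms
proof (induction "len A N" arbitrary: N q rule: less_induct)
  case less
  note N = less.prems(1,2) and Q = less.prems(3) and q = less.prems(4,5)
  have Nc: "N \<in> mod_cat A" by (rule Tors_mod_cat[OF N(1)])
  interpret N: left_module A N by (rule mod_catD[OF Nc])
  interpret Q: left_module A Q by (rule mod_catD[OF Q])
  interpret X: left_module A X by (rule mod_catD[OF X_mod_cat])
  let ?L = "hker N Q q"
  note sL = submod_hker[OF N.is_lmod Q.is_lmod q(1)]
  show ?case
  proof (cases "?L = {\<zero>\<^bsub>N\<^esub>}")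
    case True
    then have "x = \<zero>\<^bsub>N\<^esub>" if "x \<in> carrier N" "q x = \<zero>\<^bsub>Q\<^esub>" for x using that by (auto simp: hker_def)
    then obtain g where g: "g \<in> lmod_hom A Q N" "\<And>x. x \<in> carrier N \<Longrightarrow> g (q x) = x"
      using lmod_hom_factor_surj[OF N.is_lmod Q.is_lmod N.is_lmod q lmod_hom_id]
      by blast
    have "inj_on g (carrier Q)" unfolding q(2)[symmetric] by (rule inj_onI) (auto simp: g(2))
    then show ?thesis by (rule Free_sub[OF N(2) Q g(1)])
  next
    case False
    note Lc = Tors_mod_cat[OF less.prems(6)]
    have incl: "(\<lambda>x. x) \<in> lmod_hom A (submod_on N ?L) N"
      by (rule lmod_hom_submod_incl[OF N.submod_subset[OF sL]])
    have LF: "submod_on N ?L \<in> Free A S'"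
      using incl by (intro Free_sub[OF N(2) Lc]) auto
    have "\<exists>x\<in>carrier (submod_on N ?L). x \<noteq> \<zero>\<^bsub>submod_on N ?L\<^esub>"
      using False N.submod_zero[OF sL] by auto
    then obtain i where i: "i \<in> lmod_hom A X (submod_on N ?L)" "inj_on i (carrier X)"
      using X_embeds[OF less.prems(6) LF] by blast
    have iL: "i ` carrier X \<subseteq> ?L" using lmod_hom_closed[OF i(1)] by auto
    have iN: "i \<in> lmod_hom A X N" using lmod_hom_submod_codD[OF i(1) N.submod_subset[OF sL]] .
    define I where "I = i ` carrier X"
    have sI: "submod A N I"
      unfolding I_def by (rule submod_image[OF X.is_lmod N.is_lmod iN X.submod_carrier])
    let ?Q = "quot_mod N I" and ?q = "qrep N I"
    note Q' = quot_mod_cat[OF Nc sI] and q' = N.lmod_hom_qrep[OF sI]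
      and qs = N.qrep_surj[OF sI] and qk = N.hker_qrep[OF sI]
    interpret Q': left_module A ?Q by (rule mod_catD[OF Q'])
    have W: "?Q \<in> Tors A S" "?Q \<in> Free A S'"
      using quotient_by_X[OF N iN i(2) Q' q' qs] qk by (simp_all add: I_def)
    obtain b where b: "b \<in> carrier X" "b \<noteq> \<zero>\<^bsub>X\<^esub>" using brick_nonzero[OF X_brick] by blast
    then have "i b \<noteq> \<zero>\<^bsub>N\<^esub>"
      using i lmod_hom_zero[OF X.is_lmod N.is_lmod iN]
      by (metis X.M.zero_closed inj_onD)
    moreover have "i b \<in> hker N ?Q ?q" using b qk by (simp add: I_def)
    ultimately have less_len: "len A ?Q < len A N"
      using Nc by (intro len_surj_less[OF N.is_lmod Q'.is_lmod q' qs, of "i b"])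
        (auto simp: mod_cat_iff hker_def)
    have "q x = \<zero>\<^bsub>Q\<^esub>" if "x \<in> carrier N" "?q x = \<zero>\<^bsub>?Q\<^esub>" for x
    proof -
      have "x \<in> hker N ?Q ?q" using that by (simp add: hker_def)
      then show ?thesis using qk iL by (auto simp: I_def hker_def)
    qed
    then obtain q2 where q2: "q2 \<in> lmod_hom A ?Q Q" "\<And>x. x \<in> carrier N \<Longrightarrow> q2 (?q x) = q x"
      using lmod_hom_factor_surj[OF N.is_lmod Q'.is_lmod Q.is_lmod q' qs q(1)]
      by blast
    have q2s: "q2 ` carrier ?Q = carrier Q"
      unfolding qs[symmetric] q(2)[symmetric] image_image using q2(2) by (intro image_cong) auto
    have ker: "hker ?Q Q q2 = ?q ` ?L"
      unfolding hker_def qs[symmetric] using q2(2) by (auto simp: image_iff)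
    have sK: "submod A ?Q (?q ` ?L)"
      by (rule submod_image[OF N.is_lmod Q'.is_lmod q' sL])
    have "?q \<in> lmod_hom A (submod_on N ?L) (submod_on ?Q (?q ` ?L))"
      using lmod_hom_submod_dom[OF q' N.submod_subset[OF sL]] by (rule lmod_hom_submod_cod) auto
    then have "submod_on ?Q (hker ?Q Q q2) \<in> Tors A S"
      unfolding ker using submod_mod_cat[OF Q' sK] by (intro Tors_quotient[OF less.prems(6)]) auto
    then show ?thesis by (rule less.hyps[OF less_len W Q q2(1) q2s])
  qed
qed

end

section \<open>Left approximations of the regular module\<close>

text \<open>
  A map from the regular module to \<open>M\<close> is an element \<open>m\<close> of \<open>M\<close>; it is a left \<open>T\<close>-approximation iff
  every element of a module in \<open>T\<close> is an image of \<open>m\<close>.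
\<close>

definition left_approx ::
  "('a, 'x) ring_scheme \<Rightarrow> ('a, 'a list) module set \<Rightarrow> ('a, 'a list) module \<Rightarrow> 'a list \<Rightarrow> bool" where
  "left_approx A T M m \<longleftrightarrow> M \<in> T \<and> m \<in> carrier M \<and>
     (\<forall>Y\<in>T. \<forall>y\<in>carrier Y. \<exists>h\<in>lmod_hom A M Y. h m = y)"

text \<open>The common feature of torsion classes and of the class of projectives that allows direct
  sums to be formed inside either.\<close>

definition biproduct_closed :: "('a, 'x) ring_scheme \<Rightarrow> ('a, 'a list) module set \<Rightarrow> bool" where
  "biproduct_closed A T \<longleftrightarrow> T \<subseteq> mod_cat A \<and>
     (\<forall>M\<in>T. \<forall>N\<in>T. \<forall>P\<in>mod_cat A. \<forall>i j p q. biproduct A P M N i j p q \<longrightarrow> P \<in> T)"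

lemma biproduct_closedD:
  assumes "biproduct_closed A T"
  shows "T \<subseteq> mod_cat A"
    and "M \<in> T \<Longrightarrow> N \<in> T \<Longrightarrow> P \<in> mod_cat A \<Longrightarrow> biproduct A P M N i j p q \<Longrightarrow> P \<in> T"
  using assms unfolding biproduct_closed_def by blast+

context fin_dim_algebra
begin

lemma biproduct_closed_Tors: "S \<subseteq> mod_cat A \<Longrightarrow> biproduct_closed A (Tors A S)"
  unfolding biproduct_closed_def
proof (intro conjI ballI allI impI)
  fix M N P i j p q
  assume "S \<subseteq> mod_cat A" "M \<in> Tors A S" "N \<in> Tors A S" "P \<in> mod_cat A" "biproduct A P M N i j p q"
  then show "P \<in> Tors A S" by (rule Tors_biproduct)
qed (auto simp: Tors_def)

lemma projective_lift:
  assumes "projective A P" "X \<in> mod_cat A" "Y \<in> mod_cat A" "g \<in> lmod_hom A X Y"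
    "g ` carrier X = carrier Y" "f \<in> lmod_hom A P Y"
  shows "\<exists>h\<in>lmod_hom A P X. \<forall>x\<in>carrier P. g (h x) = f x"
  using assms unfolding projective_def by blast

lemma biproduct_closed_projective: "biproduct_closed A {P. projective A P}"
  unfolding biproduct_closed_def
proof (intro conjI ballI allI impI)
  fix M N P i j p q
  assume M: "M \<in> {P. projective A P}" and N: "N \<in> {P. projective A P}" and P: "P \<in> mod_cat A"
    and b: "biproduct A P M N i j p q"
  have h: "i \<in> lmod_hom A M P" "j \<in> lmod_hom A N P" "p \<in> lmod_hom A P M" "q \<in> lmod_hom A P N"
    and z: "\<And>z. z \<in> carrier P \<Longrightarrow> z = i (p z) \<oplus>\<^bsub>P\<^esub> j (q z)"
    using b by (auto simp: biproduct_def)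
  have "\<exists>h\<in>lmod_hom A P X. \<forall>x\<in>carrier P. g (h x) = f x"
    if X: "X \<in> mod_cat A" "Y \<in> mod_cat A" "g \<in> lmod_hom A X Y" "f \<in> lmod_hom A P Y"
      "g ` carrier X = carrier Y" for X Y g f
  proof -
    have proj: "projective A M" "projective A N" using M N by auto
    from projective_lift[OF proj(1) X(1,2,3,5) lmod_hom_comp[OF h(1) X(4)]]
    obtain u where u: "u \<in> lmod_hom A M X" "\<forall>x\<in>carrier M. g (u x) = (f \<circ> i) x" by (elim bexE) (rule that)
    from projective_lift[OF proj(2) X(1,2,3,5) lmod_hom_comp[OF h(2) X(4)]]
    obtain v where v: "v \<in> lmod_hom A N X" "\<forall>x\<in>carrier N. g (v x) = (f \<circ> j) x" by (elim bexE) (rule that)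
    have w: "(\<lambda>z. (u \<circ> p) z \<oplus>\<^bsub>X\<^esub> (v \<circ> q) z) \<in> lmod_hom A P X"
      by (intro lmod_hom_sum mod_catD P X lmod_hom_comp[OF h(3) u(1)] lmod_hom_comp[OF h(4) v(1)])
    have "g ((u \<circ> p) x \<oplus>\<^bsub>X\<^esub> (v \<circ> q) x) = f x" if x: "x \<in> carrier P" for x
    proof -
      have c: "p x \<in> carrier M" "q x \<in> carrier N" using lmod_hom_closed[OF h(3) x] lmod_hom_closed[OF h(4) x] .
      have "g ((u \<circ> p) x \<oplus>\<^bsub>X\<^esub> (v \<circ> q) x) = f (i (p x)) \<oplus>\<^bsub>Y\<^esub> f (j (q x))"
        using c u v lmod_hom_closed[OF u(1)] lmod_hom_closed[OF v(1)] lmod_hom_add[OF X(3)] by simp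
      also have "\<dots> = f (i (p x) \<oplus>\<^bsub>P\<^esub> j (q x))"
        using c lmod_hom_closed[OF h(1)] lmod_hom_closed[OF h(2)] lmod_hom_add[OF X(4)] by simp
      finally show ?thesis by (simp only: z[OF x, symmetric])
    qed
    then show ?thesis by (intro bexI[OF _ w] ballI)
  qed
  then show "P \<in> {P. projective A P}" using P by (simp add: projective_def)
qed (auto simp: projective_def)

text \<open>\<open>P\<close> is the direct sum of the domains of the maps in \<open>\<Phi>\<close>,
  and \<open>\<pi>\<close> is the sum of these maps. The summands are not named. That each map
  factors through \<open>\<pi>\<close> replaces the inclusions; that \<open>\<pi> x\<close> is a sum
  of terms \<open>h (p x)\<close> is expressed by membership in every set closed under addition that
  contains such terms.\<close>

lemma sum_of_homs:
  assumes T: "biproduct_closed A T" and X: "X \<in> mod_cat A" and "finite \<Phi>" "\<Phi> \<noteq> {}"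
    and "\<forall>D h. (D, h) \<in> \<Phi> \<longrightarrow> D \<in> T \<and> h \<in> lmod_hom A D X"
  shows "\<exists>P\<in>T. \<exists>\<pi>\<in>lmod_hom A P X.
    (\<forall>D h. (D, h) \<in> \<Phi> \<longrightarrow> (\<exists>i\<in>lmod_hom A D P. \<forall>x\<in>carrier D. \<pi> (i x) = h x)) \<and>
    (\<forall>x\<in>carrier P. \<forall>Z. (\<forall>a\<in>Z. \<forall>b\<in>Z. a \<oplus>\<^bsub>X\<^esub> b \<in> Z) \<longrightarrow>
       (\<forall>D h. (D, h) \<in> \<Phi> \<longrightarrow> (\<forall>p\<in>lmod_hom A P D. h (p x) \<in> Z)) \<longrightarrow> \<pi> x \<in> Z)"
  using assms(3-)
proof (induction \<Phi> rule: finite_ne_induct)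
  case (singleton a)
  obtain D h where a: "a = (D, h)" by (cases a)
  have Dh: "D \<in> T" "h \<in> lmod_hom A D X" using singleton a by auto
  show ?case
    by (intro bexI[OF _ Dh(1)] bexI[OF _ Dh(2)])
      (use lmod_hom_id[of A D] in \<open>auto simp: a intro!: bexI[of _ "\<lambda>x. x"]\<close>)
next
  case (insert a \<Phi>)
  obtain D h where a: "a = (D, h)" by (cases a)
  have Dh: "D \<in> T" "h \<in> lmod_hom A D X" using insert.prems a by blast+
  have "\<forall>D h. (D, h) \<in> \<Phi> \<longrightarrow> D \<in> T \<and> h \<in> lmod_hom A D X" using insert.prems by blast
  from insert.IH[OF this] obtain P \<pi> where P: "P \<in> T" "\<pi> \<in> lmod_hom A P X"
    and lift: "\<forall>D h. (D, h) \<in> \<Phi> \<longrightarrow> (\<exists>i\<in>lmod_hom A D P. \<forall>x\<in>carrier D. \<pi> (i x) = h x)"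
    and gen: "\<forall>x\<in>carrier P. \<forall>Z. (\<forall>a\<in>Z. \<forall>b\<in>Z. a \<oplus>\<^bsub>X\<^esub> b \<in> Z) \<longrightarrow>
       (\<forall>D h. (D, h) \<in> \<Phi> \<longrightarrow> (\<forall>p\<in>lmod_hom A P D. h (p x) \<in> Z)) \<longrightarrow> \<pi> x \<in> Z"
    by (elim bexE conjE) (rule that)
  have cat: "D \<in> mod_cat A" "P \<in> mod_cat A" using biproduct_closedD(1)[OF T] Dh P by blast+
  obtain Q i j p q where Q: "Q \<in> mod_cat A" and b: "biproduct A Q D P i j p q"
    using biproduct_exists[OF cat] by blast
  have h: "i \<in> lmod_hom A D Q" "j \<in> lmod_hom A P Q" "p \<in> lmod_hom A Q D" "q \<in> lmod_hom A Q P"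
    and z: "\<And>x. x \<in> carrier D \<Longrightarrow> p (i x) = x \<and> q (i x) = \<zero>\<^bsub>P\<^esub>"
      "\<And>x. x \<in> carrier P \<Longrightarrow> p (j x) = \<zero>\<^bsub>D\<^esub> \<and> q (j x) = x"
    using b by (auto simp: biproduct_def)
  interpret X: left_module A X by (rule mod_catD[OF X])
  note lm = mod_catD[OF cat(1)] mod_catD[OF cat(2)]
  define \<rho> where "\<rho> z = (h \<circ> p) z \<oplus>\<^bsub>X\<^esub> (\<pi> \<circ> q) z" for z
  have \<rho>: "\<rho> \<in> lmod_hom A Q X"
    unfolding \<rho>_def[abs_def]
    by (intro lmod_hom_sum mod_catD Q X lmod_hom_comp[OF h(3) Dh(2)] lmod_hom_comp[OF h(4) P(2)])
  have QT: "Q \<in> T" by (rule biproduct_closedD(2)[OF T Dh(1) P(1) Q b])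
  show ?case
  proof (intro bexI[OF _ QT] bexI[OF _ \<rho>] conjI ballI allI impI, goal_cases)
    case (1 D' h')
    show ?case
    proof (cases "(D', h') = a")
      case True
      have "\<rho> (i x) = h x" if "x \<in> carrier D" for x
        using z(1)[OF that] lmod_hom_zero[OF lm(2) X.is_lmod P(2)] lmod_hom_closed[OF Dh(2) that]
        by (simp add: \<rho>_def)
      then show ?thesis using True a h(1) by auto
    next
      case False
      then have "(D', h') \<in> \<Phi>" using 1 by simp
      from lift[rule_format, OF this] obtain k where k: "k \<in> lmod_hom A D' P" "\<And>x. x \<in> carrier D' \<Longrightarrow> \<pi> (k x) = h' x"
        by blast
      have "\<rho> ((j \<circ> k) x) = h' x" if x: "x \<in> carrier D'" for x
      proof -
        have "\<pi> (k x) \<in> carrier X" by (rule lmod_hom_closed[OF P(2) lmod_hom_closed[OF k(1) x]])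
        then show ?thesis
          using z(2)[OF lmod_hom_closed[OF k(1) x]] lmod_hom_zero[OF lm(1) X.is_lmod Dh(2)] k(2)[OF x]
          by (simp add: \<rho>_def)
      qed
      then show ?thesis using lmod_hom_comp[OF k(1) h(2)] by blast
    qed
  next
    case (2 x Z)
    note * = 2(3)[rule_format]
    have "\<pi> (q x) \<in> Z"
    proof (rule gen[THEN bspec, THEN spec, THEN mp, THEN mp, OF lmod_hom_closed[OF h(4) 2(1)] 2(2)],
        intro allI impI ballI)
      fix D' h' p' assume "(D', h') \<in> \<Phi>" "p' \<in> lmod_hom A P D'"
      then show "h' (p' (q x)) \<in> Z" using *[of D' h' "p' \<circ> q"] lmod_hom_comp[OF h(4)] by auto
    qed
    moreover have "h (p x) \<in> Z" using *[of D h p] a h(3) by auto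
    ultimately show ?case using 2(2) by (auto simp: \<rho>_def)
  qed
qed

text \<open>The direct sum of the modules in \<open>\<Psi>\<close>, with the tuple of their chosen
  elements; a module occurs once for each element paired with it.\<close>

lemma pointed_product:
  assumes T: "biproduct_closed A T" and "finite \<Psi>" "\<Psi> \<noteq> {}"
    and "\<forall>D d. (D, d) \<in> \<Psi> \<longrightarrow> D \<in> T \<and> d \<in> carrier D"
  shows "\<exists>M\<in>T. \<exists>m\<in>carrier M. \<forall>D d. (D, d) \<in> \<Psi> \<longrightarrow> (\<exists>p\<in>lmod_hom A M D. p m = d)"
  using assms(2-)
proof (induction \<Psi> rule: finite_ne_induct)
  case (singleton a)
  obtain D d where a: "a = (D, d)" by (cases a)
  have D: "D \<in> T" "d \<in> carrier D" using singleton a by auto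
  show ?case
    by (intro bexI[OF _ D(1)] bexI[OF _ D(2)])
      (use lmod_hom_id[of A D] in \<open>auto simp: a intro!: bexI[of _ "\<lambda>x. x"]\<close>)
next
  case (insert a \<Psi>)
  obtain D d where a: "a = (D, d)" by (cases a)
  have D: "D \<in> T" "d \<in> carrier D" using insert.prems a by blast+
  have "\<forall>D d. (D, d) \<in> \<Psi> \<longrightarrow> D \<in> T \<and> d \<in> carrier D" using insert.prems by blast
  from insert.IH[OF this] obtain M m where M: "M \<in> T" "m \<in> carrier M"
    and pr: "\<forall>D d. (D, d) \<in> \<Psi> \<longrightarrow> (\<exists>p\<in>lmod_hom A M D. p m = d)"
    by (elim bexE) (rule that)
  have cat: "D \<in> mod_cat A" "M \<in> mod_cat A" using biproduct_closedD(1)[OF T] D M by blast+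
  obtain Q i j p q where Q: "Q \<in> mod_cat A" and b: "biproduct A Q D M i j p q"
    using biproduct_exists[OF cat] by blast
  have h: "i \<in> lmod_hom A D Q" "j \<in> lmod_hom A M Q" "p \<in> lmod_hom A Q D" "q \<in> lmod_hom A Q M"
    and z: "\<And>x. x \<in> carrier D \<Longrightarrow> p (i x) = x \<and> q (i x) = \<zero>\<^bsub>M\<^esub>"
      "\<And>x. x \<in> carrier M \<Longrightarrow> p (j x) = \<zero>\<^bsub>D\<^esub> \<and> q (j x) = x"
    using b by (auto simp: biproduct_def)
  interpret D: left_module A D by (rule mod_catD[OF cat(1)])
  interpret M: left_module A M by (rule mod_catD[OF cat(2)])
  interpret Q: left_module A Q by (rule mod_catD[OF Q])
  have QT: "Q \<in> T" by (rule biproduct_closedD(2)[OF T D(1) M(1) Q b])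
  define n where "n = i d \<oplus>\<^bsub>Q\<^esub> j m"
  have c: "i d \<in> carrier Q" "j m \<in> carrier Q" using lmod_hom_closed[OF h(1) D(2)] lmod_hom_closed[OF h(2) M(2)] .
  then have n: "n \<in> carrier Q" by (simp add: n_def)
  have pn: "p n = d" "q n = m"
    using c z(1)[OF D(2)] z(2)[OF M(2)] D(2) M(2)
    by (simp_all add: n_def lmod_hom_add[OF h(3)] lmod_hom_add[OF h(4)])
  have "\<exists>p\<in>lmod_hom A Q D'. p n = d'" if "(D', d') \<in> insert a \<Psi>" for D' d'
  proof (cases "(D', d') = a")
    case True
    then show ?thesis using a pn(1) h(3) by blast
  next
    case False
    then obtain p' where "p' \<in> lmod_hom A M D'" "p' m = d'" using pr \<open>(D', d') \<in> insert a \<Psi>\<close> by blast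
    then show ?thesis using lmod_hom_comp[OF h(4), of p' D'] pn(2) by (intro bexI[of _ "p' \<circ> q"]) auto
  qed
  then show ?case using QT n by blast
qed

text \<open>Take for \<open>M\<close> one copy of \<open>G\<close> for each element of a finite
  \<open>K\<close>-spanning set of \<open>G\<close>, and for \<open>m\<close> the tuple of these
  elements. The images of \<open>m\<close> in \<open>Y\<close> are closed under addition, and
  scaling homomorphisms by \<open>K\<close> shows that they include every \<open>h g\<close>. The
  set has to span over \<open>K\<close> and not just over \<open>A\<close>, because multiplying a
  homomorphism by an element of \<open>A\<close> need not give a homomorphism.\<close>

lemma left_approx_generates:
  assumes G: "finite \<G>" "\<G> \<noteq> {}" "\<G> \<subseteq> T" and T: "biproduct_closed A T"
    and gen: "\<And>Y Z. Y \<in> T \<Longrightarrow> Z \<subseteq> carrier Y \<Longrightarrow> \<zero>\<^bsub>Y\<^esub> \<in> Z \<Longrightarrow> (\<forall>a\<in>Z. \<forall>b\<in>Z. a \<oplus>\<^bsub>Y\<^esub> b \<in> Z) \<Longrightarrow>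
      (\<And>G g h. G \<in> \<G> \<Longrightarrow> g \<in> carrier G \<Longrightarrow> h \<in> lmod_hom A G Y \<Longrightarrow> h g \<in> Z) \<Longrightarrow> carrier Y \<subseteq> Z"
  shows "\<exists>M m. left_approx A T M m"
proof -
  have cat: "T \<subseteq> mod_cat A" using T by (simp add: biproduct_closed_def)
  have "\<exists>F. finite F \<and> F \<noteq> {} \<and> F \<subseteq> carrier G \<and> carrier G = lspan K (restr_K G) F" if "G \<in> \<G>" for G
  proof -
    have Gc: "G \<in> mod_cat A" using that G(3) cat by blast
    interpret G: left_module A G by (rule mod_catD[OF Gc])
    interpret rG: left_module K "restr_K G" by (rule left_module_restr_K[OF G.is_lmod])
    obtain F where F: "finite F" "F \<subseteq> carrier (restr_K G)" "carrier (restr_K G) = lspan K (restr_K G) F"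
      using rG.finitely_generated_finite_length[OF finite_length_restr_K[OF Gc]]
        rG.finitely_generated_iff_lspan by blast
    \<comment> \<open>Zero is added so that every spanning set is nonempty, as
      \<open>pointed_product\<close> needs a nonempty family.\<close>
    let ?F = "insert \<zero>\<^bsub>G\<^esub> F"
    have f: "finite ?F" "?F \<subseteq> carrier (restr_K G)" using F by auto
    have "lspan K (restr_K G) F \<subseteq> lspan K (restr_K G) ?F"
      using rG.subset_lspan[OF f] by (intro rG.lspan_subset rG.submod_lspan f F) auto
    then have "carrier G = lspan K (restr_K G) ?F"
      using F rG.submod_subset[OF rG.submod_lspan[OF f]] by auto
    then show ?thesis using f by (intro exI[of _ ?F]) auto
  qed
  then obtain F where F: "\<And>G. G \<in> \<G> \<Longrightarrow> finite (F G) \<and> F G \<noteq> {} \<and> F G \<subseteq> carrier G \<and>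
      carrier G = lspan K (restr_K G) (F G)" by metis
  let ?\<Psi> = "SIGMA G:\<G>. F G"
  obtain G0 where "G0 \<in> \<G>" using G(2) by blast
  then have "finite ?\<Psi>" "?\<Psi> \<noteq> {}" using G F by blast+
  moreover have "D \<in> T \<and> d \<in> carrier D" if "(D, d) \<in> ?\<Psi>" for D d using that G(3) F by blast
  ultimately have "\<exists>M\<in>T. \<exists>m\<in>carrier M. \<forall>D d. (D, d) \<in> ?\<Psi> \<longrightarrow> (\<exists>p\<in>lmod_hom A M D. p m = d)"
    by (intro pointed_product[OF T]) auto
  then obtain M m where M: "M \<in> T" "m \<in> carrier M"
    and pr: "\<forall>D d. (D, d) \<in> ?\<Psi> \<longrightarrow> (\<exists>p\<in>lmod_hom A M D. p m = d)"
    by (elim bexE) (rule that)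
  have lM: "left_module A M" using M cat mod_catD by blast
  have "\<exists>h\<in>lmod_hom A M Y. h m = y" if Y: "Y \<in> T" "y \<in> carrier Y" for Y y
  proof -
    interpret Y: left_module A Y using Y cat mod_catD by blast
    define Z where "Z = (\<lambda>h. h m) ` lmod_hom A M Y"
    have Zc: "Z \<subseteq> carrier Y" unfolding Z_def by (rule image_subsetI) (rule lmod_hom_closed[OF _ M(2)])
    have Z0: "\<zero>\<^bsub>Y\<^esub> \<in> Z" using lmod_hom_const_zero[OF Y.is_lmod] by (force simp: Z_def)
    have Za: "\<forall>a\<in>Z. \<forall>b\<in>Z. a \<oplus>\<^bsub>Y\<^esub> b \<in> Z"
    proof (intro ballI)
      fix a b assume "a \<in> Z" "b \<in> Z"
      then obtain f g where "f \<in> lmod_hom A M Y" "g \<in> lmod_hom A M Y" "a = f m" "b = g m"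
        by (auto simp: Z_def)
      then show "a \<oplus>\<^bsub>Y\<^esub> b \<in> Z"
        using lmod_hom_sum[OF lM Y.is_lmod] by (auto simp: Z_def)
    qed
    have "h g \<in> Z" if h: "G \<in> \<G>" "g \<in> carrier G" "h \<in> lmod_hom A G Y" for G g h
    proof -
      interpret Gm: left_module A G using h G(3) cat mod_catD by blast
      interpret rG: left_module K "restr_K G" by (rule left_module_restr_K[OF Gm.is_lmod])
      \<comment> \<open>The elements of \<open>G\<close> all of whose images in \<open>Y\<close> are
        images of \<open>m\<close>. This is a \<open>K\<close>-subspace because a homomorphism can
        absorb a scalar.\<close>
      define W where "W = {g \<in> carrier G. \<forall>h\<in>lmod_hom A G Y. h g \<in> Z}"
      have "submod K (restr_K G) W"
        unfolding submod_def
      proof (intro conjI ballI)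
        show "\<zero>\<^bsub>restr_K G\<^esub> \<in> W"
          using Z0 lmod_hom_zero[OF Gm.is_lmod Y.is_lmod] by (auto simp: W_def)
        fix x assume x: "x \<in> W"
        show "x \<oplus>\<^bsub>restr_K G\<^esub> y \<in> W" if "y \<in> W" for y
          using x that Za by (auto simp: W_def lmod_hom_add)
        fix c assume c: "c \<in> carrier K"
        have "h (scal c \<odot>\<^bsub>G\<^esub> x) \<in> Z" if "h \<in> lmod_hom A G Y" for h
          using x c lmod_hom_scal[OF Y.is_lmod that c] lmod_hom_smult[OF that, of "scal c" x]
          by (auto simp: W_def)
        then show "c \<odot>\<^bsub>restr_K G\<^esub> x \<in> W" using x c by (auto simp: W_def)
      qed (auto simp: W_def)
      moreover have "F G \<subseteq> W"
      proof
        fix d assume d: "d \<in> F G"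
        then obtain p where p: "p \<in> lmod_hom A M G" "p m = d" using pr h(1) by blast
        have "h d \<in> Z" if "h \<in> lmod_hom A G Y" for h
          unfolding Z_def using lmod_hom_comp[OF p(1) that] p(2) by (intro image_eqI[of _ _ "h \<circ> p"]) auto
        then show "d \<in> W" using d F[OF h(1)] by (auto simp: W_def)
      qed
      ultimately have "carrier G \<subseteq> W" using rG.lspan_subset F[OF h(1)] by metis
      then show ?thesis using h by (auto simp: W_def)
    qed
    then have "y \<in> Z" using gen[OF Y(1) Zc Z0 Za] Y(2) by blast
    then show ?thesis by (auto simp: Z_def)
  qed
  then have "left_approx A T M m" using M by (simp add: left_approx_def)
  then show ?thesis by blast
qed

text \<open>
  The kernel of \<open>\<pi>\<close> lies in the torsion class: an element of it is the image of \<open>m\<close> under a map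
  \<open>M \<rightarrow> P\<close>, whose composition with \<open>\<pi>\<close> factors through \<open>C\<close>; subtracting a lift \<open>C \<rightarrow> P\<close> of that
  composition gives a map from \<open>M\<close> into the kernel with the same value at \<open>m\<close>.
\<close>

lemma left_approx_resolution:
  assumes S: "S \<subseteq> mod_cat A" and M: "left_approx A (Tors A S) M m" and Y: "Y \<in> Tors A S"
    and C: "C = quot_mod M ((\<lambda>a. a \<odot>\<^bsub>M\<^esub> m) ` carrier A)"
  shows "\<exists>P\<in>Tors A S. \<exists>\<pi>\<in>lmod_hom A P Y. \<pi> ` carrier P = carrier Y \<and>
    submod_on P (hker P Y \<pi>) \<in> Tors A S \<and>
    (\<forall>x\<in>carrier P. \<forall>Z. (\<forall>a\<in>Z. \<forall>b\<in>Z. a \<oplus>\<^bsub>Y\<^esub> b \<in> Z) \<longrightarrow>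
       (\<forall>D\<in>{M, C}. \<forall>h\<in>lmod_hom A D Y. \<forall>p\<in>lmod_hom A P D. h (p x) \<in> Z) \<longrightarrow> \<pi> x \<in> Z)"
proof -
  have MT: "M \<in> Tors A S" and m: "m \<in> carrier M"
    and ap: "\<And>Y y. Y \<in> Tors A S \<Longrightarrow> y \<in> carrier Y \<Longrightarrow> \<exists>h\<in>lmod_hom A M Y. h m = y"
    using M by (auto simp: left_approx_def)
  have Mc: "M \<in> mod_cat A" and Yc: "Y \<in> mod_cat A" using MT Y Tors_mod_cat by blast+
  interpret M: left_module A M by (rule mod_catD[OF Mc])
  interpret Y: left_module A Y by (rule mod_catD[OF Yc])
  define U where "U = (\<lambda>a. a \<odot>\<^bsub>M\<^esub> m) ` carrier A"
  have sU: "submod A M U" unfolding U_def by (rule M.submod_cyclic[OF m])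
  let ?q = "qrep M U"
  have C: "C = quot_mod M U" by (simp add: C U_def)
  have Cc: "C \<in> mod_cat A" and q: "?q \<in> lmod_hom A M C" "?q ` carrier M = carrier C"
    and qk: "hker M C ?q = U"
    unfolding C by (rule quot_mod_cat[OF Mc sU] M.lmod_hom_qrep[OF sU] M.qrep_surj[OF sU] M.hker_qrep[OF sU])+
  have CT: "C \<in> Tors A S" by (rule Tors_quotient[OF MT Cc q])
  interpret C: left_module A C by (rule mod_catD[OF Cc])
  have "m \<in> U" using M.smult_one[OF m] by (force simp: U_def)
  then have qm: "?q m = \<zero>\<^bsub>C\<^esub>" using qk by (auto simp: hker_def)
  let ?H = "Hom_K M Y"
  note lH = left_module_Hom_K[OF M.is_lmod Y.is_lmod]
  interpret H: left_module K ?H by (rule lH)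
  \<comment> \<open>The maps that kill \<open>m\<close>, that is, those factoring through
    \<open>C\<close>.\<close>
  define V where "V = {v \<in> carrier ?H. v m = \<zero>\<^bsub>Y\<^esub>}"
  have sV: "submod K ?H V"
    using submod_hker[OF lH left_module_restr_K[OF Y.is_lmod] Hom_K_eval[OF m]]
    by (simp add: V_def hker_def)
  interpret V: left_module K "submod_on ?H V" by (rule H.left_module_submod[OF sV])
  obtain F where F: "finite F" "F \<subseteq> V" "V = lspan K (submod_on ?H V) F"
    using V.finitely_generated_finite_length[OF finite_length_submod[OF lH sV finite_length_Hom_K[OF Mc Yc]]]
      V.finitely_generated_iff_lspan by auto
  have "\<exists>w\<in>lmod_hom A C Y. \<forall>x\<in>carrier M. w (?q x) = v x" if "v \<in> V" for v
  proof (rule lmod_hom_factor_surj[OF M.is_lmod C.is_lmod Y.is_lmod q])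
    show v: "v \<in> lmod_hom A M Y" using that by (simp add: V_def)
    fix x assume x: "x \<in> carrier M" "?q x = \<zero>\<^bsub>C\<^esub>"
    then have "x \<in> U" using qk by (auto simp: hker_def)
    then obtain a where "a \<in> carrier A" "x = a \<odot>\<^bsub>M\<^esub> m" by (auto simp: U_def)
    then show "v x = \<zero>\<^bsub>Y\<^esub>" using lmod_hom_smult[OF v _ m] that by (simp add: V_def)
  qed
  then obtain w where w: "\<And>v. v \<in> V \<Longrightarrow> w v \<in> lmod_hom A C Y"
    "\<And>v x. v \<in> V \<Longrightarrow> x \<in> carrier M \<Longrightarrow> w v (?q x) = v x" by metis
  obtain k where k: "\<And>y. y \<in> carrier Y \<Longrightarrow> k y \<in> lmod_hom A M Y" "\<And>y. y \<in> carrier Y \<Longrightarrow> k y m = y"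
    using ap[OF Y] by metis
  obtain G where G: "finite G" "G \<subseteq> carrier Y" "carrier Y = lspan A Y G"
    using Yc Y.finitely_generated_iff_lspan by (auto simp: mod_cat_def)
  \<comment> \<open>The maps \<open>k y\<close> make \<open>\<pi>\<close> surjective. The maps
    \<open>w v\<close> let the members of \<open>F\<close> lift along \<open>\<pi>\<close> to maps
    killing \<open>m\<close>; a \<open>K\<close>-spanning set is used because \<open>\<Phi>\<close>
    must be finite.\<close>
  define \<Phi> where "\<Phi> = (\<lambda>y. (M, k y)) ` insert \<zero>\<^bsub>Y\<^esub> G \<union> (\<lambda>v. (C, w v)) ` F"
  have \<Phi>: "D \<in> {M, C} \<and> h \<in> lmod_hom A D Y" if "(D, h) \<in> \<Phi>" for D h
    using that k(1) w(1) G(2) F(2) Y.M.zero_closed unfolding \<Phi>_def by blast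
  then have \<Phi>T: "\<forall>D h. (D, h) \<in> \<Phi> \<longrightarrow> D \<in> Tors A S \<and> h \<in> lmod_hom A D Y"
    using MT CT by blast
  have "finite \<Phi>" "\<Phi> \<noteq> {}" using F(1) G(1) by (auto simp: \<Phi>_def)
  from sum_of_homs[OF biproduct_closed_Tors[OF S] Yc this \<Phi>T]
  obtain P \<pi> where P: "P \<in> Tors A S" "\<pi> \<in> lmod_hom A P Y"
    and lift: "\<forall>D h. (D, h) \<in> \<Phi> \<longrightarrow> (\<exists>i\<in>lmod_hom A D P. \<forall>x\<in>carrier D. \<pi> (i x) = h x)"
    and gen: "\<forall>x\<in>carrier P. \<forall>Z. (\<forall>a\<in>Z. \<forall>b\<in>Z. a \<oplus>\<^bsub>Y\<^esub> b \<in> Z) \<longrightarrow>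
       (\<forall>D h. (D, h) \<in> \<Phi> \<longrightarrow> (\<forall>p\<in>lmod_hom A P D. h (p x) \<in> Z)) \<longrightarrow> \<pi> x \<in> Z"
    by (elim bexE conjE) (rule that)
  have Pc: "P \<in> mod_cat A" by (rule Tors_mod_cat[OF P(1)])
  interpret P: left_module A P by (rule mod_catD[OF Pc])
  have "G \<subseteq> \<pi> ` carrier P"
  proof
    fix y assume y: "y \<in> G"
    then have "(M, k y) \<in> \<Phi>" by (simp add: \<Phi>_def)
    from lift[rule_format, OF this] obtain i where i: "i \<in> lmod_hom A M P" "\<pi> (i m) = k y m" using m by blast
    have "k y m = y" using y G(2) k(2) by blast
    then show "y \<in> \<pi> ` carrier P" using i lmod_hom_closed[OF i(1) m] by (intro image_eqI[of _ _ "i m"]) auto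
  qed
  then have surj: "\<pi> ` carrier P = carrier Y" by (rule lmod_hom_onto[OF P.is_lmod Y.is_lmod P(2) G(1,3)])
  \<comment> \<open>Having a lift that kills \<open>m\<close> is preserved by sums and scalars, so
    it passes from \<open>F\<close> to all of \<open>V\<close>.\<close>
  define V' where "V' = {v \<in> V. \<exists>v'\<in>lmod_hom A M P. v' m = \<zero>\<^bsub>P\<^esub> \<and> (\<forall>x\<in>carrier M. \<pi> (v' x) = v x)}"
  have "submod K (submod_on ?H V) V'"
    unfolding submod_def
  proof (intro conjI ballI)
    show "\<zero>\<^bsub>submod_on ?H V\<^esub> \<in> V'"
      using V.M.zero_closed lmod_hom_const_zero[OF P.is_lmod]
        lmod_hom_zero[OF P.is_lmod Y.is_lmod P(2)]
      by (auto simp: V'_def intro!: bexI[of _ "\<lambda>x. \<zero>\<^bsub>P\<^esub>"])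
    fix v assume v: "v \<in> V'"
    then obtain v' where v': "v' \<in> lmod_hom A M P" "v' m = \<zero>\<^bsub>P\<^esub>" "\<And>x. x \<in> carrier M \<Longrightarrow> \<pi> (v' x) = v x"
      by (auto simp: V'_def)
    {
      fix u assume u: "u \<in> V'"
      then obtain u' where u': "u' \<in> lmod_hom A M P" "u' m = \<zero>\<^bsub>P\<^esub>" "\<And>x. x \<in> carrier M \<Longrightarrow> \<pi> (u' x) = u x"
        by (auto simp: V'_def)
      have "v \<oplus>\<^bsub>submod_on ?H V\<^esub> u \<in> V" using u v V.M.a_closed[of v u] by (simp add: V'_def)
      moreover have "\<pi> (v' x \<oplus>\<^bsub>P\<^esub> u' x) = (v \<oplus>\<^bsub>submod_on ?H V\<^esub> u) x" if "x \<in> carrier M" for x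
        using that v'(3) u'(3) lmod_hom_closed[OF v'(1)] lmod_hom_closed[OF u'(1)]
        by (simp add: lmod_hom_add[OF P(2)])
      ultimately show "v \<oplus>\<^bsub>submod_on ?H V\<^esub> u \<in> V'"
        using lmod_hom_sum[OF M.is_lmod P.is_lmod v'(1) u'(1)] v'(2) u'(2)
        unfolding V'_def by (intro CollectI conjI bexI[of _ "\<lambda>x. v' x \<oplus>\<^bsub>P\<^esub> u' x"]) auto
    }
    fix c assume c: "c \<in> carrier K"
    have "c \<odot>\<^bsub>submod_on ?H V\<^esub> v \<in> V" using v c V.smult_closed[of c v] by (simp add: V'_def)
    moreover have "\<pi> (scal c \<odot>\<^bsub>P\<^esub> v' x) = (c \<odot>\<^bsub>submod_on ?H V\<^esub> v) x" if "x \<in> carrier M" for x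
      using that v'(3) c lmod_hom_closed[OF v'(1)] by (simp add: lmod_hom_smult[OF P(2)])
    ultimately show "c \<odot>\<^bsub>submod_on ?H V\<^esub> v \<in> V'"
      using lmod_hom_scal[OF P.is_lmod v'(1) c] v'(2) c
      unfolding V'_def by (intro CollectI conjI bexI[of _ "\<lambda>x. scal c \<odot>\<^bsub>P\<^esub> v' x"]) auto
  qed (auto simp: V'_def)
  moreover have "F \<subseteq> V'"
  proof
    fix v assume v: "v \<in> F"
    then have "(C, w v) \<in> \<Phi>" by (simp add: \<Phi>_def)
    from lift[rule_format, OF this] obtain i where i: "i \<in> lmod_hom A C P" "\<And>x. x \<in> carrier C \<Longrightarrow> \<pi> (i x) = w v x"
      by blast
    have "\<pi> ((i \<circ> ?q) x) = v x" if "x \<in> carrier M" for x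
      using i(2)[OF lmod_hom_closed[OF q(1) that]] w(2)[OF _ that] v F(2) by auto
    moreover have "(i \<circ> ?q) m = \<zero>\<^bsub>P\<^esub>"
      using qm lmod_hom_zero[OF C.is_lmod P.is_lmod i(1)] by simp
    ultimately show "v \<in> V'"
      using v F(2) lmod_hom_comp[OF q(1) i(1)] unfolding V'_def by blast
  qed
  ultimately have "V \<subseteq> V'" using V.lspan_subset[OF _ F(1)] F(3) by simp
  let ?L = "hker P Y \<pi>"
  note sL = submod_hker[OF P.is_lmod Y.is_lmod P(2)]
  have "\<phi> l = \<zero>\<^bsub>B\<^esub>" if B: "B \<in> S" "\<phi> \<in> lmod_hom A (submod_on P ?L) B" "l \<in> ?L" for B \<phi> l
  proof -
    have l: "l \<in> carrier P" "\<pi> l = \<zero>\<^bsub>Y\<^esub>" using B(3) by (auto simp: hker_def)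
    obtain h where h: "h \<in> lmod_hom A M P" "h m = l" using ap[OF P(1) l(1)] by blast
    have "restrict (\<pi> \<circ> h) (carrier M) \<in> V"
      using lmod_hom_comp[OF h(1) P(2)] l h m by (simp add: V_def restrict_lmod_hom[OF M.is_lmod])
    then obtain v' where v': "v' \<in> lmod_hom A M P" "v' m = \<zero>\<^bsub>P\<^esub>" "\<And>x. x \<in> carrier M \<Longrightarrow> \<pi> (v' x) = \<pi> (h x)"
      using \<open>V \<subseteq> V'\<close> by (fastforce simp: V'_def)
    define f where "f x = h x \<ominus>\<^bsub>P\<^esub> v' x" for x
    have f: "f \<in> lmod_hom A M P"
      unfolding f_def by (rule lmod_hom_diff[OF M.is_lmod P.is_lmod h(1) v'(1)])
    have "\<pi> (f x) = \<zero>\<^bsub>Y\<^esub>" if x: "x \<in> carrier M" for x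
    proof -
      have c: "h x \<in> carrier P" "v' x \<in> carrier P" "\<pi> (h x) \<in> carrier Y"
        using lmod_hom_closed[OF h(1) x] lmod_hom_closed[OF v'(1) x] lmod_hom_closed[OF P(2)] by auto
      then show ?thesis
        using lmod_hom_minus[OF P.is_lmod Y.is_lmod P(2) c(1,2)] v'(3)[OF x]
        by (simp add: f_def a_minus_def Y.M.r_neg)
    qed
    then have fL: "f \<in> lmod_hom A M (submod_on P ?L)"
      using lmod_hom_closed[OF f] by (intro lmod_hom_submod_cod[OF f]) (auto simp: hker_def)
    have "f m = l"
      using h(2) v'(2) l(1) P.M.add.inv_one by (simp add: f_def a_minus_def)
    then show ?thesis using TorsD[OF MT B(1) lmod_hom_comp[OF fL B(2)] m] by simp
  qed
  then have kerT: "submod_on P ?L \<in> Tors A S"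
    using submod_mod_cat[OF Pc sL] by (auto simp: Tors_def)
  have genZ: "\<pi> x \<in> Z" if "x \<in> carrier P" "\<forall>a\<in>Z. \<forall>b\<in>Z. a \<oplus>\<^bsub>Y\<^esub> b \<in> Z"
    "\<forall>D\<in>{M, C}. \<forall>h\<in>lmod_hom A D Y. \<forall>p\<in>lmod_hom A P D. h (p x) \<in> Z" for x Z
    using gen[THEN bspec, THEN spec, THEN mp, THEN mp, OF that(1,2)] that(3) \<Phi> by blast
  show ?thesis
    by (intro bexI[OF _ P(1)] bexI[OF _ P(2)] conjI surj kerT) (use genZ in blast)
qed

end

context brick_mutation
begin

text \<open>For \<open>Y\<close> torsion for \<open>S'\<close>, resolve \<open>Y\<close> by
  \<open>P\<close>, divide \<open>P\<close> by its torsion submodule \<open>t P\<close> for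
  \<open>S'\<close> and then by the image of the kernel of \<open>\<pi>\<close>. The result
  \<open>?R\<close> is torsion-free for \<open>S'\<close> and a quotient of \<open>Y\<close>, hence
  zero. So \<open>P\<close> is the sum of \<open>t P\<close> and the kernel, and \<open>t P\<close>
  maps onto \<open>Y\<close>. Maps from \<open>P\<close> to \<open>M\<close> or \<open>C\<close>
  carry \<open>t P\<close> into the torsion submodules of these, whose images therefore generate
  \<open>Y\<close>.\<close>

lemma left_approx_step:
  assumes M: "left_approx A (Tors A S) M m"
  shows "\<exists>M' m'. left_approx A (Tors A S') M' m'"
proof -
  define C where "C = quot_mod M ((\<lambda>a. a \<odot>\<^bsub>M\<^esub> m) ` carrier A)"
  have MT: "M \<in> Tors A S" and m: "m \<in> carrier M" using M by (auto simp: left_approx_def)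
  have Mc: "M \<in> mod_cat A" using MT Tors_mod_cat by blast
  interpret M: left_module A M by (rule mod_catD[OF Mc])
  have Cc: "C \<in> mod_cat A" unfolding C_def by (rule quot_mod_cat[OF Mc M.submod_cyclic[OF m]])
  obtain t where t: "\<And>D. D \<in> mod_cat A \<Longrightarrow> submod A D (t D)"
    "\<And>D. D \<in> mod_cat A \<Longrightarrow> submod_on D (t D) \<in> Tors A S'"
    "\<And>D. D \<in> mod_cat A \<Longrightarrow> quot_mod D (t D) \<in> Free A S'"
    using torsion_submodule[OF S_mod_cat(2)] by metis
  show ?thesis
  proof (rule left_approx_generates[of "{submod_on M (t M), submod_on C (t C)}"])
    show "{submod_on M (t M), submod_on C (t C)} \<subseteq> Tors A S'" using t(2) Mc Cc by simp
    show "biproduct_closed A (Tors A S')" by (rule biproduct_closed_Tors[OF S_mod_cat(2)])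
    fix Y Z
    assume Y: "Y \<in> Tors A S'" and Z: "\<forall>a\<in>Z. \<forall>b\<in>Z. a \<oplus>\<^bsub>Y\<^esub> b \<in> Z"
      and gZ: "\<And>G g h. G \<in> {submod_on M (t M), submod_on C (t C)} \<Longrightarrow> g \<in> carrier G \<Longrightarrow> h \<in> lmod_hom A G Y \<Longrightarrow> h g \<in> Z"
    have hZ: "h g \<in> Z" if "D \<in> {M, C}" "g \<in> t D" "h \<in> lmod_hom A (submod_on D (t D)) Y" for D g h
      using that by (intro gZ[of "submod_on D (t D)"]) auto
    have YS: "Y \<in> Tors A S" using Y Tors_S' by blast
    have Yc: "Y \<in> mod_cat A" by (rule Tors_mod_cat[OF Y])
    from left_approx_resolution[OF S_mod_cat(1) M YS C_def]
    obtain P \<pi> where P: "P \<in> Tors A S" "\<pi> \<in> lmod_hom A P Y" "\<pi> ` carrier P = carrier Y"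
      "submod_on P (hker P Y \<pi>) \<in> Tors A S"
      and gen: "\<forall>x\<in>carrier P. \<forall>Z. (\<forall>a\<in>Z. \<forall>b\<in>Z. a \<oplus>\<^bsub>Y\<^esub> b \<in> Z) \<longrightarrow>
         (\<forall>D\<in>{M, C}. \<forall>h\<in>lmod_hom A D Y. \<forall>p\<in>lmod_hom A P D. h (p x) \<in> Z) \<longrightarrow> \<pi> x \<in> Z"
      by (elim bexE conjE) (rule that)
    have Pc: "P \<in> mod_cat A" by (rule Tors_mod_cat[OF P(1)])
    interpret P: left_module A P by (rule mod_catD[OF Pc])
    interpret Y: left_module A Y by (rule mod_catD[OF Yc])
    let ?L = "hker P Y \<pi>"
    note sL = submod_hker[OF P.is_lmod Y.is_lmod P(2)]
    note sU = t(1)[OF Pc] and tU = t(2)[OF Pc] and fU = t(3)[OF Pc]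
    let ?N = "quot_mod P (t P)" and ?q = "qrep P (t P)"
    note Nc = quot_mod_cat[OF Pc sU] and q = P.lmod_hom_qrep[OF sU] and qs = P.qrep_surj[OF sU]
      and qk = P.hker_qrep[OF sU]
    interpret N: left_module A ?N by (rule mod_catD[OF Nc])
    have NT: "?N \<in> Tors A S" by (rule Tors_quotient[OF P(1) Nc q qs])
    let ?I = "?q ` ?L"
    have sI: "submod A ?N ?I" by (rule submod_image[OF P.is_lmod N.is_lmod q sL])
    have "?q \<in> lmod_hom A (submod_on P ?L) (submod_on ?N ?I)"
      using lmod_hom_submod_dom[OF q P.submod_subset[OF sL]] by (rule lmod_hom_submod_cod) auto
    then have IT: "submod_on ?N ?I \<in> Tors A S"
      using submod_mod_cat[OF Nc sI] by (intro Tors_quotient[OF P(4)]) auto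
    let ?R = "quot_mod ?N ?I" and ?r = "qrep ?N ?I"
    note Rc = quot_mod_cat[OF Nc sI] and r = N.lmod_hom_qrep[OF sI] and rs = N.qrep_surj[OF sI]
      and rk = N.hker_qrep[OF sI]
    interpret R: left_module A ?R by (rule mod_catD[OF Rc])
    \<comment> \<open>The kernel of \<open>?r\<close> is an image of the kernel of
      \<open>\<pi>\<close>; that the latter lies in \<open>Tors A S\<close> is what the resolution
      was built for.\<close>
    have RF: "?R \<in> Free A S'"
      using IT rk by (intro quotient_in_Free[OF NT fU Rc r rs]) simp
    have rq: "?r \<circ> ?q \<in> lmod_hom A P ?R" by (rule lmod_hom_comp[OF q r])
    have "(?r \<circ> ?q) x = \<zero>\<^bsub>?R\<^esub>" if "x \<in> carrier P" "\<pi> x = \<zero>\<^bsub>Y\<^esub>" for x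
    proof -
      have "?q x \<in> hker ?N ?R ?r" using that rk by (auto simp: hker_def[of P])
      then show ?thesis by (simp add: hker_def)
    qed
    then obtain g where g: "g \<in> lmod_hom A Y ?R" "\<And>x. x \<in> carrier P \<Longrightarrow> g (\<pi> x) = (?r \<circ> ?q) x"
      using lmod_hom_factor_surj[OF P.is_lmod Y.is_lmod R.is_lmod P(2,3) rq]
      by blast
    \<comment> \<open>As \<open>g\<close> is zero, \<open>x\<close> agrees modulo \<open>t P\<close>
      with an element of the kernel of \<open>\<pi>\<close>; subtracting it does not change
      \<open>\<pi> x\<close>.\<close>
    have surjU: "\<exists>u\<in>t P. \<pi> u = \<pi> x" if x: "x \<in> carrier P" for x
    proof -
      have "g (\<pi> x) = \<zero>\<^bsub>?R\<^esub>" by (rule FreeD[OF RF Y g(1) lmod_hom_closed[OF P(2) x]])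
      then have "?q x \<in> hker ?N ?R ?r"
        using g(2)[OF x] lmod_hom_closed[OF q x] by (simp add: hker_def)
      then obtain l where l: "l \<in> ?L" "?q x = ?q l" using rk by auto
      have lc: "l \<in> carrier P" "\<pi> l = \<zero>\<^bsub>Y\<^esub>" using l(1) by (auto simp: hker_def)
      have "?q (x \<ominus>\<^bsub>P\<^esub> l) = \<zero>\<^bsub>?N\<^esub>"
        using lmod_hom_minus[OF P.is_lmod N.is_lmod q x lc(1)] l(2)
          lmod_hom_closed[OF q lc(1)] N.M.r_neg by (simp add: a_minus_def)
      then have "x \<ominus>\<^bsub>P\<^esub> l \<in> hker P ?N ?q" using x lc by (simp add: hker_def)
      then have "x \<ominus>\<^bsub>P\<^esub> l \<in> t P" by (simp only: qk)
      moreover have "\<pi> (x \<ominus>\<^bsub>P\<^esub> l) = \<pi> x"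
        using lmod_hom_minus[OF P.is_lmod Y.is_lmod P(2) x lc(1)] lc(2)
          lmod_hom_closed[OF P(2) x] Y.M.add.inv_one by (simp add: a_minus_def)
      ultimately show ?thesis by blast
    qed
    show "carrier Y \<subseteq> Z"
    proof
      fix y assume "y \<in> carrier Y"
      then obtain u where u: "u \<in> t P" "y = \<pi> u" using P(3) surjU by (metis imageE)
      have uc: "u \<in> carrier P" using u(1) P.submod_subset[OF sU] by blast
      have "\<pi> u \<in> Z"
      proof (rule gen[THEN bspec, THEN spec, THEN mp, THEN mp, OF uc Z], intro ballI)
        fix D h p assume D: "D \<in> {M, C}" "h \<in> lmod_hom A D Y" "p \<in> lmod_hom A P D"
        have Dc: "D \<in> mod_cat A" using D(1) Mc Cc by blast
        interpret D: left_module A D by (rule mod_catD[OF Dc])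
        note sD = t(1)[OF Dc]
        \<comment> \<open>A map from the torsion module \<open>t P\<close> to the torsion-free
          quotient of \<open>D\<close> is zero, so \<open>p\<close> sends \<open>t P\<close> into
          \<open>t D\<close>.\<close>
        have "(qrep D (t D) \<circ> p) u = \<zero>\<^bsub>quot_mod D (t D)\<^esub>"
          using u(1)
          by (intro FreeD[OF t(3)[OF Dc] tU
                lmod_hom_submod_dom[OF lmod_hom_comp[OF D(3) D.lmod_hom_qrep[OF sD]] P.submod_subset[OF sU]]])
            simp
        then have "p u \<in> hker D (quot_mod D (t D)) (qrep D (t D))"
          using lmod_hom_closed[OF D(3) uc] by (simp add: hker_def)
        then have "p u \<in> t D" by (simp only: D.hker_qrep[OF sD])
        then show "h (p u) \<in> Z"
          using hZ[OF D(1)] lmod_hom_submod_dom[OF D(2) D.submod_subset[OF sD]] by blast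
      qed
      then show "y \<in> Z" using u(2) by simp
    qed
  qed auto
qed

end

context brick_reps
begin

text \<open>Induction on the size of \<open>S\<close>. For empty \<open>S\<close> every module is
  torsion, and the regular module with its generator is an approximation.\<close>

lemma left_approx_exists:
  assumes ac: "acyclic arrows" and S: "pred_closed S"
  shows "\<exists>M m. left_approx A (Tors A S) M m"
  using S
proof (induction "card S" arbitrary: S rule: less_induct)
  case less
  have fin: "finite S" using less.prems finite_reps finite_subset by (auto simp: pred_closed_def)
  show ?case
  proof (cases "S = {}")
    case True
    obtain R r where R: "projective A R" "r \<in> carrier R"
      "\<And>M x. M \<in> mod_cat A \<Longrightarrow> x \<in> carrier M \<Longrightarrow> \<exists>h\<in>lmod_hom A R M. h r = x"
      using projective_regular_exists by metis
    then have "left_approx A (Tors A S) R r"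
      using True by (auto simp: left_approx_def Tors_def projective_def)
    then show ?thesis by blast
  next
    case False
    have "finite arrows"
      by (rule finite_subset[OF _ finite_cartesian_product[OF finite_reps finite_reps]]) (auto simp: arrows_def)
    \<comment> \<open>Well-foundedness of the converse provides a sink \<open>X\<close> of the
      arrows within \<open>S\<close>; removing a sink keeps \<open>S\<close> closed under
      predecessors.\<close>
    then have "wf (arrows\<inverse>)" using ac by (rule finite_acyclic_wf_converse)
    then obtain X where X: "X \<in> S" "\<And>B. (X, B) \<in> arrows \<Longrightarrow> B \<notin> S"
      using False by (metis converse_iff ex_in_conv wfE_min)
    have "pred_closed (S - {X})" using less.prems X by (auto simp: pred_closed_def)
    moreover have e: "insert X (S - {X}) = S" using X(1) by blast
    moreover have "card (S - {X}) < card S" using fin X(1) by (rule card_Diff1_less)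
    ultimately obtain M m where M: "left_approx A (Tors A (S - {X})) M m" using less.hyps by blast
    interpret brick_mutation K A Rp "S - {X}" X
      using \<open>pred_closed (S - {X})\<close> less.prems e by unfold_locales auto
    show ?thesis using left_approx_step[OF M] e by simp
  qed
qed

end

section \<open>Minimal approximations and presentations\<close>

context fin_dim_algebra
begin

text \<open>The regular module is mapped to \<open>M\<close> once for each generator, by a map that
  hits it; the sum of these maps is onto.\<close>

lemma projective_onto_exists:
  assumes M: "M \<in> mod_cat A"
  shows "\<exists>P p. projective A P \<and> p \<in> lmod_hom A P M \<and> p ` carrier P = carrier M"
proof -
  interpret M: left_module A M by (rule mod_catD[OF M])
  obtain R r where R: "projective A R" "r \<in> carrier R"
    "\<And>M x. M \<in> mod_cat A \<Longrightarrow> x \<in> carrier M \<Longrightarrow> \<exists>h\<in>lmod_hom A R M. h r = x"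
    using projective_regular_exists by metis
  obtain k where k: "\<And>y. y \<in> carrier M \<Longrightarrow> k y \<in> lmod_hom A R M" "\<And>y. y \<in> carrier M \<Longrightarrow> k y r = y"
    using R(3)[OF M] by metis
  obtain G where G: "finite G" "G \<subseteq> carrier M" "carrier M = lspan A M G"
    using M M.finitely_generated_iff_lspan by (auto simp: mod_cat_def)
  define \<Phi> where "\<Phi> = (\<lambda>y. (R, k y)) ` insert \<zero>\<^bsub>M\<^esub> G"
  have \<Phi>: "\<forall>D h. (D, h) \<in> \<Phi> \<longrightarrow> D \<in> {P. projective A P} \<and> h \<in> lmod_hom A D M"
    using R(1) k(1) G(2) by (auto simp: \<Phi>_def)
  have "finite \<Phi>" "\<Phi> \<noteq> {}" using G by (auto simp: \<Phi>_def)
  from sum_of_homs[OF biproduct_closed_projective M this \<Phi>]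
  obtain P p where P: "P \<in> {P. projective A P}" "p \<in> lmod_hom A P M"
    and lift: "\<forall>D h. (D, h) \<in> \<Phi> \<longrightarrow> (\<exists>i\<in>lmod_hom A D P. \<forall>x\<in>carrier D. p (i x) = h x)"
    by (elim bexE conjE) (rule that)
  have Pc: "P \<in> mod_cat A" using P(1) by (simp add: projective_def)
  interpret P: left_module A P by (rule mod_catD[OF Pc])
  have "G \<subseteq> p ` carrier P"
  proof
    fix y assume y: "y \<in> G"
    then have "(R, k y) \<in> \<Phi>" by (simp add: \<Phi>_def)
    from lift[rule_format, OF this] obtain i where i: "i \<in> lmod_hom A R P" "p (i r) = k y r" using R(2) by blast
    have "k y r = y" using y G(2) k(2) by blast
    then show "y \<in> p ` carrier P" using i lmod_hom_closed[OF i(1) R(2)] by (intro image_eqI[of _ _ "i r"]) auto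
  qed
  then have "p ` carrier P = carrier M" by (rule lmod_hom_onto[OF P.is_lmod M.is_lmod P(2) G(1,3)])
  then show ?thesis using P by blast
qed

text \<open>Take an approximation of least length. The image of an endomorphism fixing
  \<open>m\<close> is again an approximation, so the endomorphism is surjective and hence
  bijective.\<close>

lemma left_approx_minimal:
  assumes S: "S \<subseteq> mod_cat A" and ex: "\<exists>M m. left_approx A (Tors A S) M m"
  shows "\<exists>M m. left_approx A (Tors A S) M m \<and>
    (\<forall>u\<in>lmod_hom A M M. u m = m \<longrightarrow> u \<in> lmod_iso A M M)"
proof -
  obtain M m where M: "left_approx A (Tors A S) M m"
    and min: "\<And>M' m'. left_approx A (Tors A S) M' m' \<Longrightarrow> len A M \<le> len A M'"
    using ex_has_least_nat[of "\<lambda>M. \<exists>m. left_approx A (Tors A S) M m" _ "len A"] ex by metis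
  have MT: "M \<in> Tors A S" and m: "m \<in> carrier M"
    and ap: "\<And>Y y. Y \<in> Tors A S \<Longrightarrow> y \<in> carrier Y \<Longrightarrow> \<exists>h\<in>lmod_hom A M Y. h m = y"
    using M by (auto simp: left_approx_def)
  note Mc = Tors_mod_cat[OF MT]
  interpret M: left_module A M by (rule mod_catD[OF Mc])
  have fl: "finite_length A M" using Mc by (simp add: mod_cat_iff)
  have "u \<in> lmod_iso A M M" if u: "u \<in> lmod_hom A M M" "u m = m" for u
  proof -
    define I where "I = u ` carrier M"
    have sI: "submod A M I"
      unfolding I_def by (rule submod_image[OF M.is_lmod M.is_lmod u(1) M.submod_carrier])
    have "submod_on M I \<in> Tors A S"
      using submod_mod_cat[OF Mc sI] lmod_hom_submod_cod[OF u(1), of I] I_def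
      by (intro Tors_quotient[OF MT]) auto
    moreover have "m \<in> I" using u(2) m by (force simp: I_def)
    moreover have "\<exists>h\<in>lmod_hom A (submod_on M I) Y. h m = y" if "Y \<in> Tors A S" "y \<in> carrier Y" for Y y
      using ap[OF that] lmod_hom_submod_dom[OF _ M.submod_subset[OF sI]] by blast
    ultimately have "left_approx A (Tors A S) (submod_on M I) m" by (simp add: left_approx_def)
    from min[OF this] have "I = carrier M"
      using len_submod_less[OF M.is_lmod sI fl] by fastforce
    then show ?thesis
      using u(1) surj_endo_inj[OF M.is_lmod u(1) _ fl]
      by (simp add: I_def lmod_iso_def bij_betw_def)
  qed
  then show ?thesis using M by blast
qed

text \<open>
  Among the endomorphisms over \<open>N\<close> with image in \<open>L\<close> one with minimal image is bijective on its image,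
  so the latter is a direct summand of \<open>P\<close>.
\<close>

lemma projective_cover_exists:
  assumes N: "N \<in> mod_cat A"
  shows "\<exists>P p. projective A P \<and> p \<in> lmod_hom A P N \<and> p ` carrier P = carrier N \<and>
    (\<forall>L. submod A P L \<and> p ` L = carrier N \<longrightarrow> L = carrier P)"
proof -
  define Q where "Q P \<longleftrightarrow> (\<exists>p. projective A P \<and> p \<in> lmod_hom A P N \<and> p ` carrier P = carrier N)" for P
  have "\<exists>P. Q P" using projective_onto_exists[OF N] by (auto simp: Q_def)
  then obtain P where "Q P" and min: "\<And>P'. Q P' \<Longrightarrow> len A P \<le> len A P'"
    using ex_has_least_nat[of Q _ "len A"] by metis
  then obtain p where P: "projective A P" and p: "p \<in> lmod_hom A P N" "p ` carrier P = carrier N"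
    by (auto simp: Q_def)
  have Pc: "P \<in> mod_cat A" using P by (simp add: projective_def)
  interpret P: left_module A P by (rule mod_catD[OF Pc])
  have fl: "finite_length A P" using Pc by (simp add: mod_cat_iff)
  have "L = carrier P" if L: "submod A P L" "p ` L = carrier N" for L
  proof -
    note Lc = P.submod_subset[OF L(1)]
    define H where "H h \<longleftrightarrow> h \<in> lmod_hom A P P \<and> h ` carrier P \<subseteq> L \<and> (\<forall>x\<in>carrier P. p (h x) = p x)" for h
    \<comment> \<open>Lifting \<open>p\<close> along its restriction to \<open>L\<close> gives an
      endomorphism over \<open>N\<close> with image in \<open>L\<close>.\<close>
    obtain h0 where h0: "h0 \<in> lmod_hom A P (submod_on P L)" "\<forall>x\<in>carrier P. p (h0 x) = p x"
      using projective_lift[OF P submod_mod_cat[OF Pc L(1)] N lmod_hom_submod_dom[OF p(1) Lc] _ p(1)] L(2) by auto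
    have "H h0"
      unfolding H_def using lmod_hom_submod_codD[OF h0(1) Lc] h0(2) lmod_hom_closed[OF h0(1)] by auto
    then obtain h where "H h" and hmin: "\<And>h'. H h' \<Longrightarrow>
        len A (submod_on P (h ` carrier P)) \<le> len A (submod_on P (h' ` carrier P))"
      using ex_has_least_nat[of H h0 "\<lambda>h. len A (submod_on P (h ` carrier P))"] by blast
    then have h: "h \<in> lmod_hom A P P" "h ` carrier P \<subseteq> L" "\<And>x. x \<in> carrier P \<Longrightarrow> p (h x) = p x"
      by (auto simp: H_def)
    define I where "I = h ` carrier P"
    let ?I = "submod_on P I"
    have sI: "submod A P I"
      unfolding I_def by (rule submod_image[OF P.is_lmod P.is_lmod h(1) P.submod_carrier])
    note Ic = submod_mod_cat[OF Pc sI]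
    interpret I: left_module A ?I by (rule mod_catD[OF Ic])
    have flI: "finite_length A ?I" using Ic by (simp add: mod_cat_iff)
    have hI: "h \<in> lmod_hom A ?I ?I" and hPI: "h \<in> lmod_hom A P ?I"
      using lmod_hom_submod_cod[OF h(1), of I] P.submod_subset[OF sI]
      by (auto simp: I_def intro: lmod_hom_submod_dom)
    \<comment> \<open>Squaring cannot shrink a minimal image, so \<open>h\<close> maps
      \<open>I\<close> onto itself.\<close>
    have "H (h \<circ> h)"
      using lmod_hom_comp[OF h(1,1)] h(2,3) lmod_hom_closed[OF h(1)] by (auto simp: H_def)
    from hmin[OF this] have "len A ?I \<le> len A (submod_on P (h ` I))" by (simp add: I_def image_comp)
    moreover have "submod A ?I (h ` I)"
      using submod_image[OF I.is_lmod I.is_lmod hI I.submod_carrier] by simp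
    ultimately have hs: "h ` I = I"
      using len_submod_less[OF I.is_lmod _ flI, of "h ` I"] by fastforce
    then have "h \<in> lmod_iso A ?I ?I"
      using hI surj_endo_inj[OF I.is_lmod hI _ flI] by (simp add: lmod_iso_def bij_betw_def)
    from lmod_hom_inv_into[OF this I.is_lmod I.is_lmod]
    obtain u where u: "u \<in> lmod_hom A ?I ?I" "\<And>x. x \<in> I \<Longrightarrow> u (h x) = x" by auto
    have incl: "(\<lambda>x. x) \<in> lmod_hom A ?I P" by (rule lmod_hom_submod_incl[OF P.submod_subset[OF sI]])
    \<comment> \<open>\<open>u \<circ> h\<close> is a retraction of \<open>P\<close> onto
      \<open>I\<close>, so lifting problems on \<open>I\<close> are solved on
      \<open>P\<close>.\<close>
    have "\<exists>k\<in>lmod_hom A ?I X. \<forall>x\<in>carrier ?I. g (k x) = f x"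
      if X: "X \<in> mod_cat A" "Y \<in> mod_cat A" "g \<in> lmod_hom A X Y" "f \<in> lmod_hom A ?I Y"
        "g ` carrier X = carrier Y" for X Y g f
    proof -
      from projective_lift[OF P X(1,2,3,5) lmod_hom_comp[OF lmod_hom_comp[OF hPI u(1)] X(4)]]
      obtain k where k: "k \<in> lmod_hom A P X" "\<forall>x\<in>carrier P. g (k x) = (f \<circ> (u \<circ> h)) x"
        by (elim bexE) (rule that)
      have "g (k x) = f x" if "x \<in> carrier ?I" for x
        using k(2) that P.submod_subset[OF sI] u(2) by auto
      then show ?thesis
        by (intro bexI[OF _ lmod_hom_submod_dom[OF k(1) P.submod_subset[OF sI]]] ballI)
    qed
    then have "projective A ?I" using Ic by (simp add: projective_def)
    moreover have "p ` carrier ?I = carrier N"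
      unfolding p(2)[symmetric] using h(3) by (auto simp: I_def image_image)
    ultimately have "Q ?I"
      using lmod_hom_submod_dom[OF p(1) P.submod_subset[OF sI]] by (auto simp: Q_def)
    from min[OF this] have "I = carrier P"
      using len_submod_less[OF P.is_lmod sI fl] by fastforce
    then show ?thesis using h(2) Lc by (auto simp: I_def)
  qed
  then show ?thesis using P p by blast
qed

text \<open>\<open>E\<close> is the direct sum of \<open>P\<close> and \<open>Y\<close> modulo the
  pairs \<open>(d x, - g x)\<close>. The listed properties present it as an extension of the
  cokernel of \<open>d\<close> by a quotient of \<open>Y\<close>.\<close>

lemma pushout_exists:
  assumes cat: "Q \<in> mod_cat A" "P \<in> mod_cat A" "Y \<in> mod_cat A"
    and d: "d \<in> lmod_hom A Q P" and g: "g \<in> lmod_hom A Q Y"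
  shows "\<exists>E\<in>mod_cat A. \<exists>i\<in>lmod_hom A Y E. \<exists>j\<in>lmod_hom A P E.
    (\<forall>x\<in>carrier Q. j (d x) = i (g x)) \<and>
    (\<forall>e\<in>carrier E. \<exists>x\<in>carrier P. \<exists>y\<in>carrier Y. e = j x \<oplus>\<^bsub>E\<^esub> i y) \<and>
    (\<forall>y\<in>carrier Y. i y = \<zero>\<^bsub>E\<^esub> \<longrightarrow> (\<exists>x\<in>carrier Q. d x = \<zero>\<^bsub>P\<^esub> \<and> y = g x)) \<and>
    (\<forall>N\<in>mod_cat A. \<forall>u\<in>lmod_hom A P N. (\<forall>x\<in>carrier Q. u (d x) = \<zero>\<^bsub>N\<^esub>) \<longrightarrow>
       (\<exists>v\<in>lmod_hom A E N. (\<forall>x\<in>carrier P. v (j x) = u x) \<and> (\<forall>y\<in>carrier Y. v (i y) = \<zero>\<^bsub>N\<^esub>)))"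
proof -
  interpret Q: left_module A Q by (rule mod_catD[OF cat(1)])
  interpret P: left_module A P by (rule mod_catD[OF cat(2)])
  interpret Y: left_module A Y by (rule mod_catD[OF cat(3)])
  obtain B a b pa pb where B: "B \<in> mod_cat A" and bp: "biproduct A B P Y a b pa pb"
    using biproduct_exists[OF cat(2,3)] by blast
  have h: "a \<in> lmod_hom A P B" "b \<in> lmod_hom A Y B" "pa \<in> lmod_hom A B P" "pb \<in> lmod_hom A B Y"
    and z: "\<And>x. x \<in> carrier P \<Longrightarrow> pa (a x) = x \<and> pb (a x) = \<zero>\<^bsub>Y\<^esub>"
      "\<And>y. y \<in> carrier Y \<Longrightarrow> pa (b y) = \<zero>\<^bsub>P\<^esub> \<and> pb (b y) = y"
    and sum: "\<And>w. w \<in> carrier B \<Longrightarrow> w = a (pa w) \<oplus>\<^bsub>B\<^esub> b (pb w)"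
    using bp by (auto simp: biproduct_def)
  interpret B: left_module A B by (rule mod_catD[OF B])
  define f where "f x = (a \<circ> d) x \<ominus>\<^bsub>B\<^esub> (b \<circ> g) x" for x
  have f: "f \<in> lmod_hom A Q B"
    unfolding f_def[abs_def]
    by (rule lmod_hom_diff[OF Q.is_lmod B.is_lmod lmod_hom_comp[OF d h(1)] lmod_hom_comp[OF g h(2)]])
  have dc: "d x \<in> carrier P" and gc: "g x \<in> carrier Y" if "x \<in> carrier Q" for x
    using lmod_hom_closed[OF d that] lmod_hom_closed[OF g that] .
  have ac: "a x \<in> carrier B" if "x \<in> carrier P" for x using lmod_hom_closed[OF h(1) that] .
  have bc: "b x \<in> carrier B" if "x \<in> carrier Y" for x using lmod_hom_closed[OF h(2) that] .
  have paf: "pa (f x) = d x" and pbf: "pb (f x) = \<ominus>\<^bsub>Y\<^esub> g x" if x: "x \<in> carrier Q" for x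
    using z(1)[OF dc[OF x]] z(2)[OF gc[OF x]] dc[OF x] gc[OF x] P.M.add.inv_one
      lmod_hom_minus[OF B.is_lmod P.is_lmod h(3) ac[OF dc[OF x]] bc[OF gc[OF x]]]
      lmod_hom_minus[OF B.is_lmod Y.is_lmod h(4) ac[OF dc[OF x]] bc[OF gc[OF x]]]
    by (simp_all add: f_def a_minus_def)
  define U where "U = f ` carrier Q"
  have sU: "submod A B U"
    unfolding U_def by (rule submod_image[OF Q.is_lmod B.is_lmod f Q.submod_carrier])
  define E where "E = quot_mod B U"
  define q where "q = qrep B U"
  have E: "E \<in> mod_cat A" and q: "q \<in> lmod_hom A B E" "q ` carrier B = carrier E" and qk: "hker B E q = U"
    unfolding E_def q_def
    by (rule quot_mod_cat[OF B sU] B.lmod_hom_qrep[OF sU] B.qrep_surj[OF sU] B.hker_qrep[OF sU])+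
  interpret E: left_module A E by (rule mod_catD[OF E])
  have q0: "q w = \<zero>\<^bsub>E\<^esub> \<longleftrightarrow> w \<in> U" if "w \<in> carrier B" for w
    using qk that by (auto simp: hker_def)
  have i: "q \<circ> b \<in> lmod_hom A Y E" by (rule lmod_hom_comp[OF h(2) q(1)])
  have j: "q \<circ> a \<in> lmod_hom A P E" by (rule lmod_hom_comp[OF h(1) q(1)])
  have p1: "(q \<circ> a) (d x) = (q \<circ> b) (g x)" if x: "x \<in> carrier Q" for x
  proof -
    have c: "q (a (d x)) \<in> carrier E" "q (b (g x)) \<in> carrier E"
      by (rule lmod_hom_closed[OF q(1) ac[OF dc[OF x]]] lmod_hom_closed[OF q(1) bc[OF gc[OF x]]])+
    have "q (f x) = \<zero>\<^bsub>E\<^esub>" using q0[OF lmod_hom_closed[OF f x]] x by (simp add: U_def)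
    then have "q (a (d x)) \<ominus>\<^bsub>E\<^esub> q (b (g x)) = \<zero>\<^bsub>E\<^esub>"
      using lmod_hom_minus[OF B.is_lmod E.is_lmod q(1) ac[OF dc[OF x]] bc[OF gc[OF x]]]
      by (simp add: f_def)
    then have "q (a (d x)) = \<ominus>\<^bsub>E\<^esub> (\<ominus>\<^bsub>E\<^esub> q (b (g x)))"
      using c by (intro E.M.minus_equality[symmetric]) (auto simp: a_minus_def)
    then show ?thesis using c by simp
  qed
  have p2: "\<exists>x\<in>carrier P. \<exists>y\<in>carrier Y. e = (q \<circ> a) x \<oplus>\<^bsub>E\<^esub> (q \<circ> b) y" if e: "e \<in> carrier E" for e
  proof -
    obtain w where w: "w \<in> carrier B" "e = q w" using e q(2) by (metis imageE)
    have c: "pa w \<in> carrier P" "pb w \<in> carrier Y"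
      by (rule lmod_hom_closed[OF h(3) w(1)] lmod_hom_closed[OF h(4) w(1)])+
    have "q w = q (a (pa w)) \<oplus>\<^bsub>E\<^esub> q (b (pb w))"
      using arg_cong[OF sum[OF w(1)], of q] lmod_hom_add[OF q(1) ac[OF c(1)] bc[OF c(2)]] by (rule trans)
    then show ?thesis using c w(2) by (intro bexI[of _ "pa w"] bexI[of _ "pb w"]) auto
  qed
  have p3: "\<exists>x\<in>carrier Q. d x = \<zero>\<^bsub>P\<^esub> \<and> y = g x" if y: "y \<in> carrier Y" "(q \<circ> b) y = \<zero>\<^bsub>E\<^esub>" for y
  proof -
    have "b y \<in> U" using q0[OF bc[OF y(1)]] y(2) by simp
    then obtain x where x: "x \<in> carrier Q" "b y = f x" by (auto simp: U_def)
    have "d x = \<zero>\<^bsub>P\<^esub>" using paf[OF x(1)] z(2)[OF y(1)] x(2) by simp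
    moreover have "y = \<ominus>\<^bsub>Y\<^esub> g x" using pbf[OF x(1)] z(2)[OF y(1)] x(2) by simp
    then have "y = g (\<ominus>\<^bsub>Q\<^esub> x)"
      using lmod_hom_uminus[OF Q.is_lmod Y.is_lmod g x(1)] by simp
    moreover have "d (\<ominus>\<^bsub>Q\<^esub> x) = \<zero>\<^bsub>P\<^esub>"
      using lmod_hom_uminus[OF Q.is_lmod P.is_lmod d x(1)] \<open>d x = \<zero>\<^bsub>P\<^esub>\<close> P.M.add.inv_one
      by simp
    ultimately show ?thesis using x(1) by (intro bexI[of _ "\<ominus>\<^bsub>Q\<^esub> x"]) auto
  qed
  have p4: "\<exists>v\<in>lmod_hom A E N. (\<forall>x\<in>carrier P. v ((q \<circ> a) x) = u x) \<and> (\<forall>y\<in>carrier Y. v ((q \<circ> b) y) = \<zero>\<^bsub>N\<^esub>)"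
    if N: "N \<in> mod_cat A" and u: "u \<in> lmod_hom A P N" "\<forall>x\<in>carrier Q. u (d x) = \<zero>\<^bsub>N\<^esub>" for N u
  proof -
    interpret N: left_module A N by (rule mod_catD[OF N])
    have "(u \<circ> pa) w = \<zero>\<^bsub>N\<^esub>" if w: "w \<in> carrier B" "q w = \<zero>\<^bsub>E\<^esub>" for w
    proof -
      have "w \<in> U" using q0[OF w(1)] w(2) by simp
      then obtain x where "x \<in> carrier Q" "w = f x" by (auto simp: U_def)
      then show ?thesis using paf u(2) by simp
    qed
    then obtain v where v: "v \<in> lmod_hom A E N" "\<And>w. w \<in> carrier B \<Longrightarrow> v (q w) = (u \<circ> pa) w"
      using lmod_hom_factor_surj[OF B.is_lmod E.is_lmod N.is_lmod q
          lmod_hom_comp[OF h(3) u(1)]] by blast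
    have "v (q (a x)) = u x" if "x \<in> carrier P" for x using v(2)[OF ac[OF that]] z(1)[OF that] by simp
    moreover have "v (q (b y)) = \<zero>\<^bsub>N\<^esub>" if "y \<in> carrier Y" for y
      using v(2)[OF bc[OF that]] z(2)[OF that] lmod_hom_zero[OF P.is_lmod N.is_lmod u(1)]
      by simp
    ultimately show ?thesis using v(1) by (intro bexI[OF _ v(1)]) auto
  qed
  show ?thesis
    by (intro bexI[OF _ E] bexI[OF _ i] bexI[OF _ j] conjI ballI impI; rule p1 p2 p3 p4; assumption)
qed

text \<open>
  A minimal approximation is Ext-projective: the pushout of a presentation of \<open>M\<close> along \<open>g\<close> is an
  extension of \<open>M\<close> which splits. Hence \<open>g\<close> extends up to a map whose image is already the image of
  the kernel of the presentation, and such a map vanishes by minimality of the presentation.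
\<close>

lemma presentation_surj:
  assumes S: "S \<subseteq> mod_cat A" and M: "left_approx A (Tors A S) M m"
    and min: "\<And>u. u \<in> lmod_hom A M M \<Longrightarrow> u m = m \<Longrightarrow> u \<in> lmod_iso A M M"
    and P: "projective A P" "p \<in> lmod_hom A P M" "p ` carrier P = carrier M"
    and Q: "Q \<in> mod_cat A" "d \<in> lmod_hom A Q P" "d ` carrier Q = hker P M p"
    and Qmin: "\<And>L. submod A Q L \<Longrightarrow> d ` L = hker P M p \<Longrightarrow> L = carrier Q"
    and Y: "Y \<in> Tors A S" and g: "g \<in> lmod_hom A Q Y"
  shows "\<exists>h\<in>lmod_hom A P Y. \<forall>x\<in>carrier Q. h (d x) = g x"
proof -
  have MT: "M \<in> Tors A S" and m: "m \<in> carrier M"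
    and ap: "\<And>Y y. Y \<in> Tors A S \<Longrightarrow> y \<in> carrier Y \<Longrightarrow> \<exists>h\<in>lmod_hom A M Y. h m = y"
    using M by (auto simp: left_approx_def)
  have Mc: "M \<in> mod_cat A" and Yc: "Y \<in> mod_cat A" and Pc: "P \<in> mod_cat A"
    using Tors_mod_cat[OF MT] Tors_mod_cat[OF Y] P(1) by (simp_all add: projective_def)
  interpret M: left_module A M by (rule mod_catD[OF Mc])
  interpret Y: left_module A Y by (rule mod_catD[OF Yc])
  interpret P: left_module A P by (rule mod_catD[OF Pc])
  interpret Q: left_module A Q by (rule mod_catD[OF Q(1)])
  from pushout_exists[OF Q(1) Pc Yc Q(2) g]
  obtain E i j where E: "E \<in> mod_cat A" and i: "i \<in> lmod_hom A Y E" and j: "j \<in> lmod_hom A P E"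
    and comm: "\<forall>x\<in>carrier Q. j (d x) = i (g x)"
    and gen: "\<forall>e\<in>carrier E. \<exists>x\<in>carrier P. \<exists>y\<in>carrier Y. e = j x \<oplus>\<^bsub>E\<^esub> i y"
    and keri: "\<forall>y\<in>carrier Y. i y = \<zero>\<^bsub>E\<^esub> \<longrightarrow> (\<exists>x\<in>carrier Q. d x = \<zero>\<^bsub>P\<^esub> \<and> y = g x)"
    and univ: "\<forall>N\<in>mod_cat A. \<forall>u\<in>lmod_hom A P N. (\<forall>x\<in>carrier Q. u (d x) = \<zero>\<^bsub>N\<^esub>) \<longrightarrow>
       (\<exists>v\<in>lmod_hom A E N. (\<forall>x\<in>carrier P. v (j x) = u x) \<and> (\<forall>y\<in>carrier Y. v (i y) = \<zero>\<^bsub>N\<^esub>))"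
    by (elim bexE conjE) (rule that)
  interpret E: left_module A E by (rule mod_catD[OF E])
  have ic: "i y \<in> carrier E" if "y \<in> carrier Y" for y using lmod_hom_closed[OF i that] .
  have jc: "j x \<in> carrier E" if "x \<in> carrier P" for x using lmod_hom_closed[OF j that] .
  have pd: "p (d x) = \<zero>\<^bsub>M\<^esub>" if "x \<in> carrier Q" for x
  proof -
    have "d x \<in> hker P M p" using that Q(3) by blast
    then show ?thesis by (simp add: hker_def)
  qed
  have dx: "\<exists>z\<in>carrier Q. x = d z" if "x \<in> carrier P" "p x = \<zero>\<^bsub>M\<^esub>" for x
  proof -
    have "x \<in> d ` carrier Q" unfolding Q(3) using that by (simp add: hker_def)
    then show ?thesis by blast
  qed
  have "\<forall>x\<in>carrier Q. p (d x) = \<zero>\<^bsub>M\<^esub>" using pd by blast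
  from univ[THEN bspec, THEN bspec, THEN mp, OF Mc P(2) this]
  obtain \<pi> where \<pi>: "\<pi> \<in> lmod_hom A E M" "\<And>x. x \<in> carrier P \<Longrightarrow> \<pi> (j x) = p x"
    "\<And>y. y \<in> carrier Y \<Longrightarrow> \<pi> (i y) = \<zero>\<^bsub>M\<^esub>"
    by (elim bexE conjE) (rule that, assumption, simp_all)
  \<comment> \<open>\<open>E\<close> is an extension of \<open>M\<close> by the image of
    \<open>Y\<close>. The argument runs on elements, as \<open>i\<close> may fail to be
    injective.\<close>
  have ET: "E \<in> Tors A S"
    unfolding Tors_def
  proof (intro CollectI conjI ballI)
    fix B f e assume B: "B \<in> S" "f \<in> lmod_hom A E B" "e \<in> carrier E"
    interpret B: left_module A B using S B(1) mod_catD by blast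
    have fi: "f (i y) = \<zero>\<^bsub>B\<^esub>" if "y \<in> carrier Y" for y
      using TorsD[OF Y B(1) lmod_hom_comp[OF i B(2)] that] by simp
    have "(f \<circ> j) x = \<zero>\<^bsub>B\<^esub>" if x: "x \<in> carrier P" "p x = \<zero>\<^bsub>M\<^esub>" for x
    proof -
      obtain z where "z \<in> carrier Q" "x = d z" using dx[OF x] by blast
      then show ?thesis using comm fi lmod_hom_closed[OF g] by simp
    qed
    then obtain k where k: "k \<in> lmod_hom A M B" "\<And>x. x \<in> carrier P \<Longrightarrow> k (p x) = (f \<circ> j) x"
      using lmod_hom_factor_surj[OF P.is_lmod M.is_lmod B.is_lmod P(2,3)
          lmod_hom_comp[OF j B(2)]] by blast
    have fj: "f (j x) = \<zero>\<^bsub>B\<^esub>" if "x \<in> carrier P" for x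
      using k(2)[OF that] TorsD[OF MT B(1) k(1) lmod_hom_closed[OF P(2) that]] by simp
    obtain x y where "x \<in> carrier P" "y \<in> carrier Y" "e = j x \<oplus>\<^bsub>E\<^esub> i y" using gen B(3) by blast
    then show "f e = \<zero>\<^bsub>B\<^esub>" using fi fj ic jc by (simp add: lmod_hom_add[OF B(2)])
  qed (rule E)
  obtain x0 where x0: "x0 \<in> carrier P" "p x0 = m" using m P(3) by (metis imageE)
  \<comment> \<open>The approximation yields a map sending \<open>m\<close> to the preimage
    \<open>j x0\<close> of \<open>m\<close> under \<open>\<pi>\<close>. Minimality makes
    \<open>\<pi> \<circ> s0\<close> an automorphism, and correcting by its inverse gives a section
    of \<open>\<pi>\<close>.\<close>
  obtain s0 where s0: "s0 \<in> lmod_hom A M E" "s0 m = j x0" using ap[OF ET jc[OF x0(1)]] by blast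
  have "\<pi> \<circ> s0 \<in> lmod_iso A M M"
    using min[OF lmod_hom_comp[OF s0(1) \<pi>(1)]] s0(2) \<pi>(2)[OF x0(1)] x0(2) by simp
  from lmod_hom_inv_into[OF this M.is_lmod M.is_lmod]
  obtain u where u: "u \<in> lmod_hom A M M" "\<And>x. x \<in> carrier M \<Longrightarrow> \<pi> (s0 (u x)) = x" by auto
  define s where "s = s0 \<circ> u"
  have s: "s \<in> lmod_hom A M E" unfolding s_def by (rule lmod_hom_comp[OF u(1) s0(1)])
  have \<pi>s: "\<pi> (s x) = x" if "x \<in> carrier M" for x using u(2)[OF that] by (simp add: s_def)
  \<comment> \<open>\<open>\<pi>\<close> kills the values of \<open>r\<close>, which therefore lie
    in the image of \<open>i\<close>; projectivity of \<open>P\<close> lifts \<open>r\<close>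
    through \<open>i\<close>.\<close>
  define r where "r x = j x \<ominus>\<^bsub>E\<^esub> (s \<circ> p) x" for x
  have r: "r \<in> lmod_hom A P E"
    unfolding r_def[abs_def]
    by (rule lmod_hom_diff[OF P.is_lmod E.is_lmod j lmod_hom_comp[OF P(2) s]])
  have sc: "s (p x) \<in> carrier E" if "x \<in> carrier P" for x
    using lmod_hom_closed[OF s lmod_hom_closed[OF P(2) that]] .
  define I where "I = i ` carrier Y"
  have sI: "submod A E I"
    unfolding I_def by (rule submod_image[OF Y.is_lmod E.is_lmod i Y.submod_carrier])
  have rI: "r x \<in> I" if x: "x \<in> carrier P" for x
  proof -
    obtain x' y where xy: "x' \<in> carrier P" "y \<in> carrier Y" "r x = j x' \<oplus>\<^bsub>E\<^esub> i y"
      using gen lmod_hom_closed[OF r x] by blast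
    have px: "p x \<in> carrier M" "p x' \<in> carrier M" by (rule lmod_hom_closed[OF P(2) x] lmod_hom_closed[OF P(2) xy(1)])+
    have "\<pi> (r x) = \<zero>\<^bsub>M\<^esub>"
      using lmod_hom_minus[OF E.is_lmod M.is_lmod \<pi>(1) jc[OF x] sc[OF x]]
        \<pi>(2)[OF x] \<pi>s[OF px(1)] px(1) M.M.r_neg by (simp add: r_def a_minus_def)
    moreover have "\<pi> (r x) = p x'"
      unfolding xy(3) using lmod_hom_add[OF \<pi>(1) jc[OF xy(1)] ic[OF xy(2)]] \<pi>(2)[OF xy(1)] \<pi>(3)[OF xy(2)] px(2)
      by simp
    ultimately obtain z where z: "z \<in> carrier Q" "x' = d z" using dx[OF xy(1)] by auto
    have "j x' = i (g z)" using comm z by simp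
    then have "r x = i (g z \<oplus>\<^bsub>Y\<^esub> y)"
      using xy(3) lmod_hom_add[OF i lmod_hom_closed[OF g z(1)] xy(2)] by simp
    then show ?thesis using lmod_hom_closed[OF g z(1)] xy(2) by (simp add: I_def)
  qed
  have rI': "r \<in> lmod_hom A P (submod_on E I)" using rI by (intro lmod_hom_submod_cod[OF r]) auto
  have iI: "i \<in> lmod_hom A Y (submod_on E I)" by (rule lmod_hom_submod_cod[OF i]) (simp add: I_def)
  obtain h where h: "h \<in> lmod_hom A P Y" "\<And>x. x \<in> carrier P \<Longrightarrow> i (h x) = r x"
    using projective_lift[OF P(1) Yc submod_mod_cat[OF E sI] iI _ rI'] by (auto simp: I_def)
  \<comment> \<open>\<open>f\<close> measures the failure of \<open>h\<close> to extend
    \<open>g\<close> along \<open>d\<close>. Each of its values is already taken on the kernel of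
    \<open>d\<close>.\<close>
  define f where "f x = g x \<ominus>\<^bsub>Y\<^esub> (h \<circ> d) x" for x
  have f: "f \<in> lmod_hom A Q Y"
    unfolding f_def[abs_def]
    by (rule lmod_hom_diff[OF Q.is_lmod Y.is_lmod g lmod_hom_comp[OF Q(2) h(1)]])
  have hd: "h (d x) \<in> carrier Y" if "x \<in> carrier Q" for x
    using lmod_hom_closed[OF h(1) lmod_hom_closed[OF Q(2) that]] .
  have "\<exists>z\<in>carrier Q. d z = \<zero>\<^bsub>P\<^esub> \<and> f x = f z" if x: "x \<in> carrier Q" for x
  proof -
    have c: "d x \<in> carrier P" "g x \<in> carrier Y" by (rule lmod_hom_closed[OF Q(2) x] lmod_hom_closed[OF g x])+
    have "i (h (d x)) = j (d x)"
      using h(2)[OF c(1)] pd[OF x] lmod_hom_zero[OF M.is_lmod E.is_lmod s] jc[OF c(1)]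
        E.M.add.inv_one by (simp add: r_def a_minus_def)
    then have "i (f x) = \<zero>\<^bsub>E\<^esub>"
      using lmod_hom_minus[OF Y.is_lmod E.is_lmod i c(2) hd[OF x]] comm x ic[OF c(2)] E.M.r_neg
      by (simp add: f_def a_minus_def)
    then obtain z where z: "z \<in> carrier Q" "d z = \<zero>\<^bsub>P\<^esub>" "f x = g z"
      using keri lmod_hom_closed[OF f x] by blast
    have "f z = g z"
      using z(2) lmod_hom_zero[OF P.is_lmod Y.is_lmod h(1)] lmod_hom_closed[OF g z(1)]
        Y.M.add.inv_one by (simp add: f_def a_minus_def)
    then show ?thesis using z by auto
  qed
  then have fd: "\<exists>z\<in>carrier Q. d z = d x \<and> f z = \<zero>\<^bsub>Y\<^esub>" if x: "x \<in> carrier Q" for x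
  proof -
    obtain z where z: "z \<in> carrier Q" "d z = \<zero>\<^bsub>P\<^esub>" "f x = f z"
      using \<open>\<And>x. x \<in> carrier Q \<Longrightarrow> \<exists>z\<in>carrier Q. d z = \<zero>\<^bsub>P\<^esub> \<and> f x = f z\<close>[OF x] by blast
    have "d (x \<ominus>\<^bsub>Q\<^esub> z) = d x"
      using lmod_hom_minus[OF Q.is_lmod P.is_lmod Q(2) x z(1)] z(2)
        lmod_hom_closed[OF Q(2) x] P.M.add.inv_one by (simp add: a_minus_def)
    moreover have "f (x \<ominus>\<^bsub>Q\<^esub> z) = \<zero>\<^bsub>Y\<^esub>"
      using lmod_hom_minus[OF Q.is_lmod Y.is_lmod f x z(1)] z(3)
        lmod_hom_closed[OF f z(1)] Y.M.r_neg by (simp add: a_minus_def)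
    ultimately show ?thesis using x z(1) by (intro bexI[of _ "x \<ominus>\<^bsub>Q\<^esub> z"]) auto
  qed
  \<comment> \<open>Subtracting from \<open>x\<close> an element of the kernel of \<open>d\<close>
    with the same value under \<open>f\<close> moves \<open>x\<close> into the kernel of
    \<open>f\<close>; minimality of \<open>Q\<close> then forces \<open>f\<close> to be
    zero.\<close>
  have "d ` hker Q Y f = d ` carrier Q"
  proof (intro equalityI subsetI)
    fix y assume "y \<in> d ` carrier Q"
    then obtain x where "x \<in> carrier Q" "y = d x" by blast
    then obtain z where "z \<in> carrier Q" "d z = y" "f z = \<zero>\<^bsub>Y\<^esub>" using fd by metis
    then show "y \<in> d ` hker Q Y f" by (auto simp: hker_def)
  qed (auto simp: hker_def)
  then have "hker Q Y f = carrier Q"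
    using Qmin[OF submod_hker[OF Q.is_lmod Y.is_lmod f]] Q(3) by simp
  then have f0: "f x = \<zero>\<^bsub>Y\<^esub>" if "x \<in> carrier Q" for x using that by (auto simp: hker_def)
  have "h (d x) = g x" if x: "x \<in> carrier Q" for x
  proof -
    have "g x = \<ominus>\<^bsub>Y\<^esub> (\<ominus>\<^bsub>Y\<^esub> h (d x))"
      using f0[OF x] lmod_hom_closed[OF g x] hd[OF x]
      by (intro Y.M.minus_equality[symmetric]) (auto simp: f_def a_minus_def)
    then show ?thesis using hd[OF x] by simp
  qed
  then show ?thesis using h(1) by blast
qed

lemma dim_vector_Tors_Free:
  assumes S: "S \<subseteq> mod_cat A" and ex: "\<exists>M m. left_approx A (Tors A S) M m"
    and X: "X \<in> Free A S" and Y: "Y \<in> Tors A S" and nz: "\<exists>y\<in>carrier Y. y \<noteq> \<zero>\<^bsub>Y\<^esub>"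
  shows "dim_vector A X \<noteq> dim_vector A Y"
proof
  assume eq: "dim_vector A X = dim_vector A Y"
  obtain M m where M: "left_approx A (Tors A S) M m"
    and min: "\<And>u. u \<in> lmod_hom A M M \<Longrightarrow> u m = m \<Longrightarrow> u \<in> lmod_iso A M M"
    using left_approx_minimal[OF S ex] by blast
  have MT: "M \<in> Tors A S" and m: "m \<in> carrier M"
    and ap: "\<And>Y y. Y \<in> Tors A S \<Longrightarrow> y \<in> carrier Y \<Longrightarrow> \<exists>h\<in>lmod_hom A M Y. h m = y"
    using M by (auto simp: left_approx_def)
  have Mc: "M \<in> mod_cat A" and Yc: "Y \<in> mod_cat A" and Xc: "X \<in> mod_cat A"
    using Tors_mod_cat[OF MT] Tors_mod_cat[OF Y] Free_mod_cat[OF X] .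
  interpret M: left_module A M by (rule mod_catD[OF Mc])
  interpret Y: left_module A Y by (rule mod_catD[OF Yc])
  interpret X: left_module A X by (rule mod_catD[OF Xc])
  obtain P p where P: "projective A P" "p \<in> lmod_hom A P M" "p ` carrier P = carrier M"
    using projective_onto_exists[OF Mc] by blast
  have Pc: "P \<in> mod_cat A" using P(1) by (simp add: projective_def)
  interpret P: left_module A P by (rule mod_catD[OF Pc])
  note sk = submod_hker[OF P.is_lmod M.is_lmod P(2)]
  obtain Q d where Q: "projective A Q" "d \<in> lmod_hom A Q (submod_on P (hker P M p))"
    "d ` carrier Q = hker P M p" and Qmin: "\<And>L. submod A Q L \<Longrightarrow> d ` L = hker P M p \<Longrightarrow> L = carrier Q"
    using projective_cover_exists[OF submod_mod_cat[OF Pc sk]] by auto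
  have Qc: "Q \<in> mod_cat A" using Q(1) by (simp add: projective_def)
  interpret Q: left_module A Q by (rule mod_catD[OF Qc])
  have d: "d \<in> lmod_hom A Q P" by (rule lmod_hom_submod_codD[OF Q(2) P.submod_subset[OF sk]])
  have pd: "p (d x) = \<zero>\<^bsub>M\<^esub>" if "x \<in> carrier Q" for x
  proof -
    have "d x \<in> hker P M p" using that Q(3) by blast
    then show ?thesis by (simp add: hker_def)
  qed
  let ?D = "\<lambda>f. restrict (f \<circ> d) (carrier Q)"
  have D: "?D \<in> lmod_hom K (Hom_K P Z) (Hom_K Q Z)" for Z :: "('a, 'a list) module"
    by (rule Hom_K_precomp[OF Q.is_lmod d])
  have HP: "left_module K (Hom_K P Z)" and HQ: "left_module K (Hom_K Q Z)"
    and fP: "finite_length K (Hom_K P Z)" and fQ: "finite_length K (Hom_K Q Z)"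
    if "Z \<in> mod_cat A" for Z :: "('a, 'a list) module"
    using that Pc Qc by (auto intro!: left_module_Hom_K finite_length_Hom_K mod_catD)

  \<comment> \<open>Precomposition with \<open>d\<close> is onto by \<open>presentation_surj\<close>
    and kills \<open>h \<circ> p\<close>, which is nonzero because \<open>h m\<close> is the nonzero
    element \<open>y\<close>.\<close>
  have "len K (Hom_K Q Y) < len K (Hom_K P Y)"
  proof -
    obtain y where y: "y \<in> carrier Y" "y \<noteq> \<zero>\<^bsub>Y\<^esub>" using nz by blast
    obtain h where h: "h \<in> lmod_hom A M Y" "h m = y" using ap[OF Y y(1)] by blast
    obtain x0 where x0: "x0 \<in> carrier P" "p x0 = m" using m P(3) by (metis imageE)
    let ?k = "restrict (h \<circ> p) (carrier P)"
    have "?k \<in> carrier (Hom_K P Y)"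
      using lmod_hom_comp[OF P(2) h(1)] by (simp add: restrict_lmod_hom[OF P.is_lmod])
    moreover have "?D ?k = \<zero>\<^bsub>Hom_K Q Y\<^esub>"
      using pd lmod_hom_closed[OF d] lmod_hom_zero[OF M.is_lmod Y.is_lmod h(1)]
      by (auto intro!: restrict_ext)
    moreover have "?k \<noteq> \<zero>\<^bsub>Hom_K P Y\<^esub>"
    proof
      assume "?k = \<zero>\<^bsub>Hom_K P Y\<^esub>"
      then have "?k x0 = \<zero>\<^bsub>Hom_K P Y\<^esub> x0" by simp
      then show False using x0 h y by simp
    qed
    moreover have "?D ` carrier (Hom_K P Y) = carrier (Hom_K Q Y)"
    proof (intro equalityI subsetI)
      fix g assume "g \<in> carrier (Hom_K Q Y)"
      then have g: "g \<in> lmod_hom A Q Y" "g \<in> extensional (carrier Q)" by auto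
      obtain k where k: "k \<in> lmod_hom A P Y" "\<And>x. x \<in> carrier Q \<Longrightarrow> k (d x) = g x"
        using presentation_surj[OF S M min P Qc d Q(3) Qmin Y g(1)] by blast
      have "g = ?D (restrict k (carrier P))"
        using k(2) g(2) lmod_hom_closed[OF d] by (auto intro!: extensionalityI[of _ "carrier Q"])
      moreover have "restrict k (carrier P) \<in> carrier (Hom_K P Y)"
        using k(1) by (simp add: restrict_lmod_hom[OF P.is_lmod])
      ultimately show "g \<in> ?D ` carrier (Hom_K P Y)" by blast
    qed (use lmod_hom_closed[OF D] in auto)
    ultimately show ?thesis
      using len_surj_less[OF HP[OF Yc] HQ[OF Yc] D _ fP[OF Yc], of ?k] by blast
  qed
  \<comment> \<open>A map from \<open>P\<close> to \<open>X\<close> that vanishes on the image of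
    \<open>d\<close> factors through \<open>M\<close>, and \<open>M\<close> has no nonzero map to
    \<open>X\<close>.\<close>
  moreover have "len K (Hom_K P X) \<le> len K (Hom_K Q X)"
  proof (rule len_inj_le[OF HP[OF Xc] HQ[OF Xc] D _ fQ[OF Xc]])
    have "f = \<zero>\<^bsub>Hom_K P X\<^esub>" if "f \<in> hker (Hom_K P X) (Hom_K Q X) ?D" for f
    proof -
      have f: "f \<in> lmod_hom A P X" "f \<in> extensional (carrier P)" "?D f = \<zero>\<^bsub>Hom_K Q X\<^esub>"
        using that by (auto simp: hker_def)
      have fd: "f (d x) = \<zero>\<^bsub>X\<^esub>" if "x \<in> carrier Q" for x
        using fun_cong[OF f(3), of x] that by simp
      have "f x = \<zero>\<^bsub>X\<^esub>" if "x \<in> carrier P" "p x = \<zero>\<^bsub>M\<^esub>" for x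
      proof -
        have "x \<in> d ` carrier Q" unfolding Q(3) using that by (simp add: hker_def)
        then show ?thesis using fd by blast
      qed
      then obtain k where k: "k \<in> lmod_hom A M X" "\<And>x. x \<in> carrier P \<Longrightarrow> k (p x) = f x"
        using lmod_hom_factor_surj[OF P.is_lmod M.is_lmod X.is_lmod P(2,3) f(1)]
        by blast
      have "f x = \<zero>\<^bsub>X\<^esub>" if "x \<in> carrier P" for x
        using k(2)[OF that] FreeD[OF X MT k(1) lmod_hom_closed[OF P(2) that]] by simp
      then show ?thesis using f(2) by (auto intro!: extensionalityI[of _ "carrier P"])
    qed
    then have "hker (Hom_K P X) (Hom_K Q X) ?D = {\<zero>\<^bsub>Hom_K P X\<^esub>}"
      using left_module.submod_zero[OF HP[OF Xc] submod_hker[OF HP[OF Xc] HQ[OF Xc] D]] by blast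
    then show "inj_on ?D (carrier (Hom_K P X))" using inj_on_iff_hker[OF HP[OF Xc] HQ[OF Xc] D] by simp
  qed
  \<comment> \<open>Both terms of \<open>\<theta>\<close> are additive, so equal dimension vectors
    would make the two inequalities contradict each other.\<close>
  moreover have "int (len K (Hom_K Z X)) = int (len K (Hom_K Z Y))" if Z: "projective A Z" for Z
    using len_Hom_K_exact[OF Z] by (intro additive_dim_vector[OF _ eq]) simp
  then have "len K (Hom_K P X) = len K (Hom_K P Y)" "len K (Hom_K Q X) = len K (Hom_K Q Y)"
    using P(1) Q(1) by (simp_all only: of_nat_eq_iff)
  ultimately show False by simp
qed

end

section \<open>Brick-directed algebras\<close>

lemma lmod_isomorphic_refl: "lmod_isomorphic A M M"
  using lmod_hom_id[of A M]
  by (auto simp: lmod_isomorphic_def lmod_iso_def bij_betw_def intro!: exI[of _ "\<lambda>x. x"])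

lemma lmod_isomorphic_sym:
  assumes "left_module A M" "left_module A N" "lmod_isomorphic A M N"
  shows "lmod_isomorphic A N M"
proof -
  obtain f where f: "f \<in> lmod_iso A M N" using assms(3) by (auto simp: lmod_isomorphic_def)
  obtain g where g: "g \<in> lmod_hom A N M" "\<forall>x\<in>carrier M. g (f x) = x" "\<forall>y\<in>carrier N. f (g y) = y"
    using lmod_hom_inv_into[OF f assms(1,2)] by blast
  have "bij_betw g (carrier N) (carrier M)"
    by (rule bij_betw_byWitness[where f' = f]) (use f g in \<open>auto simp: lmod_iso_def lmod_hom_def\<close>)
  then show ?thesis using g(1) by (auto simp: lmod_isomorphic_def lmod_iso_def)
qed

lemma lmod_isomorphic_trans: "lmod_isomorphic A L M \<Longrightarrow> lmod_isomorphic A M N \<Longrightarrow> lmod_isomorphic A L N"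
  using lmod_hom_comp bij_betw_trans by (fastforce simp: lmod_isomorphic_def lmod_iso_def)

text \<open>A closed path of arrows consists of nonzero maps between distinct, hence non-isomorphic,
  representatives, so no map in it is invertible and it is a brick-cycle.\<close>

lemma (in brick_reps) acyclic_arrows:
  assumes dir: "brick_directed A"
    and uniq: "\<And>B B'. B \<in> Rp \<Longrightarrow> B' \<in> Rp \<Longrightarrow> lmod_isomorphic A B B' \<Longrightarrow> B = B'"
  shows "acyclic arrows"
proof (rule acyclicI, intro allI notI)
  fix B assume "(B, B) \<in> arrows\<^sup>+"
  then obtain n X where n: "n > 0" "X 0 = B" "X n = B" "\<And>i. i < n \<Longrightarrow> (X i, X (Suc i)) \<in> arrows"
    unfolding trancl_power relpow_fun_conv by auto
  define f where "f j = (SOME f. f \<in> lmod_hom A (X (j - 1)) (X j) \<and> (\<exists>x\<in>carrier (X (j - 1)). f x \<noteq> \<zero>\<^bsub>X j\<^esub>))" for j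
  have "brick_cycle A n X f"
    unfolding brick_cycle_def
  proof (intro conjI allI impI ballI)
    show "X i \<in> bricks A" if "i \<le> n" for i
    proof (cases i)
      case 0
      then show ?thesis using n(4)[OF n(1)] reps_bricks by (auto simp: arrows_def)
    next
      case (Suc k)
      then show ?thesis using n(4)[of k] that reps_bricks by (auto simp: arrows_def)
    qed
    fix j assume "j \<in> {1..n}"
    then have a: "(X (j - 1), X j) \<in> arrows" using n(4)[of "j - 1"] by auto
    then have "\<exists>f. f \<in> lmod_hom A (X (j - 1)) (X j) \<and> (\<exists>x\<in>carrier (X (j - 1)). f x \<noteq> \<zero>\<^bsub>X j\<^esub>)"
      by (auto simp: arrows_def)
    from someI_ex[OF this] show "f j \<in> lmod_hom A (X (j - 1)) (X j)"
      "\<exists>x\<in>carrier (X (j - 1)). f j x \<noteq> \<zero>\<^bsub>X j\<^esub>" by (simp_all add: f_def)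
    have "\<not> lmod_isomorphic A (X (j - 1)) (X j)" using a uniq by (auto simp: arrows_def)
    then show "f j \<notin> lmod_iso A (X (j - 1)) (X j)" by (auto simp: lmod_isomorphic_def)
  qed (use n lmod_isomorphic_refl in auto)
  then show False using dir by (auto simp: brick_directed_def)
qed

text \<open>\<open>S\<close> is the smallest predecessor-closed set containing \<open>M'\<close>; it
  separates the two representatives because there is no path from \<open>N'\<close> to
  \<open>M'\<close>. The step to \<open>M\<close> and \<open>N\<close> uses closure of
  \<open>Free A S\<close> under submodules and of \<open>Tors A S\<close> under quotients.\<close>

lemma (in brick_reps) dim_vector_neq:
  assumes ac: "acyclic arrows" and rep: "M' \<in> Rp" "N' \<in> Rp" "(N', M') \<notin> arrows\<^sup>*"
    and M: "M \<in> bricks A" "lmod_isomorphic A M M'" and N: "N \<in> bricks A" "lmod_isomorphic A N' N"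
  shows "dim_vector A M \<noteq> dim_vector A N"
proof -
  define S where "S = {B \<in> Rp. (B, M') \<in> arrows\<^sup>*}"
  have S: "pred_closed S"
    unfolding pred_closed_def S_def by (auto simp: arrows_def intro: converse_rtrancl_into_rtrancl)
  note Sc = pred_closed_mod_cat[OF S]
  have MN: "M \<in> mod_cat A" "N \<in> mod_cat A" using M N by (auto simp: bricks_def)
  obtain f where f: "f \<in> lmod_iso A M M'" using M(2) by (auto simp: lmod_isomorphic_def)
  have "M' \<in> Free A S" using Free_mem[OF Sc] rep(1) by (simp add: S_def)
  then have "M \<in> Free A S"
    using f MN by (intro Free_sub[of M' A S M f]) (auto simp: lmod_iso_def bij_betw_def)
  moreover obtain g where g: "g \<in> lmod_iso A N' N" using N(2) by (auto simp: lmod_isomorphic_def)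
  have "N' \<in> Tors A S" using rep by (intro rep_in_Tors[OF S]) (auto simp: S_def)
  then have "N \<in> Tors A S"
    using g MN by (intro Tors_quotient[of N' A S N g]) (auto simp: lmod_iso_def bij_betw_def)
  ultimately show ?thesis
    using dim_vector_Tors_Free[OF Sc left_approx_exists[OF ac S] _ _ brick_nonzero[OF N(1)]] by blast
qed

theorem corollary1p11:
  fixes K :: "('k, 'r) ring_scheme" and A :: "('k, 'a, 's) module_scheme"
    and M N :: "('a, 'a list) module"
  assumes "fin_dim_algebra K A"
    and "brick_finite A"
    and "brick_directed A"
    and "M \<in> bricks A" and "N \<in> bricks A"
    and "\<not> lmod_isomorphic A M N"
  shows "dim_vector A M \<noteq> dim_vector A N"
proof -
  interpret fin_dim_algebra K A by fact
  have lm: "left_module A B" if "B \<in> bricks A" for B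
    using that mod_catD by (auto simp: bricks_def)
  define r where "r = {(X, Y). X \<in> bricks A \<and> Y \<in> bricks A \<and> lmod_isomorphic A X Y}"
  define rep where "rep C = (SOME X. X \<in> C)" for C :: "('a, 'a list) module set"
  \<comment> \<open>One brick is chosen from each isomorphism class, so brick-finiteness makes
    \<open>Rp\<close> finite and isomorphic members of \<open>Rp\<close> equal.\<close>
  define Rp where "Rp = rep ` (bricks A // r)"
  have r: "equiv (bricks A) r"
  proof (rule equivI)
    show "r \<subseteq> bricks A \<times> bricks A" by (auto simp: r_def)
    show "refl_on (bricks A) r" using lmod_isomorphic_refl by (auto simp: r_def refl_on_def)
    show "sym r" using lmod_isomorphic_sym lm by (auto simp: r_def intro!: symI)
    show "trans r" using lmod_isomorphic_trans by (auto simp: r_def intro!: transI)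
  qed
  have rep: "rep C \<in> C" if "C \<in> bricks A // r" for C
    unfolding rep_def using in_quotient_imp_non_empty[OF r that] by (simp add: some_in_eq)
  interpret brick_reps K A Rp
  proof
    show "finite Rp" using assms(2) by (simp add: Rp_def r_def brick_finite_def)
    show "Rp \<subseteq> bricks A"
      using rep in_quotient_imp_subset[OF r] by (fastforce simp: Rp_def)
    fix B assume B: "B \<in> bricks A"
    then have "(B, rep (r `` {B})) \<in> r" using rep[OF quotientI[OF B]] by simp
    then show "\<exists>B'\<in>Rp. lmod_isomorphic A B B'"
      using quotientI[OF B, of r] by (auto simp: r_def Rp_def)
  qed
  have "B = B'" if B: "B \<in> Rp" "B' \<in> Rp" "lmod_isomorphic A B B'" for B B'
  proof -
    obtain C C' where C: "C \<in> bricks A // r" "B = rep C" "C' \<in> bricks A // r" "B' = rep C'"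
      using B(1,2) by (auto simp: Rp_def)
    have "(B, B') \<in> r" using B reps_bricks by (auto simp: r_def)
    then have "C = C'" using quotient_eqI[OF r C(1,3) rep[OF C(1)] rep[OF C(3)]] C by simp
    then show ?thesis using C by simp
  qed
  then have ac: "acyclic arrows" by (rule acyclic_arrows[OF assms(3)])
  obtain M' N' where M': "M' \<in> Rp" "lmod_isomorphic A M M'" and N': "N' \<in> Rp" "lmod_isomorphic A N N'"
    using reps_complete assms(4,5) by metis
  have b: "M' \<in> bricks A" "N' \<in> bricks A" using M' N' reps_bricks by auto
  have M'': "lmod_isomorphic A M' M" and N'': "lmod_isomorphic A N' N"
    using lmod_isomorphic_sym lm b M' N' assms(4,5) by blast+
  have "M' \<noteq> N'" using lmod_isomorphic_trans[OF M'(2)] N'' assms(6) by blast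
  \<comment> \<open>Paths in both directions between the distinct representatives would compose to a
    closed path of positive length.\<close>
  then have "(N', M') \<notin> arrows\<^sup>* \<or> (M', N') \<notin> arrows\<^sup>*"
    using ac by (metis acyclic_def rtranclD trancl_rtrancl_trancl)
  then show ?thesis
    using dim_vector_neq[OF ac M'(1) N'(1) _ assms(4) M'(2) assms(5) N'']
      dim_vector_neq[OF ac N'(1) M'(1) _ assms(5) N'(2) assms(4) M''] by metis
qed

end
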